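(* Let $k$ be a field of arbitrary characteristic, let $G$ be a finite group acting linearly on a finite-dimensional $k$-vector space $V$, and let $\lambda: kG\otimes V\to kG$ and $\kappa: V\otimes V\to kG$ be $k$-linear maps with $\kappa$ alternating. The algebra $\mathcal{H}_{\lambda,\kappa}$ exhibits the PBW property if, and only if, the following conditions hold for all $g,h\in G$ and all $u,v,w\in V$: 1. $\lambda(gh,v)=\lambda(g,{}^hv)\,h+g\,\lambda(h,v)$ in $kG$. 2. $\kappa({}^gu,{}^gv)\,g-g\,\kappa(u,v)=\lambda(\lambda(g,v),u)-\lambda(\lambda(g,u),v)$ in $kG$. 3. $\lambda_h(g,v)\,({}^hu-{}^gu)=\lambda_h(g,u)\,({}^hv-{}^gv)$ in $V$. 4. $\kappa_g(u,v)({}^gw-w)+\kappa_g(v,w)({}^gu-u)+\kappa_g(w,u)({}^gv-v)=0$ in $V$. 5. $\lambda(\kappa(u,v),w)+\lambda(\kappa(v,w),u)+\lambda(\kappa(w,u),v)=0$ in $kG$.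
   Context: Notation: $\otimes=\otimes_k$; ${}^gv$ denotes the action of $g\in G$ on $v$; $\lambda(g,v)=\lambda(g\otimes v)$ and $\kappa(v,w)=\kappa(v\otimes w)$. The skew group algebra $S(V)\# G$ is the vector space $S(V)\otimes kG$ with product $(r\otimes g)(s\otimes h)=r({}^gs)\otimes gh$, where $S(V)$ is the symmetric algebra on $V$ and $G$ acts on it by the automorphisms extending its action on $V$. $\mathcal{H}_{\lambda,\kappa}$ is the associative unital $k$-algebra generated by a basis of $V$ together with the group algebra $kG$, subject to the relations in $kG$ and $vw-wv=\kappa(v,w)$, $gv-{}^gv\,g=\lambda(g,v)$ for all $v,w\in V$, $g\in G$ (the unit of $k$ is identified with the identity of $G$). It is filtered by $\deg v=1$ for $v\in V$ and $\deg g=0$ for $g\in G$. It exhibits the Poincaré–Birkhoff–Witt (PBW) property when its associated graded algebra satisfies $\mathrm{gr}(\mathcal{H}_{\lambda,\kappa})\cong S(V)\# G$ as graded algebras ($S(V)\# G$ is graded with $V$ in degree 1 and $G$ in degree 0); equivalently, when $\{v_1^{i_1}\cdots v_m^{i_m}g: i_j\in\mathbb{Z}_{\ge 0},\ g\in G\}$ is a $k$-basis of $\mathcal{H}_{\lambda,\kappa}$ for $v_1,\dots,v_m$ any basis of $V$. The $k$-linear component maps $\lambda_g:kG\otimes V\to k$ and $\kappa_g:V\otimes V\to k$ are defined by $\lambda(h,v)=\sum_{g\in G}\lambda_g(h,v)\,g$ and $\kappa(u,v)=\sum_{g\in G}\kappa_g(u,v)\,g$. *)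

theory Defs
  imports Complex_Main "HOL-Library.Poly_Mapping" "HOL-Algebra.QuotRing" "HOL-Algebra.Module"
begin

text \<open>
  Conventions. The finite group \<open>G\<close> is a type \<open>'g\<close> of the classes \<open>group_add\<close> (which is not assumed
  to be commutative) and \<open>finite\<close>; the product \<open>gh\<close> is therefore written \<open>g + h\<close> and the identity
  of \<open>G\<close> is \<open>0\<close>. In return the group algebra \<open>kG\<close> is the library's monoid algebra \<open>'g \<Rightarrow>\<^sub>0 'k\<close>
  with the convolution product: \<open>g \<in> kG\<close> is \<open>Poly_Mapping.single g 1\<close>, and the coefficient of
  \<open>g\<close> in \<open>a\<close> is \<open>lookup a g\<close>. A linear map out of a tensor product is given by the corresponding
  bilinear map.

  A \<open>k\<close>-algebra is a record of type \<open>('k, 'a) module\<close>: a ring together with a scalar multiplication.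
\<close>

section \<open>Linear data\<close>

definition pm_scale :: "'k::mult_zero \<Rightarrow> ('x \<Rightarrow>\<^sub>0 'k) \<Rightarrow> ('x \<Rightarrow>\<^sub>0 'k)" where
  "pm_scale c = Poly_Mapping.map ((*) c)"

definition bilinear_map ::
  "('k::field \<Rightarrow> 'a::ab_group_add \<Rightarrow> 'a) \<Rightarrow> ('k \<Rightarrow> 'b::ab_group_add \<Rightarrow> 'b) \<Rightarrow>
   ('k \<Rightarrow> 'c::ab_group_add \<Rightarrow> 'c) \<Rightarrow> ('a \<Rightarrow> 'b \<Rightarrow> 'c) \<Rightarrow> bool" where
  "bilinear_map sa sb sc f \<longleftrightarrow>
     (\<forall>x. Vector_Spaces.linear sb sc (f x)) \<and> (\<forall>y. Vector_Spaces.linear sa sc (\<lambda>x. f x y))"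

definition linear_action ::
  "('k::field \<Rightarrow> 'v::ab_group_add \<Rightarrow> 'v) \<Rightarrow> ('g::group_add \<Rightarrow> 'v \<Rightarrow> 'v) \<Rightarrow> bool" where
  "linear_action scale act \<longleftrightarrow>
     (\<forall>g. Vector_Spaces.linear scale scale (act g)) \<and>
     (\<forall>v. act 0 v = v) \<and> (\<forall>g h v. act (g + h) v = act g (act h v))"

abbreviation grp :: "'g \<Rightarrow> ('g \<Rightarrow>\<^sub>0 'k::{zero,one})" where
  "grp g \<equiv> Poly_Mapping.single g 1"


section \<open>Algebras given by generators and relations\<close>

text \<open>Words form the free monoid, so \<open>'x list \<Rightarrow>\<^sub>0 'k\<close> is the free associative unital algebra on \<open>'x\<close>.\<close>

instantiation list :: (type) monoid_add
begin
definition zero_list :: "'a list" where "zero_list = []"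
definition plus_list :: "'a list \<Rightarrow> 'a list \<Rightarrow> 'a list" where "plus_list = (@)"
instance by standard (simp_all add: zero_list_def plus_list_def)
end

definition free_alg :: "('k::comm_ring_1, 'x list \<Rightarrow>\<^sub>0 'k) module" where
  "free_alg = \<lparr>carrier = UNIV, mult = (*), one = 1, zero = 0, add = (+), smult = pm_scale\<rparr>"

abbreviation gen :: "'x \<Rightarrow> ('x list \<Rightarrow>\<^sub>0 'k::{zero,one})" where
  "gen x \<equiv> Poly_Mapping.single [x] 1"

definition alg_quot :: "('k, 'a) module \<Rightarrow> 'a set \<Rightarrow> ('k, 'a set) module" where
  "alg_quot A I = ring.extend (A Quot I)
     (module.fields (\<lambda>c X. \<Union>x\<in>X. I +>\<^bsub>A\<^esub> (c \<odot>\<^bsub>A\<^esub> x)))"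

definition rel_ideal :: "('x list \<Rightarrow>\<^sub>0 'k::comm_ring_1) set \<Rightarrow> ('x list \<Rightarrow>\<^sub>0 'k) set" where
  "rel_ideal R = Idl\<^bsub>free_alg\<^esub> R"

definition presented_alg ::
  "('x list \<Rightarrow>\<^sub>0 'k::comm_ring_1) set \<Rightarrow> ('k, ('x list \<Rightarrow>\<^sub>0 'k) set) module" where
  "presented_alg R = alg_quot free_alg (rel_ideal R)"

definition word_degree :: "('x \<Rightarrow> nat) \<Rightarrow> 'x list \<Rightarrow> nat" where
  "word_degree d w = sum_list (map d w)"

definition presented_filtration ::
  "('x \<Rightarrow> nat) \<Rightarrow> ('x list \<Rightarrow>\<^sub>0 'k::comm_ring_1) set \<Rightarrow> nat \<Rightarrow> ('x list \<Rightarrow>\<^sub>0 'k) set set" where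
  "presented_filtration d R n =
     (\<lambda>p. rel_ideal R +>\<^bsub>free_alg\<^esub> p) ` {p. \<forall>w \<in> Poly_Mapping.keys p. word_degree d w \<le> n}"

definition presented_grading ::
  "('x \<Rightarrow> nat) \<Rightarrow> ('x list \<Rightarrow>\<^sub>0 'k::comm_ring_1) set \<Rightarrow> nat \<Rightarrow> ('x list \<Rightarrow>\<^sub>0 'k) set set" where
  "presented_grading d R n =
     (\<lambda>p. rel_ideal R +>\<^bsub>free_alg\<^esub> p) ` {p. \<forall>w \<in> Poly_Mapping.keys p. word_degree d w = n}"


section \<open>Associated graded algebras and graded isomorphisms\<close>

text \<open>
  For a filtration \<open>F 0 \<subseteq> F 1 \<subseteq> \<dots>\<close> of an algebra \<open>A\<close>, \<open>filt_below A F n\<close> is \<open>F (n - 1)\<close> with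
  \<open>F (-1) = 0\<close>. An element of the direct sum of the quotients \<open>F n / F (n - 1)\<close> is a family \<open>a\<close> of
  cosets \<open>a n\<close> of \<open>F (n - 1)\<close> in \<open>F n\<close>, almost all of them the zero coset \<open>F (n - 1)\<close>.
\<close>

definition filt_below :: "('k, 'a) module \<Rightarrow> (nat \<Rightarrow> 'a set) \<Rightarrow> nat \<Rightarrow> 'a set" where
  "filt_below A F n = (case n of 0 \<Rightarrow> {\<zero>\<^bsub>A\<^esub>} | Suc m \<Rightarrow> F m)"

text \<open>
  The coset \<open>(a * b) n\<close> is the class of the sum over \<open>i \<le> n\<close> of the products \<open>x i \<otimes> y (n - i)\<close>, where
  \<open>x\<close> and \<open>y\<close> are any representatives of \<open>a\<close> and \<open>b\<close>; as in the definition of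
  \<^const>\<open>rcoset_mult\<close>, the union runs over all choices of representatives, which all give the same
  coset.
\<close>

definition assoc_graded ::
  "('k, 'a) module \<Rightarrow> (nat \<Rightarrow> 'a set) \<Rightarrow> ('k, nat \<Rightarrow> 'a set) module" where
  "assoc_graded A F = (let F' = filt_below A F in
     \<lparr>carrier = {a. (\<forall>n. \<exists>x \<in> F n. a n = F' n +>\<^bsub>A\<^esub> x) \<and> finite {n. a n \<noteq> F' n}},
      mult = (\<lambda>a b n. \<Union>x \<in> {x. \<forall>i. x i \<in> a i}. \<Union>y \<in> {y. \<forall>i. y i \<in> b i}.
                F' n +>\<^bsub>A\<^esub> (\<Oplus>\<^bsub>A\<^esub> i \<in> {..n}. x i \<otimes>\<^bsub>A\<^esub> y (n - i))),
      one = (\<lambda>n. if n = 0 then F' 0 +>\<^bsub>A\<^esub> \<one>\<^bsub>A\<^esub> else F' n),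
      zero = F',
      add = (\<lambda>a b n. a n <+>\<^bsub>A\<^esub> b n),
      smult = (\<lambda>c a n. \<Union>x \<in> a n. F' n +>\<^bsub>A\<^esub> (c \<odot>\<^bsub>A\<^esub> x))\<rparr>)"

definition assoc_graded_grading ::
  "('k, 'a) module \<Rightarrow> (nat \<Rightarrow> 'a set) \<Rightarrow> nat \<Rightarrow> (nat \<Rightarrow> 'a set) set" where
  "assoc_graded_grading A F n =
     {a \<in> carrier (assoc_graded A F). \<forall>m. m \<noteq> n \<longrightarrow> a m = filt_below A F m}"

definition graded_alg_isomorphic ::
  "('k, 'a) module \<Rightarrow> (nat \<Rightarrow> 'a set) \<Rightarrow> ('k, 'b) module \<Rightarrow> (nat \<Rightarrow> 'b set) \<Rightarrow> bool" where
  "graded_alg_isomorphic A dA B dB \<longleftrightarrow>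
     (\<exists>\<phi> \<in> ring_iso A B.
        (\<forall>c. \<forall>x \<in> carrier A. \<phi> (c \<odot>\<^bsub>A\<^esub> x) = c \<odot>\<^bsub>B\<^esub> \<phi> x) \<and> (\<forall>n. \<phi> ` dA n = dB n))"


section \<open>The symmetric algebra and the skew group algebra\<close>

text \<open>
  The generators are all vectors; the linear relations make the free algebra on the set \<open>V\<close> into
  the tensor algebra of the vector space \<open>V\<close>.
\<close>

definition linear_rels ::
  "('k::field \<Rightarrow> 'v::ab_group_add \<Rightarrow> 'v) \<Rightarrow> ('v \<Rightarrow> 'x) \<Rightarrow> ('x list \<Rightarrow>\<^sub>0 'k) set" where
  "linear_rels scale j =
     {gen (j (v + w)) - gen (j v) - gen (j w) | v w. True} \<union>
     {gen (j (scale c v)) - pm_scale c (gen (j v)) | c v. True}"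

definition symmetric_rels ::
  "('k::field \<Rightarrow> 'v::ab_group_add \<Rightarrow> 'v) \<Rightarrow> ('v list \<Rightarrow>\<^sub>0 'k) set" where
  "symmetric_rels scale =
     linear_rels scale id \<union> {gen v * gen w - gen w * gen v | v w. True}"

definition symmetric_alg ::
  "('k::field \<Rightarrow> 'v::ab_group_add \<Rightarrow> 'v) \<Rightarrow> ('k, ('v list \<Rightarrow>\<^sub>0 'k) set) module" where
  "symmetric_alg scale = presented_alg (symmetric_rels scale)"

definition symmetric_grading ::
  "('k::field \<Rightarrow> 'v::ab_group_add \<Rightarrow> 'v) \<Rightarrow> nat \<Rightarrow> ('v list \<Rightarrow>\<^sub>0 'k) set set" where
  "symmetric_grading scale = presented_grading (\<lambda>_. 1) (symmetric_rels scale)"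

definition free_alg_map :: "('x \<Rightarrow> 'y) \<Rightarrow> ('x list \<Rightarrow>\<^sub>0 'k::comm_ring_1) \<Rightarrow> ('y list \<Rightarrow>\<^sub>0 'k)" where
  "free_alg_map f p =
     (\<Sum>w \<in> Poly_Mapping.keys p. Poly_Mapping.single (map f w) (Poly_Mapping.lookup p w))"

text \<open>
  The automorphism of the free algebra that extends \<open>v \<mapsto> \<^sup>gv\<close> maps the ideal of relations
  onto itself, so the image of a coset is the coset that the induced automorphism of \<open>S(V)\<close>
  assigns to it.
\<close>

definition symmetric_action ::
  "('g \<Rightarrow> 'v \<Rightarrow> 'v) \<Rightarrow> 'g \<Rightarrow> ('v list \<Rightarrow>\<^sub>0 'k::comm_ring_1) set \<Rightarrow> ('v list \<Rightarrow>\<^sub>0 'k) set" where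
  "symmetric_action act g X = free_alg_map (act g) ` X"

text \<open>
  As \<open>G\<close> is a finite basis of \<open>kG\<close>, an element of \<open>S \<otimes> kG\<close> is a sum of terms \<open>r g \<otimes> g\<close> with
  unique \<open>r g \<in> S\<close>; it is represented by the function \<open>r\<close>. The product is
  the bilinear extension of \<open>(r \<otimes> g)(s \<otimes> h) = r(\<^sup>gs) \<otimes> gh\<close>.
\<close>

definition skew_group_alg ::
  "('k, 'a) module \<Rightarrow> ('g::{group_add,finite} \<Rightarrow> 'a \<Rightarrow> 'a) \<Rightarrow> ('k, 'g \<Rightarrow> 'a) module" where
  "skew_group_alg S \<sigma> =
     \<lparr>carrier = {r. \<forall>g. r g \<in> carrier S},
      mult = (\<lambda>r s x. finsum S (\<lambda>(g, h). r g \<otimes>\<^bsub>S\<^esub> \<sigma> g (s h)) {(g, h). g + h = x}),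
      one = (\<lambda>g. if g = 0 then \<one>\<^bsub>S\<^esub> else \<zero>\<^bsub>S\<^esub>),
      zero = (\<lambda>g. \<zero>\<^bsub>S\<^esub>),
      add = (\<lambda>r s g. r g \<oplus>\<^bsub>S\<^esub> s g),
      smult = (\<lambda>c r g. c \<odot>\<^bsub>S\<^esub> r g)\<rparr>"

definition skew_group_grading :: "(nat \<Rightarrow> 'a set) \<Rightarrow> nat \<Rightarrow> ('g \<Rightarrow> 'a) set" where
  "skew_group_grading dS n = {r. \<forall>g. r g \<in> dS n}"


section \<open>The algebra \<open>\<H>\<close> and the PBW property\<close>

text \<open>
  The generators are the vectors \<open>Inl v\<close> and the group elements \<open>Inr g\<close>. Modulo the linear
  relations, the vectors of any basis of \<open>V\<close> generate the others, and \<open>v\<close> stands for the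
  corresponding linear combination of them.
\<close>

definition group_alg_embed ::
  "('g::finite \<Rightarrow>\<^sub>0 'k::comm_ring_1) \<Rightarrow> (('v + 'g) list \<Rightarrow>\<^sub>0 'k)" where
  "group_alg_embed a = (\<Sum>g \<in> UNIV. pm_scale (Poly_Mapping.lookup a g) (gen (Inr g)))"

definition H_rels ::
  "('k::field \<Rightarrow> 'v::ab_group_add \<Rightarrow> 'v) \<Rightarrow> ('g::{group_add,finite} \<Rightarrow> 'v \<Rightarrow> 'v) \<Rightarrow>
   (('g \<Rightarrow>\<^sub>0 'k) \<Rightarrow> 'v \<Rightarrow> ('g \<Rightarrow>\<^sub>0 'k)) \<Rightarrow> ('v \<Rightarrow> 'v \<Rightarrow> ('g \<Rightarrow>\<^sub>0 'k)) \<Rightarrow>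
   (('v + 'g) list \<Rightarrow>\<^sub>0 'k) set" where
  "H_rels scale act lam kap =
     linear_rels scale Inl \<union>
     {gen (Inr g) * gen (Inr h) - gen (Inr (g + h)) | g h. True} \<union>
     {gen (Inr 0) - 1} \<union>
     {gen (Inl v) * gen (Inl w) - gen (Inl w) * gen (Inl v) - group_alg_embed (kap v w) | v w. True} \<union>
     {gen (Inr g) * gen (Inl v) - gen (Inl (act g v)) * gen (Inr g) - group_alg_embed (lam (grp g) v)
       | g v. True}"

definition H_alg ::
  "('k::field \<Rightarrow> 'v::ab_group_add \<Rightarrow> 'v) \<Rightarrow> ('g::{group_add,finite} \<Rightarrow> 'v \<Rightarrow> 'v) \<Rightarrow>
   (('g \<Rightarrow>\<^sub>0 'k) \<Rightarrow> 'v \<Rightarrow> ('g \<Rightarrow>\<^sub>0 'k)) \<Rightarrow> ('v \<Rightarrow> 'v \<Rightarrow> ('g \<Rightarrow>\<^sub>0 'k)) \<Rightarrow>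
   ('k, (('v + 'g) list \<Rightarrow>\<^sub>0 'k) set) module" where
  "H_alg scale act lam kap = presented_alg (H_rels scale act lam kap)"

definition H_filtration ::
  "('k::field \<Rightarrow> 'v::ab_group_add \<Rightarrow> 'v) \<Rightarrow> ('g::{group_add,finite} \<Rightarrow> 'v \<Rightarrow> 'v) \<Rightarrow>
   (('g \<Rightarrow>\<^sub>0 'k) \<Rightarrow> 'v \<Rightarrow> ('g \<Rightarrow>\<^sub>0 'k)) \<Rightarrow> ('v \<Rightarrow> 'v \<Rightarrow> ('g \<Rightarrow>\<^sub>0 'k)) \<Rightarrow>
   nat \<Rightarrow> (('v + 'g) list \<Rightarrow>\<^sub>0 'k) set set" where
  "H_filtration scale act lam kap =
     presented_filtration (case_sum (\<lambda>_. 1) (\<lambda>_. 0)) (H_rels scale act lam kap)"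

definition PBW_property ::
  "('k::field \<Rightarrow> 'v::ab_group_add \<Rightarrow> 'v) \<Rightarrow> ('g::{group_add,finite} \<Rightarrow> 'v \<Rightarrow> 'v) \<Rightarrow>
   (('g \<Rightarrow>\<^sub>0 'k) \<Rightarrow> 'v \<Rightarrow> ('g \<Rightarrow>\<^sub>0 'k)) \<Rightarrow> ('v \<Rightarrow> 'v \<Rightarrow> ('g \<Rightarrow>\<^sub>0 'k)) \<Rightarrow> bool" where
  "PBW_property scale act lam kap \<longleftrightarrow>
     graded_alg_isomorphic
       (assoc_graded (H_alg scale act lam kap) (H_filtration scale act lam kap))
       (assoc_graded_grading (H_alg scale act lam kap) (H_filtration scale act lam kap))
       (skew_group_alg (symmetric_alg scale) (symmetric_action act :: 'g \<Rightarrow> _))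
       (skew_group_grading (symmetric_grading scale))"

end

(*
Left multiplication makes T(V) (x) kG a module over the free algebra on V and G: g is moved past letters by
gv = (^g v) g + lambda(g,v), and condition 1 makes this an action of G. By conditions 2 and 3 the span J of the
elements x (vw - wv - kappa(v,w)) m is a submodule, so the relations of H annihilate the quotient by J. Sorting
words in a basis of V and resolving the overlaps of descents with conditions 4 and 5 (a diamond lemma) shows
that an element of J of degree n is a combination of generators of degree at most n. Hence the leading part of
every relation in H is a relation in S(V)#G, which is the PBW property.

Conversely, words can always be sorted modulo lower degree, so S(V)#G maps onto gr(H). A graded isomorphism then
turns the finite-dimensional components of degree 0 and 1 into targets of surjective endomorphisms, which are
injective; so kG and V (x) kG + kG embed into H. The conditions are read off from (gh)v = g(hv), from
g(uv - vu) and from the Jacobi identity for commutators in H.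
*)
theory Submission
  imports Defs
begin

text \<open>The obstacle in the sufficiency proof is cancellation: a relation of low degree may be a
  combination of long ones whose leading parts cancel. Hence \<open>J n\<close> is indexed by the
  length of the generators used, not by the degree of the resulting elements, and reconciling the
  two indices (\<open>J_degree\<close>) is the heart of that direction. The module is built on
  \<open>T(V) \<otimes> kG\<close> because there the action of G is a plain recursion on words that
  can be checked before conditions 4 and 5 enter. Its words are kept in a basis so that the linear
  relations of V hold exactly, not merely modulo something. Both gr(H) and S(V)#G are treated as
  images of one free algebra graded by the number of vector letters. Every structural property is
  inherited from it, and the isomorphism amounts to the equality of two kernels. In the other
  direction the given graded isomorphism need not be the canonical map, so it says nothing about
  individual generators. Only dimensions can be extracted from it, and this is where the finiteness
  of G and of dim V enters.\<close>

abbreviation "lookup \<equiv> Poly_Mapping.lookup"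
abbreviation "keys \<equiv> Poly_Mapping.keys"
abbreviation "single \<equiv> Poly_Mapping.single"

section \<open>Linear maps out of spaces of finitely supported functions\<close>

lemma lookup_pm_scale [simp]: "lookup (pm_scale c p) x = c * lookup p x"
  for c :: "'k::mult_zero"
  by (simp add: pm_scale_def map.rep_eq when_def)

interpretation pm: vector_space "pm_scale :: 'k::field \<Rightarrow> ('x \<Rightarrow>\<^sub>0 'k) \<Rightarrow> _"
  by unfold_locales (auto intro!: poly_mapping_eqI simp: lookup_add algebra_simps)

lemma pm_scale_single [simp]: "pm_scale c (single x d) = single x (c * d)"
  for c :: "'k::field"
  by (auto intro!: poly_mapping_eqI simp: lookup_single when_def)

lemma pm_scale_mult_left: "pm_scale c p * q = pm_scale c (p * q)"
  for p q :: "'x::monoid_add \<Rightarrow>\<^sub>0 'k::field"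
  by (simp add: pm_scale_def mult_map_scale_conv_mult mult.assoc)

text \<open>Scaling is left multiplication by \<open>single 0 c\<close>; centrality of these
  elements is what lets scalars leave the right factor of a product.\<close>

lemma single_zero_commute: "p * single 0 c = single 0 c * p"
  for p :: "'x::monoid_add \<Rightarrow>\<^sub>0 'k::field"
proof (induction p rule: update_induct)
  case (update f a b)
  have eq: "Poly_Mapping.update a b f = f + single a b"
    using update.hyps
    by (auto intro!: poly_mapping_eqI simp: lookup_update lookup_add lookup_single when_def in_keys_iff)
  show ?case
    using update.IH by (simp add: eq distrib_left distrib_right mult_single mult.commute)
qed simp

lemma pm_scale_mult_right: "p * pm_scale c q = pm_scale c (p * q)"
  for p q :: "'x::monoid_add \<Rightarrow>\<^sub>0 'k::field"
  by (simp add: pm_scale_def mult_map_scale_conv_mult flip: mult.assoc)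
     (simp add: single_zero_commute)

lemma poly_mapping_expand: "p = (\<Sum>x\<in>keys p. pm_scale (lookup p x) (single x 1))"
  for p :: "'x \<Rightarrow>\<^sub>0 'k::field"
proof (rule poly_mapping_eqI)
  fix y
  have "lookup (\<Sum>x\<in>keys p. pm_scale (lookup p x) (single x 1)) y
      = (\<Sum>x\<in>keys p. if x = y then lookup p y else 0)"
    unfolding lookup_sum by (rule sum.cong) (auto simp: lookup_single when_def)
  then show "lookup p y = lookup (\<Sum>x\<in>keys p. pm_scale (lookup p x) (single x 1)) y"
    by (simp add: in_keys_iff)
qed

lemma subspace_supp: "pm.subspace {p :: 'x \<Rightarrow>\<^sub>0 'k::field. keys p \<subseteq> X}"
proof (rule pm.subspaceI)
  fix p q :: "'x \<Rightarrow>\<^sub>0 'k" and c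
  assume p: "p \<in> {p. keys p \<subseteq> X}"
  then show "pm_scale c p \<in> {p. keys p \<subseteq> X}"
    by (auto simp: in_keys_iff)
  assume "q \<in> {p. keys p \<subseteq> X}"
  with p show "p + q \<in> {p. keys p \<subseteq> X}"
    using keys_add[of p q] by auto
qed simp

lemma linear_addD: "Vector_Spaces.linear s t f \<Longrightarrow> f (x + y) = f x + f y"
  by (simp add: Vector_Spaces.linear_iff)

lemma linear_scaleD: "Vector_Spaces.linear s t f \<Longrightarrow> f (s c x) = t c (f x)"
  by (simp add: Vector_Spaces.linear_iff)

lemma linear_zeroD: "Vector_Spaces.linear s t f \<Longrightarrow> f 0 = 0"
  by (metis add_cancel_right_right linear_addD)

lemma linear_diffD: "Vector_Spaces.linear s t f \<Longrightarrow> f (x - y) = f x - f y"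
  by (metis diff_add_cancel add_diff_cancel linear_addD)

lemma linear_uminusD: "Vector_Spaces.linear s t f \<Longrightarrow> f (- y) = - f y"
  by (metis diff_0 linear_diffD linear_zeroD)

lemma linear_sumD: "Vector_Spaces.linear s t f \<Longrightarrow> f (sum g A) = (\<Sum>x\<in>A. f (g x))"
  by (induction A rule: infinite_finite_induct) (simp_all add: linear_zeroD linear_addD)

lemma linear_pmI:
  fixes f :: "('x \<Rightarrow>\<^sub>0 'k::field) \<Rightarrow> ('y \<Rightarrow>\<^sub>0 'k)"
  assumes "\<And>p q. f (p + q) = f p + f q" "\<And>c p. f (pm_scale c p) = pm_scale c (f p)"
  shows "Vector_Spaces.linear pm_scale pm_scale f"
  using assms by (auto simp: Vector_Spaces.linear_iff intro: pm.vector_space_axioms)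

definition lin :: "('k::field \<Rightarrow> 'a::ab_group_add \<Rightarrow> 'a) \<Rightarrow> ('x \<Rightarrow> 'a) \<Rightarrow> ('x \<Rightarrow>\<^sub>0 'k) \<Rightarrow> 'a" where
  "lin s f p = (\<Sum>x\<in>keys p. s (lookup p x) (f x))"

abbreviation plin :: "('x \<Rightarrow> ('y \<Rightarrow>\<^sub>0 'k::field)) \<Rightarrow> ('x \<Rightarrow>\<^sub>0 'k) \<Rightarrow> ('y \<Rightarrow>\<^sub>0 'k)" where
  "plin \<equiv> lin pm_scale"

lemma lin_superset:
  assumes "vector_space s" "finite A" "keys p \<subseteq> A"
  shows "lin s f p = (\<Sum>x\<in>A. s (lookup p x) (f x))"
proof -
  interpret vector_space s by fact
  show ?thesis
    unfolding lin_def by (rule sum.mono_neutral_left) (use assms in \<open>auto simp: in_keys_iff\<close>)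
qed

lemma linear_lin:
  assumes "vector_space s"
  shows "Vector_Spaces.linear pm_scale s (lin s f)"
proof -
  interpret vector_space s by fact
  have "lin s f (p + q) = lin s f p + lin s f q" for p q
  proof -
    let ?A = "keys p \<union> keys q"
    have "lin s f (p + q) = (\<Sum>x\<in>?A. s (lookup (p + q) x) (f x))"
      by (rule lin_superset[OF assms]) (auto simp: keys_add)
    also have "\<dots> = (\<Sum>x\<in>?A. s (lookup p x) (f x)) + (\<Sum>x\<in>?A. s (lookup q x) (f x))"
      by (simp add: lookup_add scale_left_distrib sum.distrib)
    also have "\<dots> = lin s f p + lin s f q"
      by (subst (1 2) lin_superset[OF assms]) auto
    finally show ?thesis .
  qed
  moreover have "lin s f (pm_scale c p) = s c (lin s f p)" for c p
  proof -
    have "lin s f (pm_scale c p) = (\<Sum>x\<in>keys p. s (lookup (pm_scale c p) x) (f x))"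
      by (rule lin_superset[OF assms]) (auto simp: in_keys_iff)
    then show ?thesis
      by (simp add: lin_def scale_sum_right)
  qed
  ultimately show ?thesis
    by (auto simp: Vector_Spaces.linear_iff pm.vector_space_axioms assms)
qed

lemmas linear_plin = linear_lin[OF pm.vector_space_axioms]

lemma lin_single:
  assumes "vector_space s"
  shows "lin s f (single x c) = s c (f x)"
proof -
  interpret vector_space s by fact
  show ?thesis by (simp add: lin_def)
qed

lemma plin_single [simp]: "plin f (single x c) = pm_scale c (f x)"
  by (simp add: lin_single pm.vector_space_axioms)

lemma plin_simps [simp]:
  "plin f (p + q) = plin f p + plin f q"
  "plin f (p - q) = plin f p - plin f q"
  "plin f (- p) = - plin f p"
  "plin f 0 = 0"
  "plin f (sum g A) = (\<Sum>x\<in>A. plin f (g x))"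
  "plin f (pm_scale c p) = pm_scale c (plin f p)"
  using linear_plin[of f]
  by (simp_all add: linear_addD linear_diffD linear_uminusD linear_zeroD linear_sumD linear_scaleD)

text \<open>The premise is limited to \<open>keys p\<close>, so a degree bound on \<open>p\<close>
  is available for each basis element. Most degree estimates below use this form.\<close>

lemma linear_mem:
  fixes p :: "'x \<Rightarrow>\<^sub>0 'k::field"
  assumes F: "Vector_Spaces.linear pm_scale s F" and S: "module.subspace s S"
    and "\<And>x. x \<in> keys p \<Longrightarrow> F (single x 1) \<in> S"
  shows "F p \<in> S"
proof -
  interpret vector_space s using F by (simp add: Vector_Spaces.linear_iff)
  have "F p = (\<Sum>x\<in>keys p. s (lookup p x) (F (single x 1)))"
    by (subst poly_mapping_expand[of p]) (simp only: linear_sumD[OF F] linear_scaleD[OF F])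
  also have "\<dots> \<in> S"
    using assms(3) S by (intro subspace_sum subspace_scale)
  finally show ?thesis .
qed

lemma linear_eq_on_keys:
  fixes p :: "'x \<Rightarrow>\<^sub>0 'k::field"
  assumes F: "Vector_Spaces.linear pm_scale s F" and G: "Vector_Spaces.linear pm_scale s G"
    and eq: "\<And>x. x \<in> keys p \<Longrightarrow> F (single x 1) = G (single x 1)"
  shows "F p = G p"
proof -
  interpret vector_space s using F by (simp add: Vector_Spaces.linear_iff)
  have "F p = (\<Sum>x\<in>keys p. s (lookup p x) (F (single x 1)))"
    by (subst poly_mapping_expand[of p]) (simp only: linear_sumD[OF F] linear_scaleD[OF F])
  also have "\<dots> = (\<Sum>x\<in>keys p. s (lookup p x) (G (single x 1)))"
    by (intro sum.cong) (simp_all add: eq)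
  also have "\<dots> = G p"
    by (subst (3) poly_mapping_expand[of p]) (simp only: linear_sumD[OF G] linear_scaleD[OF G])
  finally show ?thesis .
qed

lemma linear_mono_span:
  fixes F :: "('x \<Rightarrow>\<^sub>0 'k::field) \<Rightarrow> ('y \<Rightarrow>\<^sub>0 'k)"
  assumes F: "Vector_Spaces.linear pm_scale pm_scale F" and S: "pm.subspace S"
    and "\<And>x. x \<in> X \<Longrightarrow> F x \<in> S" "p \<in> pm.span X"
  shows "F p \<in> S"
  using assms(4)
proof (induction rule: pm.span_induct_alt)
  case base
  then show ?case using S F by (simp add: linear_zeroD pm.subspace_0)
next
  case (step c x y)
  then show ?case
    using S F assms(3) by (simp add: linear_addD linear_scaleD pm.subspace_add pm.subspace_scale)
qed

lemma linear_pm_add: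
  fixes f g :: "('x \<Rightarrow>\<^sub>0 'k::field) \<Rightarrow> ('y \<Rightarrow>\<^sub>0 'k)"
  assumes "Vector_Spaces.linear pm_scale pm_scale f" "Vector_Spaces.linear pm_scale pm_scale g"
  shows "Vector_Spaces.linear pm_scale pm_scale (\<lambda>p. f p + g p)"
  using assms by (intro linear_pmI) (simp_all add: linear_addD linear_scaleD pm.scale_right_distrib)

lemma linear_pm_diff:
  fixes f g :: "('x \<Rightarrow>\<^sub>0 'k::field) \<Rightarrow> ('y \<Rightarrow>\<^sub>0 'k)"
  assumes "Vector_Spaces.linear pm_scale pm_scale f" "Vector_Spaces.linear pm_scale pm_scale g"
  shows "Vector_Spaces.linear pm_scale pm_scale (\<lambda>p. f p - g p)"
  using assms by (intro linear_pmI) (simp_all add: linear_addD linear_scaleD pm.scale_right_diff_distrib)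

lemma linear_pm_scale:
  fixes f :: "('x \<Rightarrow>\<^sub>0 'k::field) \<Rightarrow> ('y \<Rightarrow>\<^sub>0 'k)"
  assumes "Vector_Spaces.linear pm_scale pm_scale f"
  shows "Vector_Spaces.linear pm_scale pm_scale (\<lambda>p. pm_scale c (f p))"
  using assms by (intro linear_pmI) (simp_all add: linear_addD linear_scaleD pm.scale_right_distrib mult.commute)

lemma linear_pm_sum:
  fixes f :: "'i \<Rightarrow> ('x \<Rightarrow>\<^sub>0 'k::field) \<Rightarrow> ('y \<Rightarrow>\<^sub>0 'k)"
  assumes "\<And>i. i \<in> A \<Longrightarrow> Vector_Spaces.linear pm_scale pm_scale (f i)"
  shows "Vector_Spaces.linear pm_scale pm_scale (\<lambda>p. \<Sum>i\<in>A. f i p)"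
  by (intro linear_pmI)
     (simp_all add: linear_addD[OF assms] linear_scaleD[OF assms] sum.distrib pm.scale_sum_right cong: sum.cong)

lemma linear_pm_comp:
  assumes "Vector_Spaces.linear s t f" "Vector_Spaces.linear t u g"
  shows "Vector_Spaces.linear s u (\<lambda>p. g (f p))"
  using assms by (auto simp: Vector_Spaces.linear_iff)

lemma linear_pm_id: "Vector_Spaces.linear pm_scale pm_scale (\<lambda>p :: 'x \<Rightarrow>\<^sub>0 'k::field. p)"
  by (intro linear_pmI) simp_all

lemma linear_mult_left: "Vector_Spaces.linear pm_scale pm_scale (\<lambda>p :: 'x::monoid_add \<Rightarrow>\<^sub>0 'k::field. q * p)"
  by (intro linear_pmI) (simp_all add: distrib_left pm_scale_mult_right)

lemma linear_mult_right: "Vector_Spaces.linear pm_scale pm_scale (\<lambda>p :: 'x::monoid_add \<Rightarrow>\<^sub>0 'k::field. p * q)"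
  by (intro linear_pmI) (simp_all add: distrib_right pm_scale_mult_left)

lemmas linear_pm_intros = linear_plin linear_pm_add linear_pm_diff linear_pm_scale linear_pm_sum
  linear_pm_id linear_mult_left linear_mult_right

lemma bilinear_eqI:
  fixes p :: "'x \<Rightarrow>\<^sub>0 'k::field" and q :: "'y \<Rightarrow>\<^sub>0 'k" and F G :: "_ \<Rightarrow> _ \<Rightarrow> ('z \<Rightarrow>\<^sub>0 'k)"
  assumes "\<And>q. Vector_Spaces.linear pm_scale pm_scale (\<lambda>p. F p q)"
    "\<And>x. Vector_Spaces.linear pm_scale pm_scale (\<lambda>q. F (single x 1) q)"
    "\<And>q. Vector_Spaces.linear pm_scale pm_scale (\<lambda>p. G p q)"
    "\<And>x. Vector_Spaces.linear pm_scale pm_scale (\<lambda>q. G (single x 1) q)"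
    "\<And>x y. x \<in> keys p \<Longrightarrow> y \<in> keys q \<Longrightarrow> F (single x 1) (single y 1) = G (single x 1) (single y 1)"
  shows "F p q = G p q"
  by (rule linear_eq_on_keys[OF assms(1,3)], rule linear_eq_on_keys[OF assms(2,4)]) (rule assms(5))

section \<open>Ideals of relations\<close>

lemma zero_list_eq [simp]: "(0 :: 'a list) = []"
  by (simp add: zero_list_def)

lemma plus_list_eq [simp]: "(v :: 'a list) + w = v @ w"
  by (simp add: plus_list_def)

lemma single_Nil [simp]: "single [] 1 = (1 :: 'a list \<Rightarrow>\<^sub>0 'k::zero_neq_one)"
  by (metis single_one zero_list_eq)

lemma gen_mult: "gen x * single w (c :: 'k::comm_ring_1) = single (x # w) c"
  by (simp add: mult_single)

lemma free_alg_simps [simp]: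
  "carrier free_alg = UNIV" "mult free_alg = (*)" "one free_alg = 1" "zero free_alg = 0"
  "add free_alg = (+)" "smult free_alg = pm_scale"
  by (simp_all add: free_alg_def)

lemma ring_free_alg: "ring (free_alg :: ('k::comm_ring_1, 'x list \<Rightarrow>\<^sub>0 'k) module)"
proof (rule ringI)
  have "\<exists>q. q + p = 0" for p :: "'x list \<Rightarrow>\<^sub>0 'k"
    using left_minus by blast
  then show "abelian_group (free_alg :: ('k, 'x list \<Rightarrow>\<^sub>0 'k) module)"
    by (intro abelian_groupI) (simp_all add: add.assoc add.commute)
  show "Group.monoid (free_alg :: ('k, 'x list \<Rightarrow>\<^sub>0 'k) module)"
    by (rule monoidI) (simp_all add: mult.assoc)
qed (simp_all add: distrib_left distrib_right)

lemma ideal_rel_ideal: "ideal (rel_ideal R) (free_alg :: ('k::comm_ring_1, 'x list \<Rightarrow>\<^sub>0 'k) module)"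
  unfolding rel_ideal_def by (rule ring.genideal_ideal[OF ring_free_alg]) simp

lemma rel_ideal_base: "r \<in> R \<Longrightarrow> r \<in> rel_ideal R"
  unfolding rel_ideal_def using ring.genideal_self[OF ring_free_alg, of R] by auto

lemma rel_ideal_zero [simp]: "0 \<in> rel_ideal R"
  using additive_subgroup.zero_closed[OF ideal.axioms(1)[OF ideal_rel_ideal, of R]] by simp

lemma rel_ideal_add: "p \<in> rel_ideal R \<Longrightarrow> q \<in> rel_ideal R \<Longrightarrow> p + q \<in> rel_ideal R"
  using additive_subgroup.a_closed[OF ideal.axioms(1)[OF ideal_rel_ideal, of R]] by simp

lemma rel_ideal_mult_left: "p \<in> rel_ideal R \<Longrightarrow> q * p \<in> rel_ideal R"
  using ideal.I_l_closed[OF ideal_rel_ideal, of p R q] by simp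

lemma rel_ideal_mult_right: "p \<in> rel_ideal R \<Longrightarrow> p * q \<in> rel_ideal R"
  using ideal.I_r_closed[OF ideal_rel_ideal, of p R q] by simp

lemma rel_ideal_uminus: "p \<in> rel_ideal R \<Longrightarrow> - p \<in> rel_ideal R"
  using rel_ideal_mult_left[of p R "- 1"] by simp

lemma rel_ideal_diff: "p \<in> rel_ideal R \<Longrightarrow> q \<in> rel_ideal R \<Longrightarrow> p - q \<in> rel_ideal R"
  using rel_ideal_add[OF _ rel_ideal_uminus, of p R q] by simp

lemma rel_ideal_scale: "p \<in> rel_ideal R \<Longrightarrow> pm_scale c p \<in> rel_ideal R"
  by (simp add: pm_scale_def mult_map_scale_conv_mult rel_ideal_mult_left)

lemma subspace_rel_ideal: "pm.subspace (rel_ideal R :: ('x list \<Rightarrow>\<^sub>0 'k::field) set)"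
  by (rule pm.subspaceI) (auto intro: rel_ideal_add rel_ideal_scale)

lemma rel_ideal_minimal:
  fixes K :: "('x list \<Rightarrow>\<^sub>0 'k::comm_ring_1) set"
  assumes "R \<subseteq> K" "0 \<in> K" "\<And>p q. p \<in> K \<Longrightarrow> q \<in> K \<Longrightarrow> p + q \<in> K"
    "\<And>p q. p \<in> K \<Longrightarrow> q * p \<in> K" "\<And>p q. p \<in> K \<Longrightarrow> p * q \<in> K"
  shows "rel_ideal R \<subseteq> K"
  unfolding rel_ideal_def
proof (rule ring.genideal_minimal[OF ring_free_alg _ assms(1)])
  have "- p \<in> K" if "p \<in> K" for p
    using assms(4)[OF that, of "- 1"] by simp
  moreover have "inv\<^bsub>add_monoid free_alg\<^esub> p = - p" for p :: "'x list \<Rightarrow>\<^sub>0 'k"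
  proof -
    have "\<ominus>\<^bsub>free_alg\<^esub> p = - p"
      using abelian_group.minus_equality[OF ring.is_abelian_group[OF ring_free_alg], of "- p" p] by simp
    then show ?thesis by (simp add: a_inv_def)
  qed
  ultimately have "subgroup K (add_monoid (free_alg :: ('k, 'x list \<Rightarrow>\<^sub>0 'k) module))"
    using assms(2,3)
    by (intro group.subgroupI[OF abelian_group.a_group[OF ring.is_abelian_group[OF ring_free_alg]]]) auto
  then show "ideal K free_alg"
    by (rule idealI[OF ring_free_alg]) (simp_all add: assms(4,5))
qed

text \<open>Every element is a linear combination of words and every word a product of letters, so
  for a subspace stability under letters on both sides is enough.\<close>

lemma rel_ideal_minimal_words:
  fixes K :: "('x list \<Rightarrow>\<^sub>0 'k::field) set"
  assumes "R \<subseteq> K" and K: "pm.subspace K"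
    and l: "\<And>p x. p \<in> K \<Longrightarrow> gen x * p \<in> K" and r: "\<And>p x. p \<in> K \<Longrightarrow> p * gen x \<in> K"
  shows "rel_ideal R \<subseteq> K"
proof (rule rel_ideal_minimal)
  have *: "single w 1 * p \<in> K \<and> p * single w 1 \<in> K" if "p \<in> K" for p w
    using that
  proof (induction w arbitrary: p)
    case Nil
    then show ?case by simp
  next
    case (Cons x w)
    have "single (x # w) 1 = gen x * single w (1::'k)"
      by (simp add: gen_mult)
    then show ?case
      using Cons.IH[OF Cons.prems] Cons.IH[OF r[OF Cons.prems]] l by (simp add: mult.assoc)
  qed
  show "q * p \<in> K" if "p \<in> K" for p q
    by (rule linear_mem[OF linear_mult_right K]) (use * that in auto)
  show "p * q \<in> K" if "p \<in> K" for p q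
    by (rule linear_mem[OF linear_mult_left K]) (use * that in auto)
qed (use assms in \<open>auto simp: pm.subspace_0 pm.subspace_add\<close>)

section \<open>The action on \<open>T(V) \<otimes> kG\<close>\<close>

locale skew_data = finite_dimensional_vector_space scale B
  for scale :: "'k::field \<Rightarrow> 'v::ab_group_add \<Rightarrow> 'v" and B :: "'v set" +
  fixes act :: "'g::{group_add,finite} \<Rightarrow> 'v \<Rightarrow> 'v"
    and lam :: "('g \<Rightarrow>\<^sub>0 'k) \<Rightarrow> 'v \<Rightarrow> ('g \<Rightarrow>\<^sub>0 'k)"
    and kap :: "'v \<Rightarrow> 'v \<Rightarrow> ('g \<Rightarrow>\<^sub>0 'k)"
  assumes linear_action: "linear_action scale act"
    and bilinear_lam: "bilinear_map pm_scale scale pm_scale lam"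
    and bilinear_kap: "bilinear_map scale scale pm_scale kap"
    and kap_self [simp]: "\<And>v. kap v v = 0"
begin

lemma act_linear: "Vector_Spaces.linear scale scale (act g)"
  and act_zero [simp]: "act 0 v = v"
  and act_plus: "act (g + h) v = act g (act h v)"
  using linear_action by (simp_all add: linear_action_def)

lemma lam_linear: "Vector_Spaces.linear pm_scale pm_scale (\<lambda>a. lam a v)" "Vector_Spaces.linear scale pm_scale (lam a)"
  using bilinear_lam by (simp_all add: bilinear_map_def)

lemma kap_linear: "Vector_Spaces.linear scale pm_scale (\<lambda>v. kap v w)" "Vector_Spaces.linear scale pm_scale (kap v)"
  using bilinear_kap by (simp_all add: bilinear_map_def)

text \<open>Polarisation of \<open>kap_self\<close> at \<open>v + w\<close>.\<close>

lemma kap_swap: "kap w v = - kap v w"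
proof -
  have "kap (v + w) (v + w) = kap v v + kap w v + (kap v w + kap w w)"
    by (simp only: linear_addD[OF kap_linear(1)] linear_addD[OF kap_linear(2)])
  then show ?thesis
    using minus_unique[of "kap v w" "kap w v"] by (simp add: add.commute)
qed

lemma expand_basis: "(\<Sum>b\<in>B. scale (representation B v b) b) = v"
  using sum_representation_eq[OF independent_Basis _ finite_Basis, of v] by (simp add: span_Basis)

text \<open>The basis vector \<open>single (w, h) 1\<close> stands for \<open>w \<otimes> h\<close>. In \<open>L v\<close> the vector \<open>v\<close> is expanded in
  the basis \<open>B\<close>, so the words that occur in the module are words in \<open>B\<close>.\<close>

definition cons_op :: "'v \<Rightarrow> ('v list \<times> 'g \<Rightarrow>\<^sub>0 'k) \<Rightarrow> ('v list \<times> 'g \<Rightarrow>\<^sub>0 'k)" where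
  "cons_op b = plin (\<lambda>(w, h). single (b # w, h) 1)"

definition L :: "'v \<Rightarrow> ('v list \<times> 'g \<Rightarrow>\<^sub>0 'k) \<Rightarrow> ('v list \<times> 'g \<Rightarrow>\<^sub>0 'k)" where
  "L v m = (\<Sum>b\<in>B. pm_scale (representation B v b) (cons_op b m))"

lemma L_linear: "Vector_Spaces.linear pm_scale pm_scale (L v)"
  unfolding L_def cons_op_def by (intro linear_pm_intros)

lemma L_linear_left: "Vector_Spaces.linear scale pm_scale (\<lambda>v. L v m)"
  using vector_space_axioms
  by (auto simp: Vector_Spaces.linear_iff pm.vector_space_axioms L_def representation_add[OF independent_Basis]
      representation_scale[OF independent_Basis] span_Basis pm.scale_left_distrib sum.distrib pm.scale_sum_right)

lemmas L_simps [simp] =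
  linear_addD[OF L_linear] linear_diffD[OF L_linear] linear_zeroD[OF L_linear]
  linear_scaleD[OF L_linear] linear_sumD[OF L_linear] linear_uminusD[OF L_linear]

lemmas L_left_simps =
  linear_addD[OF L_linear_left] linear_diffD[OF L_linear_left] linear_zeroD[OF L_linear_left]
  linear_scaleD[OF L_linear_left] linear_sumD[OF L_linear_left]

lemma L_basis: "b \<in> B \<Longrightarrow> L b m = cons_op b m"
proof -
  assume b: "b \<in> B"
  have "L b m = (\<Sum>b'\<in>B. if b' = b then cons_op b m else 0)"
    unfolding L_def
    by (rule sum.cong) (auto simp: representation_basis[OF independent_Basis b] if_distrib)
  then show ?thesis
    using b by (simp add: finite_Basis)
qed

lemma L_basis_single: "b \<in> B \<Longrightarrow> L b (single (w, h) c) = single (b # w, h) c"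
  by (simp add: L_basis cons_op_def)

text \<open>Left multiplication by \<open>g\<close>, moved past the letters one by one with \<open>gv = \<^sup>gv g + \<lambda>(g, v)\<close>.\<close>

primrec grp_op_word :: "'v list \<Rightarrow> 'g \<Rightarrow> 'g \<Rightarrow> ('v list \<times> 'g \<Rightarrow>\<^sub>0 'k)" where
  "grp_op_word [] g h = single ([], g + h) 1"
| "grp_op_word (v # w) g h = L (act g v) (grp_op_word w g h) + (\<Sum>x\<in>UNIV. pm_scale (lookup (lam (grp g) v) x) (grp_op_word w x h))"

definition grp_op :: "'g \<Rightarrow> ('v list \<times> 'g \<Rightarrow>\<^sub>0 'k) \<Rightarrow> ('v list \<times> 'g \<Rightarrow>\<^sub>0 'k)" where
  "grp_op g = plin (\<lambda>(w, h). grp_op_word w g h)"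

definition alg_op :: "('g \<Rightarrow>\<^sub>0 'k) \<Rightarrow> ('v list \<times> 'g \<Rightarrow>\<^sub>0 'k) \<Rightarrow> ('v list \<times> 'g \<Rightarrow>\<^sub>0 'k)" where
  "alg_op a m = (\<Sum>g\<in>UNIV. pm_scale (lookup a g) (grp_op g m))"

lemma grp_op_linear: "Vector_Spaces.linear pm_scale pm_scale (grp_op g)"
  unfolding grp_op_def by (rule linear_plin)

lemma alg_op_linear: "Vector_Spaces.linear pm_scale pm_scale (alg_op a)"
  unfolding alg_op_def by (intro linear_pm_intros grp_op_linear)

lemma alg_op_linear_left: "Vector_Spaces.linear pm_scale pm_scale (\<lambda>a. alg_op a m)"
  by (rule linear_pmI)
     (simp_all add: alg_op_def lookup_add pm.scale_left_distrib sum.distrib pm.scale_sum_right)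

lemmas grp_op_simps [simp] =
  linear_addD[OF grp_op_linear] linear_diffD[OF grp_op_linear] linear_zeroD[OF grp_op_linear]
  linear_scaleD[OF grp_op_linear] linear_sumD[OF grp_op_linear] linear_uminusD[OF grp_op_linear]

lemmas alg_op_simps [simp] =
  linear_addD[OF alg_op_linear] linear_diffD[OF alg_op_linear] linear_zeroD[OF alg_op_linear]
  linear_scaleD[OF alg_op_linear] linear_sumD[OF alg_op_linear] linear_uminusD[OF alg_op_linear]

lemmas alg_op_left_simps =
  linear_addD[OF alg_op_linear_left] linear_diffD[OF alg_op_linear_left] linear_zeroD[OF alg_op_linear_left]
  linear_scaleD[OF alg_op_linear_left] linear_sumD[OF alg_op_linear_left] linear_uminusD[OF alg_op_linear_left]

lemma alg_op_grp [simp]: "alg_op (grp g) m = grp_op g m"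
proof -
  have "alg_op (grp g) m = (\<Sum>x\<in>UNIV. if x = g then grp_op g m else 0)"
    unfolding alg_op_def by (rule sum.cong) (auto simp: lookup_single when_def)
  then show ?thesis by simp
qed

lemma grp_op_single [simp]: "grp_op g (single (w, h) c) = pm_scale c (grp_op_word w g h)"
  by (simp add: grp_op_def)

text \<open>For a basis vector this is the recursion of \<open>grp_op_word\<close>, since
  \<open>L\<close> then prepends a letter. Both sides are linear in \<open>v\<close>, so expansion
  in \<open>B\<close> gives the general case.\<close>

lemma grp_op_L: "grp_op g (L v m) = L (act g v) (grp_op g m) + alg_op (lam (grp g) v) m"
proof (rule linear_eq_on_keys[where p = m and F = "\<lambda>m. grp_op g (L v m)"
      and G = "\<lambda>m. L (act g v) (grp_op g m) + alg_op (lam (grp g) v) m"])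
  show "Vector_Spaces.linear pm_scale pm_scale (\<lambda>m. grp_op g (L v m))"
    using linear_pm_comp[OF L_linear grp_op_linear] .
  show "Vector_Spaces.linear pm_scale pm_scale (\<lambda>m. L (act g v) (grp_op g m) + alg_op (lam (grp g) v) m)"
    by (rule linear_pm_add[OF linear_pm_comp[OF grp_op_linear L_linear] alg_op_linear])
  fix x :: "'v list \<times> 'g"
  obtain w h where x: "x = (w, h)" by (cases x)
  have b: "grp_op g (L b (single x 1)) = L (act g b) (grp_op g (single x 1)) + alg_op (lam (grp g) b) (single x 1)"
    if "b \<in> B" for b
    using that by (simp add: x L_basis_single alg_op_def)
  have "grp_op g (L v (single x 1)) = (\<Sum>b\<in>B. pm_scale (representation B v b) (grp_op g (L b (single x 1))))"
    by (subst (1) expand_basis[of v, symmetric]) (simp add: L_left_simps)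
  also have "\<dots> = (\<Sum>b\<in>B. pm_scale (representation B v b) (L (act g b) (grp_op g (single x 1)) + alg_op (lam (grp g) b) (single x 1)))"
    by (intro sum.cong refl) (simp add: b)
  also have "\<dots> = L (act g (\<Sum>b\<in>B. scale (representation B v b) b)) (grp_op g (single x 1))
      + alg_op (lam (grp g) (\<Sum>b\<in>B. scale (representation B v b) b)) (single x 1)"
    by (simp add: linear_sumD[OF act_linear] linear_scaleD[OF act_linear] linear_sumD[OF lam_linear(2)]
        linear_scaleD[OF lam_linear(2)] L_left_simps alg_op_left_simps pm.scale_right_distrib sum.distrib)
  finally show "grp_op g (L v (single x 1)) = L (act g v) (grp_op g (single x 1)) + alg_op (lam (grp g) v) (single x 1)"
    by (simp only: expand_basis)
qed

lemma alg_op_L: "alg_op a (L v m) = (\<Sum>g\<in>UNIV. pm_scale (lookup a g) (L (act g v) (grp_op g m))) + alg_op (lam a v) m"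
proof -
  have "alg_op a (L v m) = (\<Sum>g\<in>UNIV. pm_scale (lookup a g) (L (act g v) (grp_op g m)))
      + (\<Sum>g\<in>UNIV. pm_scale (lookup a g) (alg_op (lam (grp g) v) m))"
    by (simp add: alg_op_def[of a] grp_op_L pm.scale_right_distrib sum.distrib)
  also have "(\<Sum>g\<in>UNIV. pm_scale (lookup a g) (alg_op (lam (grp g) v) m)) = alg_op (lam (\<Sum>g\<in>UNIV. pm_scale (lookup a g) (grp g)) v) m"
    by (simp only: linear_sumD[OF lam_linear(1)] linear_scaleD[OF lam_linear(1)] alg_op_left_simps)
  also have "(\<Sum>g\<in>UNIV. pm_scale (lookup a g) (grp g)) = a"
  proof -
    have "a = (\<Sum>g\<in>keys a. pm_scale (lookup a g) (grp g))"
      by (rule poly_mapping_expand)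
    also have "\<dots> = (\<Sum>g\<in>UNIV. pm_scale (lookup a g) (grp g))"
      by (rule sum.mono_neutral_left) (auto simp: in_keys_iff)
    finally show ?thesis by simp
  qed
  finally show ?thesis .
qed

text \<open>Letters must lie in \<open>B\<close> because only for them does \<open>L\<close> prepend
  the letter itself; the action is well behaved on such words.\<close>

definition words_le :: "nat \<Rightarrow> ('v list \<times> 'g \<Rightarrow>\<^sub>0 'k) set" where
  "words_le n = {m. keys m \<subseteq> {(w, h). set w \<subseteq> B \<and> length w \<le> n}}"

lemma subspace_words_le: "pm.subspace (words_le n)"
  unfolding words_le_def by (rule subspace_supp)

lemma words_le_mono: "m \<in> words_le k \<Longrightarrow> k \<le> n \<Longrightarrow> m \<in> words_le n"
  unfolding words_le_def by fastforce

lemma words_le_single: "set w \<subseteq> B \<Longrightarrow> length w \<le> n \<Longrightarrow> single (w, h) c \<in> words_le n"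
  by (auto simp: words_le_def split: if_splits)

lemma words_le_keys: "m \<in> words_le n \<Longrightarrow> (w, h) \<in> keys m \<Longrightarrow> set w \<subseteq> B \<and> length w \<le> n"
  by (auto simp: words_le_def)

lemma words_le_L: "m \<in> words_le n \<Longrightarrow> L v m \<in> words_le (Suc n)"
  unfolding L_def
proof (intro pm.subspace_sum pm.subspace_scale subspace_words_le)
  fix b assume m: "m \<in> words_le n" and b: "b \<in> B"
  show "cons_op b m \<in> words_le (Suc n)"
    unfolding cons_op_def
    by (rule linear_mem[OF linear_plin subspace_words_le]) (use words_le_keys[OF m] b in \<open>fastforce intro!: words_le_single\<close>)
qed

lemma grp_op_word_words_le: "grp_op_word w g h \<in> words_le (length w)"
proof (induction w arbitrary: g)
  case (Cons v w)
  have "grp_op_word w x h \<in> words_le (length (v # w))" for x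
    using words_le_mono[OF Cons, of "length (v # w)"] by simp
  then show ?case
    using words_le_L[OF Cons] by (auto intro!: pm.subspace_add pm.subspace_sum pm.subspace_scale subspace_words_le)
qed (simp add: words_le_single)

lemma words_le_grp_op:
  assumes "m \<in> words_le n"
  shows "grp_op g m \<in> words_le n"
  unfolding grp_op_def
  by (rule linear_mem[OF linear_plin subspace_words_le]) (use assms in \<open>auto dest: words_le_keys intro: words_le_mono[OF grp_op_word_words_le]\<close>)

lemma words_le_alg_op: "m \<in> words_le n \<Longrightarrow> alg_op a m \<in> words_le n"
  unfolding alg_op_def by (intro pm.subspace_sum pm.subspace_scale subspace_words_le words_le_grp_op)

lemma words_le_induct:
  assumes "m \<in> words_le n" "Vector_Spaces.linear pm_scale pm_scale F" "pm.subspace S"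
    "\<And>w h. set w \<subseteq> B \<Longrightarrow> length w \<le> n \<Longrightarrow> F (single (w, h) 1) \<in> S"
  shows "F m \<in> S"
  by (rule linear_mem[OF assms(2,3)]) (use assms(1,4) in \<open>auto dest: words_le_keys\<close>)

definition L_word :: "'v list \<Rightarrow> ('v list \<times> 'g \<Rightarrow>\<^sub>0 'k) \<Rightarrow> ('v list \<times> 'g \<Rightarrow>\<^sub>0 'k)" where
  "L_word w = foldr L w"

lemma L_word_simps [simp]: "L_word [] m = m" "L_word (v # w) m = L v (L_word w m)" "L_word (x @ y) m = L_word x (L_word y m)"
  by (simp_all add: L_word_def)

lemma L_word_linear: "Vector_Spaces.linear pm_scale pm_scale (L_word w)"
proof (induction w)
  case Nil
  then show ?case using linear_pm_id by (simp add: L_word_def id_def)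
next
  case (Cons v w)
  then show ?case using linear_pm_comp[OF Cons L_linear[of v]] by (simp add: L_word_def comp_def)
qed

lemmas L_word_linear_simps [simp] =
  linear_addD[OF L_word_linear] linear_diffD[OF L_word_linear] linear_zeroD[OF L_word_linear]
  linear_scaleD[OF L_word_linear] linear_sumD[OF L_word_linear] linear_uminusD[OF L_word_linear]

lemma L_word_single: "set x \<subseteq> B \<Longrightarrow> L_word x (single (w, h) c) = single (x @ w, h) c"
  by (induction x) (simp_all add: L_basis_single)

lemma words_le_L_word: "m \<in> words_le n \<Longrightarrow> L_word x m \<in> words_le (length x + n)"
  by (induction x) (simp_all add: words_le_L)

text \<open>The operator by which the relation \<open>vw - wv - kappa(v, w)\<close> of H acts on the
  module.\<close>

definition comm_op :: "'v \<Rightarrow> 'v \<Rightarrow> ('v list \<times> 'g \<Rightarrow>\<^sub>0 'k) \<Rightarrow> ('v list \<times> 'g \<Rightarrow>\<^sub>0 'k)" where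
  "comm_op v w m = L v (L w m) - L w (L v m) - alg_op (kap v w) m"

lemma comm_op_linear: "Vector_Spaces.linear pm_scale pm_scale (comm_op v w)"
  unfolding comm_op_def by (intro linear_pm_intros linear_pm_comp[OF L_linear] L_linear alg_op_linear)

lemma comm_op_linear1: "Vector_Spaces.linear scale pm_scale (\<lambda>v. comm_op v w m)"
  using vector_space_axioms
  by (auto simp: Vector_Spaces.linear_iff pm.vector_space_axioms comm_op_def L_left_simps alg_op_left_simps
      linear_addD[OF kap_linear(1)] linear_scaleD[OF kap_linear(1)] pm.scale_right_diff_distrib)

lemma comm_op_linear2: "Vector_Spaces.linear scale pm_scale (\<lambda>w. comm_op v w m)"
  using vector_space_axioms
  by (auto simp: Vector_Spaces.linear_iff pm.vector_space_axioms comm_op_def L_left_simps alg_op_left_simps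
      linear_addD[OF kap_linear(2)] linear_scaleD[OF kap_linear(2)] pm.scale_right_diff_distrib)

text \<open>The index bounds the total length of the generators used. An element of
  \<open>J n\<close> may have smaller degree than \<open>n\<close>, because leading terms can
  cancel.\<close>

definition J :: "nat \<Rightarrow> ('v list \<times> 'g \<Rightarrow>\<^sub>0 'k) set" where
  "J n = pm.span {L_word x (comm_op b c (single (z, h) 1)) | x b c z h.
     set x \<subseteq> B \<and> b \<in> B \<and> c \<in> B \<and> set z \<subseteq> B \<and> length x + 2 + length z \<le> n}"

lemma subspace_J [simp]: "pm.subspace (J n)"
  by (simp add: J_def)

lemma J_mono: "m \<in> J k \<Longrightarrow> k \<le> n \<Longrightarrow> m \<in> J n"
proof -
  assume a: "m \<in> J k" "k \<le> n"
  have "J k \<subseteq> J n"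
    unfolding J_def by (rule pm.span_mono) (use a(2) in fastforce)
  then show ?thesis using a(1) by blast
qed

lemma comm_op_basis_mem:
  assumes "m \<in> words_le k" "set x \<subseteq> B" "b \<in> B" "c \<in> B" "length x + 2 + k \<le> n"
  shows "L_word x (comm_op b c m) \<in> J n"
proof (rule words_le_induct[OF assms(1) linear_pm_comp[OF comm_op_linear L_word_linear] subspace_J])
  fix z and h :: 'g
  assume "set z \<subseteq> B" "length z \<le> k"
  then have "\<exists>x' b' c' z' h'. L_word x (comm_op b c (single (z, h) 1)) = L_word x' (comm_op b' c' (single (z', h') 1)) \<and>
      set x' \<subseteq> B \<and> b' \<in> B \<and> c' \<in> B \<and> set z' \<subseteq> B \<and> length x' + 2 + length z' \<le> n"
    using assms by (intro exI[of _ x] exI[of _ b] exI[of _ c] exI[of _ z] exI[of _ h]) auto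
  then show "L_word x (comm_op b c (single (z, h) 1)) \<in> J n"
    unfolding J_def by (intro pm.span_base) simp
qed

text \<open>The generators of \<open>J\<close> have basis vectors in both slots; bilinearity of
  \<open>comm_op\<close> in its two vectors extends membership to arbitrary ones.\<close>

lemma comm_op_mem:
  assumes "m \<in> words_le k" "set x \<subseteq> B" "length x + 2 + k \<le> n"
  shows "L_word x (comm_op v w m) \<in> J n"
proof -
  have "L_word x (comm_op v w m) = L_word x (comm_op (\<Sum>b\<in>B. scale (representation B v b) b) (\<Sum>c\<in>B. scale (representation B w c) c) m)"
    by (simp only: expand_basis)
  also have "\<dots> = (\<Sum>b\<in>B. pm_scale (representation B v b) (\<Sum>c\<in>B. pm_scale (representation B w c) (L_word x (comm_op b c m))))"
    by (simp add: linear_sumD[OF comm_op_linear1] linear_scaleD[OF comm_op_linear1] linear_sumD[OF comm_op_linear2]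
        linear_scaleD[OF comm_op_linear2] pm.scale_sum_right mult.commute) (rule sum.swap)
  also have "\<dots> \<in> J n"
    by (intro pm.subspace_sum pm.subspace_scale subspace_J comm_op_basis_mem[OF assms(1,2) _ _ assms(3)])
  finally show ?thesis .
qed

text \<open>Expanding \<open>v\<close> in \<open>B\<close> turns \<open>L v\<close> into a
  combination of prepended basis letters, each of which lengthens the prefix of a generator by
  one.\<close>

lemma J_L: assumes "m \<in> J n" shows "L v m \<in> J (Suc n)"
proof (rule linear_mono_span[OF L_linear subspace_J _ assms[unfolded J_def]], safe)
  fix x b c z h
  assume a: "set x \<subseteq> B" "b \<in> B" "c \<in> B" "set z \<subseteq> B" "length x + 2 + length z \<le> n"
  have "(\<Sum>b'\<in>B. pm_scale (representation B v b') (L_word (b' # x) (comm_op b c (single (z, h) 1)))) \<in> J (Suc n)"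
    by (intro pm.subspace_sum pm.subspace_scale subspace_J comm_op_basis_mem[OF words_le_single]) (use a in auto)
  then show "L v (L_word x (comm_op b c (single (z, h) 1))) \<in> J (Suc n)"
    unfolding L_def by (simp add: L_basis)
qed

lemma J_L_word: "m \<in> J n \<Longrightarrow> L_word x m \<in> J (length x + n)"
  by (induction x) (simp_all add: J_L)

end

section \<open>Conditions 1 to 3: G acts on the module and preserves the relation submodule\<close>

locale pbw_data = skew_data scale B act lam kap
  for scale :: "'k::field \<Rightarrow> 'v::ab_group_add \<Rightarrow> 'v" and B :: "'v set"
    and act :: "'g::{group_add,finite} \<Rightarrow> 'v \<Rightarrow> 'v"
    and lam :: "('g \<Rightarrow>\<^sub>0 'k) \<Rightarrow> 'v \<Rightarrow> ('g \<Rightarrow>\<^sub>0 'k)"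
    and kap :: "'v \<Rightarrow> 'v \<Rightarrow> ('g \<Rightarrow>\<^sub>0 'k)" +
  assumes cond1: "lam (grp (g + h)) v = lam (grp g) (act h v) * grp h + grp g * lam (grp h) v"
    and cond2: "kap (act g u) (act g v) * grp g - grp g * kap u v = lam (lam (grp g) v) u - lam (lam (grp g) u) v"
    and cond3: "scale (lookup (lam (grp g) v) h) (act h u - act g u) = scale (lookup (lam (grp g) u) h) (act h v - act g v)"
    and cond4: "scale (lookup (kap u v) g) (act g w - w) + scale (lookup (kap v w) g) (act g u - u)
        + scale (lookup (kap w u) g) (act g v - v) = 0"
    and cond5: "lam (kap u v) w + lam (kap v w) u + lam (kap w u) v = 0"
begin

text \<open>Condition 1 at the identity of G reads
  \<open>lam 1 v = lam 1 v + lam 1 v\<close>.\<close>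

lemma lam_one: "lam 1 v = 0"
  using cond1[of 0 0 v] by simp

lemma grp_op_word_zero: "set w \<subseteq> B \<Longrightarrow> grp_op_word w 0 h = single (w, h) 1"
  by (induction w) (simp_all add: lam_one L_basis_single)

text \<open>The hypothesis concerns a single \<open>m\<close>, so that the lemma can be used inside
  the induction on words that proves this very hypothesis.\<close>

lemma alg_op_alg_op_if:
  assumes "\<And>g h. grp_op g (grp_op h m) = grp_op (g + h) m"
  shows "alg_op a (alg_op b m) = alg_op (a * b) m"
proof (rule bilinear_eqI[where p = a and q = b])
  show "Vector_Spaces.linear pm_scale pm_scale (\<lambda>a. alg_op (a * q) m)" for q
    by (rule linear_pm_comp[OF linear_mult_right alg_op_linear_left])
  show "Vector_Spaces.linear pm_scale pm_scale (\<lambda>b. alg_op (grp x * b) m)" for x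
    by (rule linear_pm_comp[OF linear_mult_left alg_op_linear_left])
  show "Vector_Spaces.linear pm_scale pm_scale (\<lambda>b. alg_op (grp x) (alg_op b m))" for x
    by (rule linear_pm_comp[OF alg_op_linear_left alg_op_linear])
  show "alg_op (grp g) (alg_op (grp h) m) = alg_op (grp g * grp h) m" for g h
    by (simp add: assms mult_single)
qed (rule alg_op_linear_left)

text \<open>Moving \<open>h\<close> and then \<open>g\<close> past a first letter \<open>v\<close>
  leaves two correction terms. They act on the shorter word, where the induction hypothesis merges
  products in kG, and condition 1 identifies their sum with the correction for
  \<open>g + h\<close>.\<close>

lemma grp_op_grp_op: "grp_op g (grp_op h m) = grp_op (g + h) m"
proof (rule linear_eq_on_keys[where p = m and F = "\<lambda>m. grp_op g (grp_op h m)" and G = "grp_op (g + h)"])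
  fix x :: "'v list \<times> 'g"
  obtain w y where x: "x = (w, y)" by (cases x)
  show "grp_op g (grp_op h (single x 1)) = grp_op (g + h) (single x 1)"
    unfolding x
  proof (induction w arbitrary: g h)
    case Nil
    then show ?case by (simp add: add.assoc)
  next
    case (Cons v w)
    have alg_op: "alg_op a (alg_op b (single (w, y) 1)) = alg_op (a * b) (single (w, y) 1)" for a b
      by (rule alg_op_alg_op_if) (rule Cons)
    let ?m = "single (w, y) 1"
    have "grp_op g (grp_op h (single (v # w, y) 1))
        = grp_op g (L (act h v) (grp_op h ?m) + alg_op (lam (grp h) v) ?m)"
      by (simp add: alg_op_def)
    also have "\<dots> = L (act (g + h) v) (grp_op (g + h) ?m) + (alg_op (lam (grp g) (act h v) * grp h) ?m + alg_op (grp g * lam (grp h) v) ?m)"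
      using Cons[of g h] alg_op[of "grp g" "lam (grp h) v"] alg_op[of "lam (grp g) (act h v)" "grp h"]
      by (simp only: grp_op_simps grp_op_L act_plus alg_op_grp add.assoc)
    also have "\<dots> = L (act (g + h) v) (grp_op (g + h) ?m) + alg_op (lam (grp (g + h)) v) ?m"
      by (simp only: cond1 alg_op_left_simps)
    also have "\<dots> = grp_op (g + h) (single (v # w, y) 1)"
      by (simp add: alg_op_def)
    finally show ?case .
  qed
qed (rule linear_pm_comp[OF grp_op_linear grp_op_linear] grp_op_linear)+

lemma alg_op_alg_op: "alg_op a (alg_op b m) = alg_op (a * b) m"
  by (rule alg_op_alg_op_if) (rule grp_op_grp_op)

lemma alg_op_grp_op: "alg_op a (grp_op g m) = alg_op (a * grp g) m" "grp_op g (alg_op a m) = alg_op (grp g * a) m"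
  using alg_op_alg_op[of a "grp g" m] alg_op_alg_op[of "grp g" a m] by simp_all

text \<open>Moving \<open>g\<close> past both vectors yields the transformed commutator, terms with
  one vector, and terms in kG. Condition 3 cancels the second kind and condition 2 accounts for the
  third.\<close>

lemma grp_op_comm_op: "grp_op g (comm_op v w m) = comm_op (act g v) (act g w) (grp_op g m)"
proof -
  \<comment> \<open>The terms with one vector: condition 3 is applied separately to each group
    element \<open>h\<close> and then summed.\<close>
  have *: "(\<Sum>h\<in>UNIV. pm_scale (lookup (lam (grp g) v) h) (L (act h w) (grp_op h m)))
      + L (act g v) (alg_op (lam (grp g) w) m)
      = (\<Sum>h\<in>UNIV. pm_scale (lookup (lam (grp g) w) h) (L (act h v) (grp_op h m)))
      + L (act g w) (alg_op (lam (grp g) v) m)"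
  proof -
    have "pm_scale (lookup (lam (grp g) v) h) (L (act h w) (grp_op h m)) + pm_scale (lookup (lam (grp g) w) h) (L (act g v) (grp_op h m))
       = pm_scale (lookup (lam (grp g) w) h) (L (act h v) (grp_op h m)) + pm_scale (lookup (lam (grp g) v) h) (L (act g w) (grp_op h m))" for h
    proof -
      have "L (scale (lookup (lam (grp g) v) h) (act h w - act g w)) (grp_op h m)
         = L (scale (lookup (lam (grp g) w) h) (act h v - act g v)) (grp_op h m)"
        by (simp only: cond3)
      then show ?thesis
        by (simp add: L_left_simps pm.scale_right_diff_distrib algebra_simps)
    qed
    then show ?thesis
      by (simp add: alg_op_def flip: sum.distrib)
  qed
  have "grp_op g (comm_op v w m) = L (act g v) (L (act g w) (grp_op g m)) - L (act g w) (L (act g v) (grp_op g m))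
     + (alg_op (lam (lam (grp g) v) w) m - alg_op (lam (lam (grp g) w) v) m - alg_op (grp g * kap v w) m)"
    using * by (simp add: comm_op_def grp_op_L alg_op_L alg_op_grp_op algebra_simps)
  also have "alg_op (lam (lam (grp g) v) w) m - alg_op (lam (lam (grp g) w) v) m - alg_op (grp g * kap v w) m
     = - alg_op (kap (act g v) (act g w) * grp g) m"
  proof -
    have E: "kap (act g v) (act g w) * grp g = grp g * kap v w + (lam (lam (grp g) w) v - lam (lam (grp g) v) w)"
      using cond2[of g v w] by (simp add: diff_eq_eq add.commute)
    show ?thesis
      unfolding E by (simp add: alg_op_left_simps)
  qed
  finally show ?thesis
    by (simp add: comm_op_def alg_op_grp_op)
qed

text \<open>Induction on the prefix \<open>x\<close>. A letter passed by \<open>g\<close> either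
  survives as \<open>act g v\<close> or disappears into \<open>lam\<close>, so lengths never grow;
  once the prefix is exhausted, \<open>grp_op_comm_op\<close> applies.\<close>

lemma J_grp_op:
  assumes "m \<in> J n"
  shows "grp_op g m \<in> J n"
proof (rule linear_mono_span[OF grp_op_linear subspace_J _ assms[unfolded J_def]], safe)
  fix x b c z h
  assume a: "set x \<subseteq> B" "b \<in> B" "c \<in> B" "set z \<subseteq> B" "length x + 2 + length z \<le> n"
  let ?r = "comm_op b c (single (z, h) 1)"
  have "grp_op g (L_word x ?r) \<in> J (length x + 2 + length z)"
    using a(1)
  proof (induction x arbitrary: g)
    case Nil
    have "L_word [] (comm_op (act g b) (act g c) (grp_op g (single (z, h) 1))) \<in> J (2 + length z)"
      by (rule comm_op_mem[OF words_le_grp_op[OF words_le_single]]) (use a in auto)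
    then show ?case by (simp add: grp_op_comm_op)
  next
    case (Cons v x)
    have *: "grp_op y (L_word x ?r) \<in> J (length x + 2 + length z)" for y
      using Cons by simp
    have "alg_op (lam (grp g) v) (L_word x ?r) \<in> J (length x + 2 + length z)"
      unfolding alg_op_def by (intro pm.subspace_sum pm.subspace_scale subspace_J *)
    then have "alg_op (lam (grp g) v) (L_word x ?r) \<in> J (Suc (length x + 2 + length z))"
      by (rule J_mono) simp
    moreover have "L (act g v) (grp_op g (L_word x ?r)) \<in> J (Suc (length x + 2 + length z))"
      by (rule J_L) (rule *)
    ultimately show ?case
      by (simp add: grp_op_L pm.subspace_add)
  qed
  then show "grp_op g (L_word x ?r) \<in> J n"
    by (rule J_mono) (use a in simp)
qed

lemma J_alg_op: "m \<in> J n \<Longrightarrow> alg_op a m \<in> J n"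
  unfolding alg_op_def by (intro pm.subspace_sum pm.subspace_scale subspace_J J_grp_op)

end

section \<open>The relation submodule and leading terms\<close>

context skew_data
begin

text \<open>An arbitrary numbering of the basis; it supplies the total order by which words are
  sorted.\<close>

definition rank :: "'v \<Rightarrow> nat" where
  "rank = (SOME f. inj_on f B)"

lemma inj_rank: "inj_on rank B"
proof -
  obtain f :: "'v \<Rightarrow> nat" and n where "inj_on f B"
    using finite_imp_inj_to_nat_seg[OF finite_Basis] by blast
  then show ?thesis
    unfolding rank_def by (rule someI[of "\<lambda>f. inj_on f B"])
qed

primrec inversions :: "'v list \<Rightarrow> nat" where
  "inversions [] = 0"
| "inversions (v # w) = length (filter (\<lambda>u. rank u < rank v) w) + inversions w"

lemma inversions_swap: "rank c < rank b \<Longrightarrow> inversions (x @ b # c # y) = Suc (inversions (x @ c # b # y))"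
  by (induction x) auto

definition descent :: "'v list \<Rightarrow> nat \<Rightarrow> bool" where
  "descent w i \<longleftrightarrow> Suc i < length w \<and> rank (w ! Suc i) < rank (w ! i)"

lemma descent_decomp: "descent w i \<Longrightarrow> w = take i w @ w ! i # w ! Suc i # drop (i + 2) w"
  by (simp add: descent_def Cons_nth_drop_Suc)

text \<open>The lower-order correction picked up when a word is sorted by always exchanging the letters of its
  first descent.\<close>

function sort_corr :: "'v list \<Rightarrow> 'g \<Rightarrow> ('v list \<times> 'g \<Rightarrow>\<^sub>0 'k)" where
  "sort_corr w h = (if \<exists>i. descent w i then let i = LEAST i. descent w i in
     sort_corr (take i w @ w ! Suc i # w ! i # drop (i + 2) w) h +
       L_word (take i w) (alg_op (kap (w ! i) (w ! Suc i)) (single (drop (i + 2) w, h) 1)) else 0)"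
  by auto
termination
proof (relation "measure (inversions \<circ> fst)")
  fix w h i
  assume "\<exists>i. descent w i" "i = (LEAST i. descent w i)"
  then have d: "descent w i"
    by (metis LeastI)
  then have "inversions w = Suc (inversions (take i w @ w ! Suc i # w ! i # drop (i + 2) w))"
    by (subst descent_decomp[OF d], intro inversions_swap) (simp add: descent_def)
  then show "((take i w @ w ! Suc i # w ! i # drop (i + 2) w, h), w, h) \<in> measure (inversions \<circ> fst)"
    by simp
qed simp

declare sort_corr.simps [simp del]

lemma sort_corr_first:
  assumes "rank c < rank b"
  obtains x' b' c' y' where "x @ b # c # y = x' @ b' # c' # y'" "rank c' < rank b'" "length x' \<le> length x"
    "\<And>h. sort_corr (x @ b # c # y) h = sort_corr (x' @ c' # b' # y') h + L_word x' (alg_op (kap b' c') (single (y', h) 1))"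
proof -
  define w where "w = x @ b # c # y"
  have d: "descent w (length x)"
    using assms by (simp add: descent_def w_def nth_append)
  define i where "i = (LEAST i. descent w i)"
  have i: "descent w i" "i \<le> length x"
    unfolding i_def by (rule LeastI[of "descent w", OF d], rule Least_le[of "descent w", OF d])
  show thesis
  proof
    show "x @ b # c # y = take i w @ w ! i # w ! Suc i # drop (i + 2) w"
      using descent_decomp[OF i(1)] by (simp add: w_def)
    show "rank (w ! Suc i) < rank (w ! i)"
      using i(1) by (simp add: descent_def)
    show "length (take i w) \<le> length x"
      using i(2) by simp
    show "sort_corr (x @ b # c # y) h = sort_corr (take i w @ w ! Suc i # w ! i # drop (i + 2) w) h
        + L_word (take i w) (alg_op (kap (w ! i) (w ! Suc i)) (single (drop (i + 2) w, h) 1))" for h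
      unfolding w_def[symmetric] using i(1) by (subst sort_corr.simps) (auto simp: i_def[symmetric] Let_def)
  qed
qed

text \<open>What becomes of the generator \<open>L_word x (comm_op b c (single (y, h) 1))\<close>
  when its two leading words are replaced by their \<open>sort_corr\<close>. It measures the failure
  of the exchange of \<open>b\<close> and \<open>c\<close> to agree with the chosen sorting.\<close>

definition edge :: "'v list \<Rightarrow> 'v \<Rightarrow> 'v \<Rightarrow> 'v list \<Rightarrow> 'g \<Rightarrow> ('v list \<times> 'g \<Rightarrow>\<^sub>0 'k)" where
  "edge x b c y h = sort_corr (x @ b # c # y) h - sort_corr (x @ c # b # y) h - L_word x (alg_op (kap b c) (single (y, h) 1))"

lemma words_le_deg: "m \<in> words_le n \<Longrightarrow> keys m \<subseteq> {(w, h). length w \<le> n}"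
  by (auto simp: words_le_def)

definition top_part :: "nat \<Rightarrow> ('v list \<times> 'g \<Rightarrow>\<^sub>0 'k) \<Rightarrow> ('v list \<times> 'g \<Rightarrow>\<^sub>0 'k)" where
  "top_part n = plin (\<lambda>(w, h). if length w = n then single (w, h) 1 else 0)"

definition sort_top :: "nat \<Rightarrow> ('v list \<times> 'g \<Rightarrow>\<^sub>0 'k) \<Rightarrow> ('v list \<times> 'g \<Rightarrow>\<^sub>0 'k)" where
  "sort_top n = plin (\<lambda>(w, h). if length w = n then sort_corr w h else 0)"

lemma plin_low:
  assumes "keys m \<subseteq> {(w, h). length w < n}"
  shows "plin (\<lambda>(w, h). if length w = n then f w h else 0) m = 0"
  unfolding lin_def using assms by (intro sum.neutral) auto

lemma sort_top_top: "sort_top n m = sort_top n (top_part n m)"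
  by (rule linear_eq_on_keys[where p = m and F = "sort_top n" and G = "\<lambda>m. sort_top n (top_part n m)"])
     (auto simp: sort_top_def top_part_def intro: linear_plin linear_pm_comp[OF linear_plin linear_plin])

lemma J_words_le: "m \<in> J n \<Longrightarrow> m \<in> words_le n"
proof -
  have "L_word x (comm_op b c (single (z, h) 1)) \<in> words_le n"
    if a: "set x \<subseteq> B" "b \<in> B" "c \<in> B" "set z \<subseteq> B" "length x + 2 + length z \<le> n" for x b c z h
  proof (rule words_le_mono[OF words_le_L_word[of _ "2 + length z"]])
    have s: "single (z, h) 1 \<in> words_le (length z)"
      by (rule words_le_single) (use a in auto)
    show "comm_op b c (single (z, h) 1) \<in> words_le (2 + length z)"
      unfolding comm_op_def using words_le_L[OF words_le_L[OF s]] words_le_mono[OF words_le_alg_op[OF s], of "2 + length z"]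
      by (intro pm.subspace_diff subspace_words_le) auto
  qed (use a in auto)
  then have "J n \<subseteq> words_le n"
    unfolding J_def by (intro pm.span_minimal subspace_words_le) auto
  then show "m \<in> J n \<Longrightarrow> m \<in> words_le n" by blast
qed

end

section \<open>Conditions 4 and 5: resolving overlaps and bounding the length of relations by
  degree\<close>

context pbw_data
begin

text \<open>Moving kG past a vector leaves a part \<open>L _ (grp_op g m)\<close> for each
  \<open>g\<close>, which vanishes in the cyclic sum by condition 4, and a part in kG, which
  vanishes by condition 5.\<close>

lemma jacobi:
  "alg_op (kap a b) (L c m) - L c (alg_op (kap a b) m) + (alg_op (kap b c) (L a m) - L a (alg_op (kap b c) m))
    + (alg_op (kap c a) (L b m) - L b (alg_op (kap c a) m)) = 0"
proof -
  have *: "alg_op (kap a b) (L c m) - L c (alg_op (kap a b) m)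
      = (\<Sum>g\<in>UNIV. L (scale (lookup (kap a b) g) (act g c - c)) (grp_op g m)) + alg_op (lam (kap a b) c) m" for a b c
  proof -
    have "L c (alg_op (kap a b) m) = (\<Sum>g\<in>UNIV. pm_scale (lookup (kap a b) g) (L c (grp_op g m)))"
      by (simp add: alg_op_def)
    then show ?thesis
      by (simp add: alg_op_L L_left_simps pm.scale_right_diff_distrib sum_subtractf)
  qed
  have "alg_op (kap a b) (L c m) - L c (alg_op (kap a b) m) + (alg_op (kap b c) (L a m) - L a (alg_op (kap b c) m))
    + (alg_op (kap c a) (L b m) - L b (alg_op (kap c a) m))
    = (\<Sum>g\<in>UNIV. L (scale (lookup (kap a b) g) (act g c - c) + scale (lookup (kap b c) g) (act g a - a)
         + scale (lookup (kap c a) g) (act g b - b)) (grp_op g m))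
      + alg_op (lam (kap a b) c + lam (kap b c) a + lam (kap c a) b) m"
    unfolding * by (simp only: L_left_simps(1) alg_op_left_simps(1) sum.distrib) (simp add: algebra_simps)
  then show ?thesis
    by (simp only: cond4 cond5) (simp add: L_left_simps alg_op_left_simps)
qed

text \<open>The diamond lemma. The claim compares sorting \<open>x b c y\<close> at an arbitrary descent with sorting it at its
  first one. If the two descents are disjoint, the difference consists of shorter relations, because
  \<open>J\<close> is stable under \<open>alg_op\<close>; if they overlap, it vanishes by the Jacobi identity.\<close>

lemma edge_descent:
  "rank c < rank b \<Longrightarrow> set x \<subseteq> B \<Longrightarrow> b \<in> B \<Longrightarrow> c \<in> B \<Longrightarrow> set y \<subseteq> B \<Longrightarrow>
    edge x b c y h \<in> J (Suc (length x + length y))"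
proof (induction "inversions (x @ b # c # y)" arbitrary: x b c y rule: less_induct)
  case less
  note IH = less.hyps
  obtain x' b' c' y' where eq: "x @ b # c # y = x' @ b' # c' # y'" and d: "rank c' < rank b'"
    and len: "length x' \<le> length x"
    and sort_corr: "\<And>h. sort_corr (x @ b # c # y) h = sort_corr (x' @ c' # b' # y') h + L_word x' (alg_op (kap b' c') (single (y', h) 1))"
    using sort_corr_first[OF less.prems(1)] by metis
  \<comment> \<open>The first descent coincides with the given one, shares its letter
    \<open>b\<close>, or ends before it.\<close>
  consider "x = x'" | "x = x' @ [b']" | u where "x = x' @ b' # c' # u"
  proof -
    from eq len obtain u where u: "x = x' @ u" "u @ b # c # y = b' # c' # y'"
      by (auto simp: append_eq_append_conv2)
    show thesis
    proof (cases u)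
      case Nil
      then show ?thesis using u that by simp
    next
      case (Cons e u')
      then show ?thesis using u that by (cases u') auto
    qed
  qed
  then show ?case
  proof cases
    case 1
    then show ?thesis
      using sort_corr eq by (simp add: edge_def pm.subspace_0)
  next
    case 2
    then have c: "b = c'" "c # y = y'" using eq by auto
    let ?s = "single (y, h) 1" and ?N = "Suc (length x + length y)"
    have lt: "rank c < rank b'" using d less.prems(1) c by simp
    have sub: "set x' \<subseteq> B" "b' \<in> B" using less.prems 2 by auto
    have n1: "inversions (x' @ b' # b # c # y) = Suc (inversions (x' @ b # b' # c # y))"
      using inversions_swap[of b b' x' "c # y"] d c by simp
    have n2: "inversions (x' @ b' # b # c # y) = Suc (inversions (x' @ b' # c # b # y))"
      using inversions_swap[of c b "x' @ [b']" y] less.prems by simp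
    have n3: "inversions (x' @ b # b' # c # y) = Suc (inversions (x' @ b # c # b' # y))"
      using inversions_swap[of c b' "x' @ [b]" y] lt by simp
    have n4: "inversions (x' @ b' # c # b # y) = Suc (inversions (x' @ c # b' # b # y))"
      using inversions_swap[of c b' x' "b # y"] lt by simp
    \<comment> \<open>The overlap \<open>b' b c\<close> is a hexagon. Besides the two exchanges at
      the top, its sides are \<open>b b' c\<close> to \<open>b c b'\<close> to
      \<open>c b b'\<close>, and \<open>b' c b\<close> to \<open>c b' b\<close> to
      \<open>c b b'\<close>. Each of these four starts at a word with fewer inversions than the
      given one.\<close>
    have e1: "edge (x' @ [b]) b' c y h \<in> J ?N"
      using IH[of "x' @ [b]" b' c y] n1 lt sub less.prems 2 by simp
    have e2: "edge x' b c (b' # y) h \<in> J ?N"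
      using IH[of x' b c "b' # y"] n1 n3 lt sub less.prems 2 by simp
    have e3: "edge x' b' c (b # y) h \<in> J ?N"
      using IH[of x' b' c "b # y"] n2 lt sub less.prems 2 by simp
    have e4: "edge (x' @ [c]) b' b y h \<in> J ?N"
      using IH[of "x' @ [c]" b' b y] n2 n4 d c lt sub less.prems 2 by simp
    \<comment> \<open>Around the hexagon the values of \<open>sort_corr\<close> telescope; the
      corrections that remain are the left side of \<open>jacobi\<close> for \<open>b'\<close>,
      \<open>b\<close>, \<open>c\<close>.\<close>
    have "edge x b c y h = edge (x' @ [b]) b' c y h + edge x' b c (b' # y) h - edge x' b' c (b # y) h
        - edge (x' @ [c]) b' b y h
        + L_word x' (alg_op (kap b' b) (L c ?s) - L c (alg_op (kap b' b) ?s) + (alg_op (kap b c) (L b' ?s) - L b' (alg_op (kap b c) ?s))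
           + (alg_op (kap c b') (L b ?s) - L b (alg_op (kap c b') ?s)))"
      using less.prems sub sort_corr[of h] 2 c kap_swap[of c b']
      by (simp add: edge_def L_basis_single alg_op_left_simps algebra_simps)
    also have "\<dots> = edge (x' @ [b]) b' c y h + edge x' b c (b' # y) h - edge x' b' c (b # y) h
        - edge (x' @ [c]) b' b y h"
      by (simp only: jacobi) simp
    also have "\<dots> \<in> J ?N"
      by (intro pm.subspace_add pm.subspace_diff subspace_J e1 e2 e3 e4)
    finally show ?thesis .
  next
    case (3 u)
    then have y': "y' = u @ b # c # y" using eq by simp
    let ?s = "single (y, h) 1" and ?N = "Suc (length x + length y)"
    let ?m = "alg_op (kap b c) ?s"
    have sub: "set x' \<subseteq> B" "b' \<in> B" "c' \<in> B" "set u \<subseteq> B" using less.prems 3 by auto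
    have n1: "inversions (x @ b # c # y) = Suc (inversions ((x' @ c' # b' # u) @ b # c # y))"
      using inversions_swap[OF d, of x' "u @ b # c # y"] 3 by simp
    have n2: "inversions (x @ b # c # y) = Suc (inversions (x' @ b' # c' # u @ c # b # y))"
      using inversions_swap[OF less.prems(1), of x y] 3 by simp
    have e1: "edge (x' @ c' # b' # u) b c y h \<in> J ?N"
      using IH[of "x' @ c' # b' # u" b c y] n1 sub less.prems 3 by simp
    have e2: "edge x' b' c' (u @ c # b # y) h \<in> J ?N"
      using IH[of x' b' c' "u @ c # b # y"] n2 sub d less.prems 3 by (simp add: add.assoc)
    have s: "?s \<in> words_le (length y)"
      using less.prems by (intro words_le_single) auto
    \<comment> \<open>Two disjoint exchanges form a square. Its corrections do not cancel exactly:
      each exchange acts on what the other has changed, and the two discrepancies are relations of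
      total length \<open>length x + length y\<close>.\<close>
    have "L_word u (comm_op b c ?s) \<in> J (length u + 2 + length y)"
      using sub less.prems by (intro comm_op_mem[OF s]) auto
    then have "L_word x' (alg_op (kap b' c') (L_word u (comm_op b c ?s))) \<in> J (length x' + (length u + 2 + length y))"
      by (intro J_L_word J_alg_op)
    then have e3: "L_word x' (alg_op (kap b' c') (L_word u (comm_op b c ?s))) \<in> J ?N"
      by (rule J_mono) (simp add: 3)
    have "L_word u ?m \<in> words_le (length u + length y)"
      by (intro words_le_L_word words_le_alg_op s)
    then have e4: "L_word x' (comm_op b' c' (L_word u ?m)) \<in> J ?N"
      by (rule comm_op_mem) (use sub 3 in auto)
    have single: "single (u @ b # c # y, h) 1 = L_word u (L b (L c ?s))" "single (u @ c # b # y, h) 1 = L_word u (L c (L b ?s))"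
      using sub less.prems by (simp_all add: L_basis_single L_word_single)
    have "edge x b c y h = edge (x' @ c' # b' # u) b c y h - edge x' b' c' (u @ c # b # y) h
       + L_word x' (alg_op (kap b' c') (L_word u (comm_op b c ?s))) - L_word x' (comm_op b' c' (L_word u ?m))"
      using sort_corr[of h] unfolding y' single by (simp add: edge_def 3 comm_op_def single algebra_simps)
    also have "\<dots> \<in> J ?N"
      by (intro pm.subspace_add pm.subspace_diff subspace_J e1 e2 e3 e4)
    finally show ?thesis .
  qed
qed

text \<open>As \<open>kap\<close> is alternating, \<open>edge\<close> changes sign when
  \<open>b\<close> and \<open>c\<close> are exchanged, which turns an ascent into a descent; for
  \<open>b = c\<close> it vanishes.\<close>

lemma edge_mem:
  assumes "set x \<subseteq> B" "b \<in> B" "c \<in> B" "set y \<subseteq> B"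
  shows "edge x b c y h \<in> J (Suc (length x + length y))"
proof -
  consider "rank c < rank b" | "rank b < rank c" | "b = c"
    using inj_rank assms(2,3) by (metis inj_onD nat_neq_iff)
  then show ?thesis
  proof cases
    case 1
    then show ?thesis using edge_descent assms by blast
  next
    case 2
    have "edge x b c y h = - edge x c b y h"
      by (simp add: edge_def kap_swap[of c b] alg_op_left_simps)
    then show ?thesis
      using edge_descent[OF 2 assms(1,3,2,4), of h] by (simp add: pm.subspace_neg)
  next
    case 3
    then show ?thesis by (simp add: edge_def alg_op_left_simps pm.subspace_0)
  qed
qed

text \<open>Replacing the leading part of an element by its sorting correction maps \<open>J (Suc n)\<close> into \<open>J n\<close>, and
  fixes the elements without leading part.\<close>

lemma J_descend:
  assumes "m \<in> J (Suc n)" "top_part (Suc n) m = 0"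
  shows "m \<in> J n"
proof -
  have lin: "Vector_Spaces.linear pm_scale pm_scale (\<lambda>m. m - top_part (Suc n) m + sort_top (Suc n) m)"
    unfolding top_part_def sort_top_def by (intro linear_pm_intros)
  have low: "top_part (Suc n) m = 0" "sort_top (Suc n) m = 0" if "m \<in> words_le k" "k \<le> n" for m k
    using words_le_deg[OF that(1)] that(2) by (auto simp: top_part_def sort_top_def intro!: plin_low)
  have "m - top_part (Suc n) m + sort_top (Suc n) m \<in> J n"
  proof (rule linear_mono_span[OF lin subspace_J _ assms(1)[unfolded J_def]], safe)
    fix x b c z and h :: 'g
    assume a: "set x \<subseteq> B" "b \<in> B" "c \<in> B" "set z \<subseteq> B" "length x + 2 + length z \<le> Suc n"
    let ?s = "single (z, h) 1"
    let ?m = "L_word x (comm_op b c ?s)"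
    have s: "?s \<in> words_le (length z)"
      using a by (intro words_le_single) auto
    show "?m - top_part (Suc n) ?m + sort_top (Suc n) ?m \<in> J n"
    proof (cases "length x + 2 + length z \<le> n")
      case True
      then have "?m \<in> J n"
        using a by (intro comm_op_mem[OF s]) auto
      then show ?thesis
        using low[OF J_words_le[of ?m n]] by simp
    next
      case False
      then have n: "Suc n = length x + 2 + length z" using a by simp
      have m: "?m = single (x @ b # c # z, h) 1 - single (x @ c # b # z, h) 1 - L_word x (alg_op (kap b c) ?s)"
        using a by (simp add: comm_op_def L_basis_single L_word_single)
      have "L_word x (alg_op (kap b c) ?s) \<in> words_le (length x + length z)"
        by (intro words_le_L_word words_le_alg_op s)
      from low[OF this] have "?m - top_part (Suc n) ?m + sort_top (Suc n) ?m = edge x b c z h"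
        unfolding m edge_def using n by (simp add: top_part_def sort_top_def)
      then show ?thesis
        using edge_mem[OF a(1-4), of h] n by simp
    qed
  qed
  \<comment> \<open>\<open>sort_top\<close> depends only on the leading part of \<open>m\<close>,
    which is zero here, so the map returns \<open>m\<close> itself.\<close>
  then show ?thesis
    using assms(2) by (subst (asm) sort_top_top) (simp add: sort_top_def)
qed

text \<open>Repeated descent from \<open>N\<close>: as long as the index exceeds the degree bound,
  the leading part vanishes and \<open>J_descend\<close> applies.\<close>

lemma J_degree:
  assumes "m \<in> J N" "keys m \<subseteq> {(w, h). length w \<le> n}"
  shows "m \<in> J n"
  using assms(1)
proof (induction N)
  case 0
  then show ?case by (rule J_mono) simp
next
  case (Suc N)
  show ?case
  proof (cases "Suc N \<le> n")
    case True
    then show ?thesis using J_mono Suc.prems by blast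
  next
    case False
    have "top_part (Suc N) m = 0"
      unfolding top_part_def using assms(2) False by (intro plin_low) auto
    then show ?thesis using J_descend Suc by blast
  qed
qed

end

section \<open>Homogeneous components and degree bounds\<close>

definition hcomp :: "('x \<Rightarrow> nat) \<Rightarrow> nat \<Rightarrow> ('x \<Rightarrow>\<^sub>0 'k::field) \<Rightarrow> ('x \<Rightarrow>\<^sub>0 'k)" where
  "hcomp d n = plin (\<lambda>w. if d w = n then single w 1 else 0)"

definition deg_le :: "('x \<Rightarrow> nat) \<Rightarrow> nat \<Rightarrow> ('x \<Rightarrow>\<^sub>0 'k::zero) set" where
  "deg_le d n = {p. \<forall>w\<in>keys p. d w \<le> n}"

text \<open>The strict bound stands for degree at most \<open>n - 1\<close> and gives the zero space
  at \<open>n = 0\<close>, in agreement with \<open>filt_below\<close>.\<close>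

definition deg_lt :: "('x \<Rightarrow> nat) \<Rightarrow> nat \<Rightarrow> ('x \<Rightarrow>\<^sub>0 'k::zero) set" where
  "deg_lt d n = {p. \<forall>w\<in>keys p. d w < n}"

definition deg_eq :: "('x \<Rightarrow> nat) \<Rightarrow> nat \<Rightarrow> ('x \<Rightarrow>\<^sub>0 'k::zero) set" where
  "deg_eq d n = {p. \<forall>w\<in>keys p. d w = n}"

lemma hcomp_linear: "Vector_Spaces.linear pm_scale pm_scale (hcomp d n)"
  unfolding hcomp_def by (rule linear_plin)

lemmas hcomp_simps [simp] =
  linear_addD[OF hcomp_linear] linear_diffD[OF hcomp_linear] linear_zeroD[OF hcomp_linear]
  linear_scaleD[OF hcomp_linear] linear_sumD[OF hcomp_linear] linear_uminusD[OF hcomp_linear]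

lemma hcomp_single: "hcomp d n (single w c) = (if d w = n then single w c else 0)"
  by (simp add: hcomp_def)

lemma lookup_hcomp: "lookup (hcomp d n p) w = (if d w = n then lookup p w else 0)"
proof -
  have "lookup (hcomp d n p) w = (\<Sum>x\<in>keys p. lookup p x * (if d x = n \<and> x = w then 1 else 0))"
    unfolding hcomp_def lin_def lookup_sum by (rule sum.cong) (auto simp: lookup_single when_def)
  also have "\<dots> = (\<Sum>x\<in>keys p. if x = w then if d w = n then lookup p w else 0 else 0)"
    by (rule sum.cong) auto
  finally show ?thesis
    by (auto simp: in_keys_iff)
qed

lemma keys_hcomp: "keys (hcomp d n p) = {w \<in> keys p. d w = n}"
  by (auto simp: in_keys_iff lookup_hcomp split: if_splits)

lemma hcomp_deg_eq: "hcomp d n p \<in> deg_eq d n"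
  by (simp add: deg_eq_def keys_hcomp)

lemma hcomp_id: "p \<in> deg_eq d n \<Longrightarrow> hcomp d n p = p"
  by (rule poly_mapping_eqI) (auto simp: lookup_hcomp deg_eq_def in_keys_iff)

lemma hcomp_other: "p \<in> deg_eq d k \<Longrightarrow> k \<noteq> n \<Longrightarrow> hcomp d n p = 0"
  by (rule poly_mapping_eqI) (auto simp: lookup_hcomp deg_eq_def in_keys_iff)

lemma hcomp_deg_lt: "p \<in> deg_lt d n \<Longrightarrow> hcomp d n p = 0"
  by (rule poly_mapping_eqI) (auto simp: lookup_hcomp deg_lt_def in_keys_iff)

lemma deg_eq_le: "p \<in> deg_eq d n \<Longrightarrow> p \<in> deg_le d n"
  by (simp add: deg_eq_def deg_le_def)

lemma diff_hcomp_deg_lt: "p \<in> deg_le d n \<Longrightarrow> p - hcomp d n p \<in> deg_lt d n"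
  by (auto simp: deg_le_def deg_lt_def in_keys_iff lookup_minus lookup_hcomp order_less_le split: if_splits)

lemma finite_hcomp_support: "finite {n. hcomp d n p \<noteq> 0}"
proof (rule finite_subset)
  show "{n. hcomp d n p \<noteq> 0} \<subseteq> d ` keys p"
    using keys_hcomp[of d _ p] by (fastforce simp flip: keys_eq_empty)
qed simp

lemma subspace_deg_lt: "pm.subspace (deg_lt d n :: ('x \<Rightarrow>\<^sub>0 'k::field) set)"
  unfolding deg_lt_def using subspace_supp[of "{w. d w < n}"] by (simp add: subset_iff Ball_def)

lemma subspace_deg_le: "pm.subspace (deg_le d n :: ('x \<Rightarrow>\<^sub>0 'k::field) set)"
  unfolding deg_le_def using subspace_supp[of "{w. d w \<le> n}"] by (simp add: subset_iff Ball_def)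

lemma subspace_deg_eq: "pm.subspace (deg_eq d n :: ('x \<Rightarrow>\<^sub>0 'k::field) set)"
  unfolding deg_eq_def using subspace_supp[of "{w. d w = n}"] by (simp add: subset_iff Ball_def)

lemma hcomp_sum_deg_eq:
  assumes "finite N" "\<And>n. P n \<in> deg_eq d n" "\<And>n. n \<notin> N \<Longrightarrow> P n = 0"
  shows "hcomp d n (\<Sum>i\<in>N. P i) = P n"
proof -
  have "hcomp d n (\<Sum>i\<in>N. P i) = (\<Sum>i\<in>N. if i = n then P n else 0)"
    unfolding hcomp_simps by (rule sum.cong) (auto simp: hcomp_id hcomp_other[OF assms(2)] assms(2))
  then show ?thesis using assms by simp
qed

lemma sum_hcomp: "p = (\<Sum>n\<in>d ` keys p. hcomp d n p)"
proof (rule poly_mapping_eqI)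
  fix w
  have "lookup (\<Sum>n\<in>d ` keys p. hcomp d n p) w = (\<Sum>n\<in>d ` keys p. if d w = n then lookup p w else 0)"
    by (simp add: lookup_sum lookup_hcomp)
  then show "lookup p w = lookup (\<Sum>n\<in>d ` keys p. hcomp d n p) w"
    by (auto simp: in_keys_iff image_iff)
qed

definition wd :: "('v + 'g) list \<Rightarrow> nat" where
  "wd = word_degree (case_sum (\<lambda>_. 1) (\<lambda>_. 0))"

lemma wd_simps [simp]: "wd [] = 0" "wd (Inl v # w) = Suc (wd w)" "wd (Inr g # w) = wd w"
    "wd (x @ y) = wd x + wd y" "wd (map Inl u) = length u"
  by (simp_all add: wd_def word_degree_def comp_def sum_list_triv)

section \<open>The symmetric algebra\<close>

lemma free_alg_map_conv: "free_alg_map f = plin (\<lambda>w. single (map f w) 1)"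
  for f :: "'x \<Rightarrow> 'y"
  by (simp add: fun_eq_iff free_alg_map_def lin_def)

lemma free_alg_map_linear: "Vector_Spaces.linear pm_scale pm_scale (free_alg_map f)"
  unfolding free_alg_map_conv by (rule linear_plin)

lemmas free_alg_map_simps [simp] =
  linear_addD[OF free_alg_map_linear] linear_diffD[OF free_alg_map_linear] linear_zeroD[OF free_alg_map_linear]
  linear_scaleD[OF free_alg_map_linear] linear_sumD[OF free_alg_map_linear] linear_uminusD[OF free_alg_map_linear]

lemma free_alg_map_single [simp]: "free_alg_map f (single w (c::'k::field)) = single (map f w) c"
  by (simp add: free_alg_map_conv)

lemma free_alg_map_mult: "free_alg_map f (p * q) = free_alg_map f p * free_alg_map f q"
  for p q :: "'x list \<Rightarrow>\<^sub>0 'k::field"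
proof (rule bilinear_eqI[where p = p and q = q])
  show "Vector_Spaces.linear pm_scale pm_scale (\<lambda>p. free_alg_map f (p * q))" for q :: "'x list \<Rightarrow>\<^sub>0 'k"
    by (rule linear_pm_comp[OF linear_mult_right free_alg_map_linear])
  show "Vector_Spaces.linear pm_scale pm_scale (\<lambda>q. free_alg_map f (single x (1::'k) * q))" for x
    by (rule linear_pm_comp[OF linear_mult_left free_alg_map_linear])
  show "Vector_Spaces.linear pm_scale pm_scale (\<lambda>p. free_alg_map f p * free_alg_map f q)" for q :: "'x list \<Rightarrow>\<^sub>0 'k"
    by (rule linear_pm_comp[OF free_alg_map_linear linear_mult_right])
  show "Vector_Spaces.linear pm_scale pm_scale (\<lambda>q. free_alg_map f (single x (1::'k)) * free_alg_map f q)" for x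
    by (rule linear_pm_comp[OF free_alg_map_linear linear_mult_left])
qed (simp add: mult_single)

lemma free_alg_map_comp: "free_alg_map f (free_alg_map g p) = free_alg_map (f \<circ> g) p"
  for p :: "'x list \<Rightarrow>\<^sub>0 'k::field"
  by (rule linear_eq_on_keys[where s = pm_scale and p = p and F = "\<lambda>p. free_alg_map f (free_alg_map g p)" and G = "free_alg_map (f \<circ> g)"])
     (simp_all add: linear_pm_comp[OF free_alg_map_linear free_alg_map_linear] free_alg_map_linear)

lemma free_alg_map_id: "free_alg_map (\<lambda>x. x) p = p" for p :: "'x list \<Rightarrow>\<^sub>0 'k::field"
  by (rule linear_eq_on_keys[where s = pm_scale and p = p and F = "free_alg_map (\<lambda>x. x)" and G = "\<lambda>p. p"])
     (simp_all add: linear_pm_id free_alg_map_linear)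

context skew_data
begin

abbreviation IS :: "('v list \<Rightarrow>\<^sub>0 'k) set" where
  "IS \<equiv> rel_ideal (symmetric_rels scale)"

lemma IS_add: "gen (v + w) - gen v - gen w \<in> IS"
  by (rule rel_ideal_base) (auto simp: symmetric_rels_def linear_rels_def)

lemma IS_scale: "gen (scale c v) - pm_scale c (gen v) \<in> IS"
  by (rule rel_ideal_base) (auto simp: symmetric_rels_def linear_rels_def)

lemma IS_commute: "gen v * gen w - gen w * gen v \<in> IS"
  by (rule rel_ideal_base) (auto simp: symmetric_rels_def)

lemma IS_subset:
  assumes "pm.subspace K" "\<And>p x. p \<in> K \<Longrightarrow> gen x * p \<in> K" "\<And>p x. p \<in> K \<Longrightarrow> p * gen x \<in> K"
    "\<And>v w. gen (v + w) - gen v - gen w \<in> K" "\<And>c v. gen (scale c v) - pm_scale c (gen v) \<in> K"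
    "\<And>v w. gen v * gen w - gen w * gen v \<in> K"
  shows "IS \<subseteq> K"
  using assms by (intro rel_ideal_minimal_words) (auto simp: symmetric_rels_def linear_rels_def)

lemma IS_sum: "finite A \<Longrightarrow> gen (\<Sum>b\<in>A. scale (f b) b) - (\<Sum>b\<in>A. pm_scale (f b) (gen b)) \<in> IS"
proof (induction A rule: finite_induct)
  case empty
  \<comment> \<open>The additivity relation for two zero vectors is \<open>- gen 0\<close>.\<close>
  show ?case using IS_add[of 0 0] rel_ideal_uminus by fastforce
next
  case (insert b A)
  have "gen (scale (f b) b + (\<Sum>b\<in>A. scale (f b) b)) - gen (scale (f b) b) - gen (\<Sum>b\<in>A. scale (f b) b)
    + (gen (scale (f b) b) - pm_scale (f b) (gen b)) + (gen (\<Sum>b\<in>A. scale (f b) b) - (\<Sum>b\<in>A. pm_scale (f b) (gen b))) \<in> IS"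
    by (intro rel_ideal_add IS_add IS_scale insert.IH)
  then show ?case using insert.hyps by (simp add: algebra_simps)
qed

lemma IS_expand: "gen v - (\<Sum>b\<in>B. pm_scale (representation B v b) (gen b)) \<in> IS"
  using IS_sum[OF finite_Basis, of "representation B v"] by (simp add: expand_basis)

lemma IS_act: "p \<in> IS \<Longrightarrow> free_alg_map (act g) p \<in> IS"
proof -
  have "IS \<subseteq> {p. free_alg_map (act g) p \<in> IS}"
  proof (rule IS_subset)
    show "pm.subspace {p. free_alg_map (act g) p \<in> IS}"
      by (rule pm.subspaceI) (auto intro: rel_ideal_add rel_ideal_scale)
  qed (auto simp: free_alg_map_mult rel_ideal_mult_left rel_ideal_mult_right IS_commute simp del: pm_scale_single
       simp: linear_addD[OF act_linear] linear_scaleD[OF act_linear] IS_add IS_scale)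
  then show "p \<in> IS \<Longrightarrow> free_alg_map (act g) p \<in> IS" by blast
qed

lemma act_inverse: "act (- g) (act g v) = v" "act g (act (- g) v) = v"
  by (simp_all flip: act_plus)

text \<open>The inverse group element provides preimages. Equality, not just inclusion, is needed
  for the elementwise image of a coset in \<open>symmetric_action\<close> to be a whole
  coset.\<close>

lemma IS_act_image: "free_alg_map (act g) ` IS = IS"
proof (intro equalityI subsetI)
  fix p assume "p \<in> IS"
  then have "free_alg_map (act (- g)) p \<in> IS" by (rule IS_act)
  moreover have "free_alg_map (act g) (free_alg_map (act (- g)) p) = p"
    by (simp add: free_alg_map_comp comp_def act_inverse free_alg_map_id)
  ultimately show "p \<in> free_alg_map (act g) ` IS" by (metis imageI)
qed (auto intro: IS_act)

section \<open>The symbol map onto the skew group algebra\<close>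

text \<open>A word in \<open>V\<close> and \<open>G\<close> equals \<open>w \<otimes> g\<close> with \<open>(w, g) = normal_word _\<close> up to terms of lower degree.\<close>

fun normal_word :: "('v + 'g) list \<Rightarrow> 'v list \<times> 'g" where
  "normal_word [] = ([], 0)"
| "normal_word (Inl v # w) = (v # fst (normal_word w), snd (normal_word w))"
| "normal_word (Inr g # w) = (map (act g) (fst (normal_word w)), g + snd (normal_word w))"

lemma length_normal_word [simp]: "length (fst (normal_word w)) = wd w"
  by (induction w rule: normal_word.induct) simp_all

lemma normal_word_append:
  "normal_word (w @ w') = (fst (normal_word w) @ map (act (snd (normal_word w))) (fst (normal_word w')), snd (normal_word w) + snd (normal_word w'))"
  by (induction w rule: normal_word.induct) (simp_all add: act_plus add.assoc)

text \<open>The coefficient of \<open>h\<close> under the algebra map from the free algebra to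
  \<open>T(V) # G\<close>, in which group elements pass vectors without correction terms.\<close>

definition symbol :: "'g \<Rightarrow> (('v + 'g) list \<Rightarrow>\<^sub>0 'k) \<Rightarrow> ('v list \<Rightarrow>\<^sub>0 'k)" where
  "symbol h = plin (\<lambda>w. if snd (normal_word w) = h then single (fst (normal_word w)) 1 else 0)"

lemma symbol_linear: "Vector_Spaces.linear pm_scale pm_scale (symbol h)"
  unfolding symbol_def by (rule linear_plin)

lemmas symbol_simps [simp] =
  linear_addD[OF symbol_linear] linear_diffD[OF symbol_linear] linear_zeroD[OF symbol_linear]
  linear_scaleD[OF symbol_linear] linear_sumD[OF symbol_linear] linear_uminusD[OF symbol_linear]

lemma symbol_single: "symbol h (single w c) = (if snd (normal_word w) = h then single (fst (normal_word w)) c else 0)"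
  by (simp add: symbol_def)

lemma symbol_one: "symbol h 1 = (if h = 0 then 1 else 0)"
  using symbol_single[of h "[]" 1] by auto

text \<open>Bilinearity reduces this to two words, for which exactly one pair \<open>(g, h)\<close>
  contributes; \<open>normal_word_append\<close> then gives the twisted concatenation.\<close>

lemma symbol_mult: "symbol x (p * q) = (\<Sum>(g, h)\<in>{(g, h). g + h = x}. symbol g p * free_alg_map (act g) (symbol h q))"
proof (rule bilinear_eqI[where p = p and q = q])
  show "Vector_Spaces.linear pm_scale pm_scale (\<lambda>p. symbol x (p * q))" for q
    by (rule linear_pm_comp[OF linear_mult_right symbol_linear])
  show "Vector_Spaces.linear pm_scale pm_scale (\<lambda>q. symbol x (single w 1 * q))" for w
    by (rule linear_pm_comp[OF linear_mult_left symbol_linear])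
  show "Vector_Spaces.linear pm_scale pm_scale (\<lambda>p. \<Sum>(g, h)\<in>{(g, h). g + h = x}. symbol g p * free_alg_map (act g) (symbol h q))" for q
    unfolding case_prod_beta by (intro linear_pm_sum linear_pm_comp[OF symbol_linear linear_mult_right])
  show "Vector_Spaces.linear pm_scale pm_scale
      (\<lambda>q. \<Sum>(g, h)\<in>{(g, h). g + h = x}. symbol g (single w 1) * free_alg_map (act g) (symbol h q))" for w
    unfolding case_prod_beta
    by (intro linear_pm_sum linear_pm_comp[OF linear_pm_comp[OF symbol_linear free_alg_map_linear] linear_mult_left])
  fix w w' :: "('v + 'g) list"
  have "(\<Sum>(g, h)\<in>{(g, h). g + h = x}. symbol g (grp w) * free_alg_map (act g) (symbol h (grp w' :: _ \<Rightarrow>\<^sub>0 'k)))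
     = (\<Sum>gh\<in>{(g, h). g + h = x}. if gh = (snd (normal_word w), snd (normal_word w')) then
          single (fst (normal_word w) @ map (act (snd (normal_word w))) (fst (normal_word w'))) 1 else 0)"
    by (rule sum.cong) (auto simp: symbol_single mult_single split: if_splits)
  also have "\<dots> = symbol x (single w 1 * single w' 1)"
    by (simp add: symbol_single mult_single normal_word_append)
  finally show "symbol x (single w 1 * single w' 1)
    = (\<Sum>(g, h)\<in>{(g, h). g + h = x}. symbol g (grp w) * free_alg_map (act g) (symbol h (grp w')))" by simp
qed

lemma symbol_hcomp: "symbol h (hcomp wd n p) = hcomp length n (symbol h p)"
  by (rule linear_eq_on_keys[where s = pm_scale and p = p and F = "\<lambda>p. symbol h (hcomp wd n p)" and G = "\<lambda>p. hcomp length n (symbol h p)"])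
     (simp_all add: linear_pm_comp[OF hcomp_linear symbol_linear] linear_pm_comp[OF symbol_linear hcomp_linear] hcomp_single symbol_single)

section \<open>Rewriting words modulo lower degree\<close>

abbreviation IH :: "(('v + 'g) list \<Rightarrow>\<^sub>0 'k) set" where
  "IH \<equiv> rel_ideal (H_rels scale act lam kap)"

lemma IH_add: "gen (Inl (v + w)) - gen (Inl v) - gen (Inl w) \<in> IH"
  by (rule rel_ideal_base) (auto simp: H_rels_def linear_rels_def)

lemma IH_scale: "gen (Inl (scale c v)) - pm_scale c (gen (Inl v)) \<in> IH"
  by (rule rel_ideal_base) (fastforce simp: H_rels_def linear_rels_def)

lemma IH_group: "gen (Inr g) * gen (Inr h) - gen (Inr (g + h)) \<in> IH"
  by (rule rel_ideal_base) (unfold H_rels_def, blast)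

lemma IH_one: "gen (Inr 0) - 1 \<in> IH"
  by (rule rel_ideal_base) (unfold H_rels_def, blast)

lemma IH_commute: "gen (Inl v) * gen (Inl w) - gen (Inl w) * gen (Inl v) - group_alg_embed (kap v w) \<in> IH"
  by (rule rel_ideal_base) (unfold H_rels_def, blast)

lemma IH_act: "gen (Inr g) * gen (Inl v) - gen (Inl (act g v)) * gen (Inr g) - group_alg_embed (lam (grp g) v) \<in> IH"
  by (rule rel_ideal_base) (unfold H_rels_def, blast)

text \<open>Representatives of the elements of H of degree below \<open>n\<close>: membership in
  \<open>U n\<close> means being zero in the degree \<open>n\<close> part of gr(H).\<close>

definition U :: "nat \<Rightarrow> (('v + 'g) list \<Rightarrow>\<^sub>0 'k) set" where
  "U n = {p + q | p q. p \<in> IH \<and> q \<in> deg_lt wd n}"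

lemma subspace_U: "pm.subspace (U n)"
  unfolding U_def by (rule pm.subspace_sums[OF subspace_rel_ideal subspace_deg_lt])

lemma IH_U: "p \<in> IH \<Longrightarrow> p \<in> U n"
  unfolding U_def using pm.subspace_0[OF subspace_deg_lt] by force

lemma deg_lt_U: "p \<in> deg_lt wd n \<Longrightarrow> p \<in> U n"
  unfolding U_def using rel_ideal_zero by force

lemma U_zero: "U 0 = IH"
proof -
  have "deg_lt wd 0 = {0 :: ('v + 'g) list \<Rightarrow>\<^sub>0 'k}"
    by (auto simp: deg_lt_def simp flip: keys_eq_empty)
  then show ?thesis by (auto simp: U_def)
qed

lemma deg_lt_mult:
  assumes p: "p \<in> deg_lt wd n" and x: "x \<in> deg_le wd k"
  shows "x * p \<in> deg_lt wd (k + n)" "p * x \<in> deg_lt wd (n + k)"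
proof -
  have "wd w < k + n" if w: "w \<in> keys (x * p)" for w
  proof -
    obtain a b where "w = a @ b" "a \<in> keys x" "b \<in> keys p"
      using subsetD[OF keys_mult w] by auto
    then show ?thesis using p x by (simp add: deg_lt_def deg_le_def add_le_less_mono)
  qed
  then show "x * p \<in> deg_lt wd (k + n)" by (simp add: deg_lt_def)
  have "wd w < n + k" if w: "w \<in> keys (p * x)" for w
  proof -
    obtain a b where "w = a @ b" "a \<in> keys p" "b \<in> keys x"
      using subsetD[OF keys_mult w] by auto
    then show ?thesis using p x by (simp add: deg_lt_def deg_le_def add_less_le_mono)
  qed
  then show "p * x \<in> deg_lt wd (n + k)" by (simp add: deg_lt_def)
qed

lemma U_mult:
  assumes p: "p \<in> U n" and x: "x \<in> deg_le wd k"
  shows "x * p \<in> U (k + n)" "p * x \<in> U (n + k)"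
proof -
  obtain a b where p: "p = a + b" "a \<in> IH" "b \<in> deg_lt wd n"
    using p by (auto simp: U_def)
  show "x * p \<in> U (k + n)" "p * x \<in> U (n + k)"
    unfolding p(1) distrib_left distrib_right
    using IH_U[OF rel_ideal_mult_left[OF p(2)]] IH_U[OF rel_ideal_mult_right[OF p(2)]]
      deg_lt_mult[OF p(3) x, THEN deg_lt_U]
    by (simp_all add: pm.subspace_add[OF subspace_U])
qed

lemma U_gen_Inl: "p \<in> U n \<Longrightarrow> gen (Inl v) * p \<in> U (Suc n)"
  using U_mult(1)[of p n "gen (Inl v)" 1] by (simp add: deg_le_def)

lemma U_gen_Inr: "p \<in> U n \<Longrightarrow> gen (Inr g) * p \<in> U n"
  using U_mult(1)[of p n "gen (Inr g)" 0] by (simp add: deg_le_def)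

lemma group_alg_embed_deg: "group_alg_embed (a :: 'g \<Rightarrow>\<^sub>0 'k) \<in> deg_le (wd :: ('v + 'g) list \<Rightarrow> nat) 0"
  unfolding group_alg_embed_def
  by (intro pm.subspace_sum pm.subspace_scale subspace_deg_le) (simp add: deg_le_def)

text \<open>Each passage of \<open>g\<close> past a letter costs a \<open>lam\<close> term, in which
  that letter is gone; such a term has lower degree.\<close>

lemma rewrite_group:
  "single (Inr g # map Inl u @ [Inr h]) 1 - single (map Inl (map (act g) u) @ [Inr (g + h)]) 1 \<in> U (length u)"
proof (induction u)
  case Nil
  show ?case using IH_U[OF IH_group[of g h]] by (simp add: mult_single)
next
  case (Cons v u)
  let ?X = "single (map Inl u @ [Inr h]) 1"
  let ?E = "group_alg_embed (lam (grp g) v)"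
  have "(gen (Inr g) * gen (Inl v) - gen (Inl (act g v)) * gen (Inr g) - ?E) * ?X \<in> U (Suc (length u))"
    by (intro IH_U rel_ideal_mult_right IH_act)
  moreover have "gen (Inl (act g v)) * (single (Inr g # map Inl u @ [Inr h]) 1
      - single (map Inl (map (act g) u) @ [Inr (g + h)]) 1) \<in> U (Suc (length u))"
    by (rule U_gen_Inl) (rule Cons)
  moreover have "?E * ?X \<in> U (Suc (length u))"
    using deg_lt_mult(1)[OF _ group_alg_embed_deg, of ?X "Suc (length u)"]
    by (intro deg_lt_U) (simp add: deg_lt_def)
  ultimately have "(gen (Inr g) * gen (Inl v) - gen (Inl (act g v)) * gen (Inr g) - ?E) * ?X
    + gen (Inl (act g v)) * (single (Inr g # map Inl u @ [Inr h]) 1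
      - single (map Inl (map (act g) u) @ [Inr (g + h)]) 1) + ?E * ?X \<in> U (Suc (length u))"
    by (intro pm.subspace_add subspace_U)
  then show ?case by (simp add: mult_single algebra_simps)
qed

lemma rewrite_word: "single w 1 - single (map Inl (fst (normal_word w)) @ [Inr (snd (normal_word w))]) 1 \<in> U (wd w)"
proof (induction w rule: normal_word.induct)
  case 1
  show ?case using IH_U[OF rel_ideal_uminus[OF IH_one]] by simp
next
  case (2 v w)
  show ?case using U_gen_Inl[OF 2(1), of v] by (simp add: mult_single algebra_simps)
next
  case (3 g w)
  have "gen (Inr g) * (single w 1 - single (map Inl (fst (normal_word w)) @ [Inr (snd (normal_word w))]) 1)
    + (single (Inr g # map Inl (fst (normal_word w)) @ [Inr (snd (normal_word w))]) 1
     - single (map Inl (map (act g) (fst (normal_word w))) @ [Inr (g + snd (normal_word w))]) 1) \<in> U (wd w)"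
    using rewrite_group[of g "fst (normal_word w)" "snd (normal_word w)"]
    by (intro pm.subspace_add subspace_U U_gen_Inr 3(1)) simp
  then show ?case by (simp add: mult_single algebra_simps)
qed

text \<open>By linearity from \<open>rewrite_word\<close>: modulo lower degree, a homogeneous
  element is recovered from its symbols by placing the group letter last.\<close>

lemma rewrite_hcomp:
  "hcomp wd n p - (\<Sum>h\<in>UNIV. free_alg_map Inl (hcomp length n (symbol h p)) * gen (Inr h)) \<in> U n"
proof (rule linear_mem[where p = p and F = "\<lambda>p. hcomp wd n p - (\<Sum>h\<in>UNIV. free_alg_map Inl (hcomp length n (symbol h p)) * gen (Inr h))"])
  show "Vector_Spaces.linear pm_scale pm_scale (\<lambda>p. hcomp wd n p - (\<Sum>h\<in>UNIV. free_alg_map Inl (hcomp length n (symbol h p)) * gen (Inr h)))"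
    by (intro linear_pm_diff linear_pm_sum hcomp_linear
        linear_pm_comp[OF linear_pm_comp[OF linear_pm_comp[OF symbol_linear hcomp_linear] free_alg_map_linear] linear_mult_right])
  fix w
  have "(\<Sum>h\<in>UNIV. free_alg_map Inl (hcomp length n (symbol h (single w 1))) * gen (Inr h))
      = (\<Sum>h\<in>UNIV. if h = snd (normal_word w) then if wd w = n then single (map Inl (fst (normal_word w)) @ [Inr h]) 1 else 0 else 0)"
    by (rule sum.cong) (auto simp: symbol_single hcomp_single mult_single)
  then show "hcomp wd n (single w 1) - (\<Sum>h\<in>UNIV. free_alg_map Inl (hcomp length n (symbol h (single w 1))) * gen (Inr h)) \<in> U n"
    using rewrite_word[of w] by (auto simp: hcomp_single pm.subspace_0[OF subspace_U])
qed (rule subspace_U)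

text \<open>The relations of S(V) hold in gr(H): the linear ones are relations of H, and a
  commutator differs from a relation of H only by \<open>kap\<close>, which has degree 0.\<close>

lemma symmetric_U: "q \<in> IS \<Longrightarrow> free_alg_map Inl (hcomp length n q) \<in> U n"
proof -
  have l: "hcomp length n (gen x * p) = (if n = 0 then 0 else gen x * hcomp length (n - 1) p)"
    and r: "hcomp length n (p * gen x) = (if n = 0 then 0 else hcomp length (n - 1) p * gen x)" for n x and p :: "'v list \<Rightarrow>\<^sub>0 'k"
  proof -
    show "hcomp length n (gen x * p) = (if n = 0 then 0 else gen x * hcomp length (n - 1) p)"
    proof (rule linear_eq_on_keys[where p = p and F = "\<lambda>p. hcomp length n (gen x * p)"])
      show "Vector_Spaces.linear pm_scale pm_scale (\<lambda>p. hcomp length n (gen x * p))"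
        by (rule linear_pm_comp[OF linear_mult_left hcomp_linear])
      show "Vector_Spaces.linear pm_scale pm_scale (\<lambda>p. if n = 0 then 0 else gen x * hcomp length (n - 1) p)"
        by (rule linear_pmI) (auto simp: distrib_left pm_scale_mult_right)
    qed (auto simp: mult_single hcomp_single)
    show "hcomp length n (p * gen x) = (if n = 0 then 0 else hcomp length (n - 1) p * gen x)"
    proof (rule linear_eq_on_keys[where p = p and F = "\<lambda>p. hcomp length n (p * gen x)"])
      show "Vector_Spaces.linear pm_scale pm_scale (\<lambda>p. hcomp length n (p * gen x))"
        by (rule linear_pm_comp[OF linear_mult_right hcomp_linear])
      show "Vector_Spaces.linear pm_scale pm_scale (\<lambda>p. if n = 0 then 0 else hcomp length (n - 1) p * gen x)"
        by (rule linear_pmI) (auto simp: distrib_right pm_scale_mult_left)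
    qed (auto simp: mult_single hcomp_single)
  qed
  have one: "gen (Inl x) \<in> deg_le wd 1" for x
    by (simp add: deg_le_def)
  \<comment> \<open>All degrees are treated at once because multiplication by a letter relates
    degree \<open>n\<close> to degree \<open>n - 1\<close>.\<close>
  have "IS \<subseteq> {q. \<forall>n. free_alg_map Inl (hcomp length n q) \<in> U n}"
  proof (rule IS_subset)
    show "pm.subspace {q. \<forall>n. free_alg_map Inl (hcomp length n q) \<in> U n}"
      by (rule pm.subspaceI) (auto intro: pm.subspace_0 pm.subspace_add pm.subspace_scale subspace_U)
  next
    fix p x assume p: "p \<in> {q. \<forall>n. free_alg_map Inl (hcomp length n q) \<in> U n}"
    show "gen x * p \<in> {q. \<forall>n. free_alg_map Inl (hcomp length n q) \<in> U n}"
    proof safe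
      fix n
      show "free_alg_map Inl (hcomp length n (gen x * p)) \<in> U n"
        using p U_mult(1)[OF _ one, of "free_alg_map Inl (hcomp length (n - 1) p)" "n - 1" x]
        by (auto simp: l free_alg_map_mult pm.subspace_0[OF subspace_U])
    qed
    show "p * gen x \<in> {q. \<forall>n. free_alg_map Inl (hcomp length n q) \<in> U n}"
    proof safe
      fix n
      show "free_alg_map Inl (hcomp length n (p * gen x)) \<in> U n"
        using p U_mult(2)[OF _ one, of "free_alg_map Inl (hcomp length (n - 1) p)" "n - 1" x]
        by (auto simp: r free_alg_map_mult pm.subspace_0[OF subspace_U])
    qed
  next
    fix v w and c :: 'k
    show "gen (v + w) - gen v - gen w \<in> {q. \<forall>n. free_alg_map Inl (hcomp length n q) \<in> U n}"
      using IH_U[OF IH_add[of v w], of 1] by (auto simp: hcomp_single pm.subspace_0[OF subspace_U])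
    show "gen (scale c v) - pm_scale c (gen v) \<in> {q. \<forall>n. free_alg_map Inl (hcomp length n q) \<in> U n}"
      using IH_U[OF IH_scale[of c v], of 1] by (auto simp: hcomp_single pm.subspace_0[OF subspace_U])
    have "group_alg_embed (kap v w) \<in> U 2"
      using group_alg_embed_deg by (intro deg_lt_U) (fastforce simp: deg_lt_def deg_le_def)
    then have "(gen (Inl v) * gen (Inl w) - gen (Inl w) * gen (Inl v) - group_alg_embed (kap v w)) + group_alg_embed (kap v w) \<in> U 2"
      by (rule pm.subspace_add[OF subspace_U IH_U[OF IH_commute]])
    then show "gen v * gen w - gen w * gen v \<in> {q. \<forall>n. free_alg_map Inl (hcomp length n q) \<in> U n}"
      by (auto simp: mult_single hcomp_single pm.subspace_0[OF subspace_U] numeral_2_eq_2)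
  qed
  then show "q \<in> IS \<Longrightarrow> free_alg_map Inl (hcomp length n q) \<in> U n" by blast
qed

text \<open>This makes the canonical map from S(V)#G to gr(H) well defined: vanishing of all symbols
  in S(V) forces vanishing of each graded component.\<close>

lemma symbol_zero_imp_U:
  assumes "\<And>h. symbol h p \<in> IS"
  shows "hcomp wd n p \<in> U n"
proof -
  have one: "gen (Inr h) \<in> deg_le wd 0" for h
    by (simp add: deg_le_def)
  have "(\<Sum>h\<in>UNIV. free_alg_map Inl (hcomp length n (symbol h p)) * gen (Inr h)) \<in> U n"
    using U_mult(2)[OF symmetric_U[OF assms] one, of n] by (intro pm.subspace_sum subspace_U) simp
  then show ?thesis
    using pm.subspace_add[OF subspace_U rewrite_hcomp[of n p]] by fastforce
qed

section \<open>The action of the free algebra on \<open>T(V) \<otimes> kG\<close>\<close>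

primrec letter_op :: "'v + 'g \<Rightarrow> ('v list \<times> 'g \<Rightarrow>\<^sub>0 'k) \<Rightarrow> ('v list \<times> 'g \<Rightarrow>\<^sub>0 'k)" where
  "letter_op (Inl v) = L v"
| "letter_op (Inr g) = grp_op g"

definition word_op :: "('v + 'g) list \<Rightarrow> ('v list \<times> 'g \<Rightarrow>\<^sub>0 'k) \<Rightarrow> ('v list \<times> 'g \<Rightarrow>\<^sub>0 'k)" where
  "word_op w = foldr letter_op w"

lemma word_op_simps [simp]: "word_op [] m = m" "word_op (x # w) m = letter_op x (word_op w m)" "word_op (w @ w') m = word_op w (word_op w' m)"
  by (simp_all add: word_op_def)

lemma letter_op_linear: "Vector_Spaces.linear pm_scale pm_scale (letter_op x)"
  by (cases x) (simp_all add: L_linear grp_op_linear)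

definition free_act :: "(('v + 'g) list \<Rightarrow>\<^sub>0 'k) \<Rightarrow> ('v list \<times> 'g \<Rightarrow>\<^sub>0 'k) \<Rightarrow> ('v list \<times> 'g \<Rightarrow>\<^sub>0 'k)" where
  "free_act p m = plin (\<lambda>w. word_op w m) p"

lemma free_act_linear_left: "Vector_Spaces.linear pm_scale pm_scale (\<lambda>p. free_act p m)"
  unfolding free_act_def by (rule linear_plin)

lemmas free_act_left_simps [simp] =
  linear_addD[OF free_act_linear_left] linear_diffD[OF free_act_linear_left] linear_zeroD[OF free_act_linear_left]
  linear_scaleD[OF free_act_linear_left] linear_sumD[OF free_act_linear_left] linear_uminusD[OF free_act_linear_left]

lemma free_act_single [simp]: "free_act (single w c) m = pm_scale c (word_op w m)"
  by (simp add: free_act_def)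

lemma free_act_one [simp]: "free_act 1 m = m"
  using free_act_single[of "[]" 1 m] by (simp del: free_act_single)

lemma free_act_mult_gen: "free_act (gen x * p) m = letter_op x (free_act p m)" "free_act (p * gen x) m = free_act p (letter_op x m)"
  by (rule linear_eq_on_keys[where s = pm_scale and p = p and F = "\<lambda>p. free_act (gen x * p) m"],
      simp_all add: mult_single linear_pm_comp[OF linear_mult_left free_act_linear_left] linear_pm_comp[OF free_act_linear_left letter_op_linear],
      rule linear_eq_on_keys[where s = pm_scale and p = p and F = "\<lambda>p. free_act (p * gen x) m"],
      simp_all add: mult_single linear_pm_comp[OF linear_mult_right free_act_linear_left] free_act_linear_left)

lemma free_act_group_alg_embed: "free_act (group_alg_embed a) m = alg_op a m"
  by (simp add: group_alg_embed_def alg_op_def del: pm_scale_single)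

text \<open>The module counterpart of \<open>symbol\<close>, restricted to length \<open>n\<close>.
  The length test is outermost so that \<open>plin_low\<close> applies.\<close>

definition lead_symbol :: "nat \<Rightarrow> 'g \<Rightarrow> ('v list \<times> 'g \<Rightarrow>\<^sub>0 'k) \<Rightarrow> ('v list \<Rightarrow>\<^sub>0 'k)" where
  "lead_symbol n h = plin (\<lambda>(w, h'). if length w = n then if h' = h then single w 1 else 0 else 0)"

lemma lead_symbol_linear: "Vector_Spaces.linear pm_scale pm_scale (lead_symbol n h)"
  unfolding lead_symbol_def by (rule linear_plin)

lemmas lead_symbol_simps [simp] =
  linear_addD[OF lead_symbol_linear] linear_diffD[OF lead_symbol_linear] linear_zeroD[OF lead_symbol_linear]
  linear_scaleD[OF lead_symbol_linear] linear_sumD[OF lead_symbol_linear] linear_uminusD[OF lead_symbol_linear]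

lemma lead_symbol_single: "lead_symbol n h (single (w, h') c) = (if length w = n \<and> h' = h then single w c else 0)"
  by (simp add: lead_symbol_def)

lemma lead_symbol_low: "m \<in> words_le k \<Longrightarrow> k < n \<Longrightarrow> lead_symbol n h m = 0"
  unfolding lead_symbol_def using words_le_deg[of m k] by (intro plin_low) auto

text \<open>Only generators of full length \<open>n\<close> are visible in degree \<open>n\<close>,
  and of these only the part \<open>x (bc - cb) z\<close>, because the \<open>kap\<close> part is
  two letters shorter.\<close>

lemma lead_symbol_J:
  assumes "m \<in> J n"
  shows "lead_symbol n h m \<in> IS"
proof (rule linear_mono_span[OF lead_symbol_linear subspace_rel_ideal _ assms[unfolded J_def]])
  fix p assume "p \<in> {L_word x (comm_op b c (single (z, h) 1)) |x b c z h.
            set x \<subseteq> B \<and> b \<in> B \<and> c \<in> B \<and> set z \<subseteq> B \<and> length x + 2 + length z \<le> n}"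
  then obtain x b c z and h' :: 'g where p: "p = L_word x (comm_op b c (single (z, h') 1))"
    and a: "set x \<subseteq> B" "b \<in> B" "c \<in> B" "set z \<subseteq> B" "length x + 2 + length z \<le> n" by blast
  have "single (z, h') 1 \<in> words_le (length z)"
    using a by (intro words_le_single) auto
  then have "L_word x (alg_op (kap b c) (single (z, h') 1)) \<in> words_le (length x + length z)"
    by (intro words_le_L_word words_le_alg_op)
  then have "lead_symbol n h (L_word x (alg_op (kap b c) (single (z, h') 1))) = 0"
    by (rule lead_symbol_low) (use a in simp)
  then have "lead_symbol n h p = (if length x + 2 + length z = n \<and> h' = h then single x 1 * ((gen b * gen c - gen c * gen b) * single z 1) else 0)"
    using a by (auto simp: p comm_op_def L_basis_single L_word_single lead_symbol_single mult_single algebra_simps)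
  also have "\<dots> \<in> IS"
    using rel_ideal_mult_left[OF rel_ideal_mult_right[OF IS_commute]] by simp
  finally show "lead_symbol n h p \<in> IS" .
qed

text \<open>The difference arises only because \<open>L\<close> replaces \<open>v\<close> by its
  basis expansion, which the linear relations of S(V) identify with \<open>v\<close>.\<close>

lemma lead_symbol_L: "lead_symbol (Suc n) h (L v m) - gen v * lead_symbol n h m \<in> IS"
proof (rule linear_mem[where p = m and F = "\<lambda>m. lead_symbol (Suc n) h (L v m) - gen v * lead_symbol n h m"])
  show "Vector_Spaces.linear pm_scale pm_scale (\<lambda>m. lead_symbol (Suc n) h (L v m) - gen v * lead_symbol n h m)"
    by (intro linear_pm_diff linear_pm_comp[OF L_linear lead_symbol_linear] linear_pm_comp[OF lead_symbol_linear linear_mult_left])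
  fix x :: "'v list \<times> 'g"
  obtain w h' where x: "x = (w, h')" by (cases x)
  have "lead_symbol (Suc n) h (L v (single x 1)) - gen v * lead_symbol n h (single x 1)
     = - ((gen v - (\<Sum>b\<in>B. pm_scale (representation B v b) (gen b))) * lead_symbol n h (single x 1))"
    by (auto simp: x L_def cons_op_def lead_symbol_single left_diff_distrib sum_distrib_right mult_single)
  also have "\<dots> \<in> IS"
    by (intro rel_ideal_uminus rel_ideal_mult_right IS_expand)
  finally show "lead_symbol (Suc n) h (L v (single x 1)) - gen v * lead_symbol n h (single x 1) \<in> IS" .
qed (rule subspace_rel_ideal)

text \<open>The \<open>lam\<close> terms of the recursion act on a shorter word, so they are
  invisible in the leading degree.\<close>

lemma lead_symbol_grp_op_word: "lead_symbol (length w) x (grp_op_word w g h) - (if x = g + h then single (map (act g) w) 1 else 0) \<in> IS"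
proof (induction w arbitrary: g)
  case Nil
  then show ?case by (simp add: lead_symbol_single)
next
  case (Cons v w)
  have "lead_symbol (Suc (length w)) x (grp_op_word w y h) = 0" for y
    by (rule lead_symbol_low[OF grp_op_word_words_le]) simp
  then have "lead_symbol (Suc (length w)) x (grp_op_word (v # w) g h) = lead_symbol (Suc (length w)) x (L (act g v) (grp_op_word w g h))"
    by simp
  moreover have "lead_symbol (Suc (length w)) x (L (act g v) (grp_op_word w g h)) - gen (act g v) * lead_symbol (length w) x (grp_op_word w g h)
     + gen (act g v) * (lead_symbol (length w) x (grp_op_word w g h) - (if x = g + h then single (map (act g) w) 1 else 0)) \<in> IS"
    by (intro rel_ideal_add rel_ideal_mult_left lead_symbol_L Cons)
  ultimately show ?case
    by (auto simp: algebra_simps mult_single)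
qed

lemma lead_symbol_grp_op:
  assumes "m \<in> words_le n"
  shows "lead_symbol n (g + h) (grp_op g m) - free_alg_map (act g) (lead_symbol n h m) \<in> IS"
proof (rule words_le_induct[OF assms, where F = "\<lambda>m. lead_symbol n (g + h) (grp_op g m) - free_alg_map (act g) (lead_symbol n h m)"])
  fix w and h' :: 'g assume w: "set w \<subseteq> B" "length w \<le> n"
  show "lead_symbol n (g + h) (grp_op g (single (w, h') 1)) - free_alg_map (act g) (lead_symbol n h (single (w, h') 1)) \<in> IS"
  proof (cases "length w = n")
    case True
    then show ?thesis using lead_symbol_grp_op_word[of w "g + h" g h'] by (auto simp: lead_symbol_single split: if_splits)
  next
    case False
    then show ?thesis using lead_symbol_low[OF grp_op_word_words_le, of w n] w by (simp add: lead_symbol_single)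
  qed
qed (rule subspace_rel_ideal linear_pm_diff linear_pm_comp[OF grp_op_linear lead_symbol_linear]
      linear_pm_comp[OF lead_symbol_linear free_alg_map_linear])+

lemma word_op_words_le: "word_op w (single ([], 0) 1) \<in> words_le (wd w)"
  by (induction w rule: normal_word.induct) (simp_all add: words_le_single words_le_L words_le_grp_op)

text \<open>Applying a word to \<open>1 \<otimes> 1\<close> reproduces its normal form in leading
  degree. This is how the module detects symbols.\<close>

lemma lead_symbol_word_op: "lead_symbol (wd w) h (word_op w (single ([], 0) 1)) - symbol h (single w 1) \<in> IS"
proof (induction w arbitrary: h rule: normal_word.induct)
  case 1
  then show ?case by (auto simp: lead_symbol_single symbol_single simp flip: single_Nil)
next
  case (2 v w)
  let ?m = "word_op w (single ([], 0) 1)"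
  have "lead_symbol (Suc (wd w)) h (L v ?m) - gen v * lead_symbol (wd w) h ?m + gen v * (lead_symbol (wd w) h ?m - symbol h (single w 1)) \<in> IS"
    by (intro rel_ideal_add rel_ideal_mult_left lead_symbol_L 2(1))
  then show ?case by (auto simp: symbol_single mult_single algebra_simps split: if_splits)
next
  case (3 g w)
  let ?m = "word_op w (single ([], 0) 1)"
  \<comment> \<open>The only group element that left multiplication by \<open>g\<close> carries to
    \<open>h\<close>.\<close>
  define h' where "h' = - g + h"
  have h: "h = g + h'" by (simp add: h'_def flip: add.assoc)
  have "lead_symbol (wd w) (g + h') (grp_op g ?m) - free_alg_map (act g) (lead_symbol (wd w) h' ?m)
     + free_alg_map (act g) (lead_symbol (wd w) h' ?m - symbol h' (single w 1)) \<in> IS"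
    by (intro rel_ideal_add IS_act lead_symbol_grp_op[OF word_op_words_le] 3(1))
  then show ?case by (auto simp: symbol_single h algebra_simps split: if_splits)
qed

lemma lead_symbol_free_act:
  assumes "p \<in> deg_le wd n"
  shows "lead_symbol n h (free_act p (single ([], 0) 1)) - symbol h (hcomp wd n p) \<in> IS"
proof (rule linear_mem[where p = p and F = "\<lambda>p. lead_symbol n h (free_act p (single ([], 0) 1)) - symbol h (hcomp wd n p)"])
  show "Vector_Spaces.linear pm_scale pm_scale (\<lambda>p. lead_symbol n h (free_act p (single ([], 0) 1)) - symbol h (hcomp wd n p))"
    by (intro linear_pm_diff linear_pm_comp[OF free_act_linear_left lead_symbol_linear] linear_pm_comp[OF hcomp_linear symbol_linear])
  fix w assume "w \<in> keys p"
  then have "wd w \<le> n" using assms by (simp add: deg_le_def)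
  then show "lead_symbol n h (free_act (single w 1) (single ([], 0) 1)) - symbol h (hcomp wd n (single w 1)) \<in> IS"
    using lead_symbol_word_op[of w h] lead_symbol_low[OF word_op_words_le, of w n h]
    by (cases "wd w = n") (simp_all add: hcomp_single)
qed (rule subspace_rel_ideal)

lemma free_act_words_le:
  assumes "p \<in> deg_le wd n"
  shows "free_act p (single ([], 0) 1) \<in> words_le n"
  by (rule linear_mem[OF free_act_linear_left subspace_words_le])
     (use assms in \<open>auto simp: deg_le_def intro: words_le_mono[OF word_op_words_le]\<close>)

end

section \<open>Relations of H act into the relation submodule\<close>

context pbw_data
begin

text \<open>The ideal is generated by relations that act as zero or as some \<open>comm_op\<close>,
  and the union of all \<open>J n\<close> is stable under letters. No bound on \<open>n\<close> is
  tracked here; \<open>J_degree\<close> restores it.\<close>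

lemma IH_free_act: "p \<in> IH \<Longrightarrow> m \<in> words_le k \<Longrightarrow> \<exists>n. free_act p m \<in> J n"
proof -
  \<comment> \<open>Quantifying over all \<open>m\<close> makes the set stable under right
    multiplication, where the letter acts on \<open>m\<close> first.\<close>
  let ?K = "{p. \<forall>k. \<forall>m\<in>words_le k. \<exists>n. free_act p m \<in> J n}"
  have zero: "\<exists>n. 0 \<in> J n"
    by (simp add: pm.subspace_0)
  have "IH \<subseteq> ?K"
  proof (rule rel_ideal_minimal_words)
    show "pm.subspace ?K"
    proof (rule pm.subspaceI)
      fix p q assume pq: "p \<in> ?K" "q \<in> ?K"
      have "\<exists>n. free_act (p + q) m \<in> J n" if m: "m \<in> words_le k" for k m
      proof -
        obtain a b where "free_act p m \<in> J a" "free_act q m \<in> J b"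
          using pq m by blast
        then have "free_act p m \<in> J (max a b)" "free_act q m \<in> J (max a b)"
          by (auto intro: J_mono)
        then show ?thesis by (intro exI[of _ "max a b"]) (simp add: pm.subspace_add)
      qed
      then show "p + q \<in> ?K" by blast
      show "pm_scale c p \<in> ?K" for c
        using pq(1) pm.subspace_scale[OF subspace_J] by fastforce
    qed (use pm.subspace_0[OF subspace_J] in auto)
  next
    fix p x assume p: "p \<in> ?K"
    then have K: "\<And>k m. m \<in> words_le k \<Longrightarrow> \<exists>n. free_act p m \<in> J n"
      by simp
    have "\<exists>n. letter_op x (free_act p m) \<in> J n" if m: "m \<in> words_le k" for k m
    proof -
      obtain n where n: "free_act p m \<in> J n" using K[OF m] by blast
      have "letter_op x (free_act p m) \<in> J (Suc n)"
        using J_L[OF n] J_mono[OF J_grp_op[OF n], of "Suc n"] by (cases x) simp_all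
      then show ?thesis by (rule exI)
    qed
    then show "gen x * p \<in> ?K" by (simp add: free_act_mult_gen)
    have "letter_op x m \<in> words_le (Suc k)" if "m \<in> words_le k" for k m
      using that words_le_mono[OF words_le_grp_op[OF that], of "Suc k"] by (cases x) (simp_all add: words_le_L)
    from K[OF this] show "p * gen x \<in> ?K" by (auto simp: free_act_mult_gen)
  next
    \<comment> \<open>The identity of G fixes words in \<open>B\<close> only, because a letter
      outside \<open>B\<close> would be rewritten in the basis; hence the restriction to
      \<open>words_le\<close>.\<close>
    have "grp_op 0 m = m" if "m \<in> words_le k" for m k
      by (rule linear_eq_on_keys[OF grp_op_linear linear_pm_id])
         (use words_le_keys[OF that] in \<open>auto simp: grp_op_word_zero\<close>)
    moreover have "\<exists>n. comm_op v w m \<in> J n" if "m \<in> words_le k" for v w m k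
      using comm_op_mem[OF that, of "[]" "2 + k"] by auto
    ultimately show "H_rels scale act lam kap \<subseteq> ?K"
      unfolding H_rels_def linear_rels_def
      by (auto simp: mult_single free_act_group_alg_embed grp_op_grp_op grp_op_L L_left_simps comm_op_def zero)
  qed
  then show "p \<in> IH \<Longrightarrow> m \<in> words_le k \<Longrightarrow> \<exists>n. free_act p m \<in> J n" by blast
qed

text \<open>The relation \<open>p\<close> sends \<open>1 \<otimes> 1\<close> into some
  \<open>J N\<close>, hence into \<open>J n\<close> by degree. There leading symbols lie in
  \<open>IS\<close>, and they agree modulo \<open>IS\<close> with the symbols of the degree
  \<open>n\<close> part of \<open>p\<close>.\<close>

lemma U_imp_symbol_zero:
  assumes "p \<in> IH" "p \<in> deg_le wd n"
  shows "symbol h (hcomp wd n p) \<in> IS"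
proof -
  let ?m = "free_act p (single ([], 0) 1)"
  have "single ([], 0) 1 \<in> words_le 0"
    by (rule words_le_single) simp_all
  then obtain N where "?m \<in> J N"
    using IH_free_act[OF assms(1)] by blast
  then have "?m \<in> J n"
    by (rule J_degree[OF _ words_le_deg[OF free_act_words_le[OF assms(2)]]])
  from rel_ideal_diff[OF lead_symbol_J[OF this, of h] lead_symbol_free_act[OF assms(2), of h]] show ?thesis
    by simp
qed

end

section \<open>Presented algebras\<close>

abbreviation rel_coset :: "('x list \<Rightarrow>\<^sub>0 'k::field) set \<Rightarrow> ('x list \<Rightarrow>\<^sub>0 'k) \<Rightarrow> ('x list \<Rightarrow>\<^sub>0 'k) set" where
  "rel_coset R p \<equiv> rel_ideal R +>\<^bsub>free_alg\<^esub> p"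

lemma rel_coset_image: "rel_coset R p = (\<lambda>i. i + p) ` rel_ideal R"
  by (auto simp: a_r_coset_def')

lemma mem_rel_coset: "q \<in> rel_coset R p \<longleftrightarrow> q - p \<in> rel_ideal R"
  unfolding rel_coset_image by (metis (no_types, lifting) add_diff_cancel diff_add_cancel image_iff)

lemma rel_coset_eq_iff: "rel_coset R p = rel_coset R q \<longleftrightarrow> p - q \<in> rel_ideal R"
proof
  assume "rel_coset R p = rel_coset R q"
  moreover have "p \<in> rel_coset R p" by (simp add: mem_rel_coset)
  ultimately show "p - q \<in> rel_ideal R" by (simp add: mem_rel_coset)
next
  assume pq: "p - q \<in> rel_ideal R"
  have "x - p \<in> rel_ideal R \<longleftrightarrow> x - q \<in> rel_ideal R" for x
    using rel_ideal_add[OF _ pq, of "x - p"] rel_ideal_diff[OF _ pq, of "x - q"] by auto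
  then show "rel_coset R p = rel_coset R q" by (auto simp: mem_rel_coset)
qed

lemma
  fixes R :: "('x list \<Rightarrow>\<^sub>0 'k::field) set"
  shows carrier_presented_alg: "carrier (presented_alg R) = range (rel_coset R)"
    and mult_presented_alg: "rel_coset R p \<otimes>\<^bsub>presented_alg R\<^esub> rel_coset R q = rel_coset R (p * q)"
    and add_presented_alg: "rel_coset R p \<oplus>\<^bsub>presented_alg R\<^esub> rel_coset R q = rel_coset R (p + q)"
    and one_presented_alg: "\<one>\<^bsub>presented_alg R\<^esub> = rel_coset R 1"
    and zero_presented_alg: "\<zero>\<^bsub>presented_alg R\<^esub> = rel_coset R 0"
    and smult_presented_alg: "c \<odot>\<^bsub>presented_alg R\<^esub> rel_coset R p = rel_coset R (pm_scale c p)"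
proof -
  let ?F = "free_alg :: ('k, 'x list \<Rightarrow>\<^sub>0 'k) module"
  interpret ideal "rel_ideal R" ?F by (rule ideal_rel_ideal)
  have carrier: "carrier (presented_alg R) = a_rcosets\<^bsub>?F\<^esub> rel_ideal R"
    and mult: "mult (presented_alg R) = rcoset_mult ?F (rel_ideal R)"
    and add: "add (presented_alg R) = set_add ?F"
    and zero: "zero (presented_alg R) = rel_ideal R"
    and smult: "smult (presented_alg R) = (\<lambda>c X. \<Union>x\<in>X. rel_coset R (pm_scale c x))"
    by (simp_all add: presented_alg_def alg_quot_def ring.defs module.defs FactRing_def)
  show "carrier (presented_alg R) = range (rel_coset R)"
    by (auto simp: carrier A_RCOSETS_def')
  show "rel_coset R p \<otimes>\<^bsub>presented_alg R\<^esub> rel_coset R q = rel_coset R (p * q)"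
    using rcoset_mult_add[of p q] by (simp add: mult)
  show "rel_coset R p \<oplus>\<^bsub>presented_alg R\<^esub> rel_coset R q = rel_coset R (p + q)"
    using a_rcos_sum[of p q] by (simp add: add)
  show "\<one>\<^bsub>presented_alg R\<^esub> = rel_coset R 1"
    by (simp add: presented_alg_def alg_quot_def ring.defs module.defs FactRing_def)
  show "\<zero>\<^bsub>presented_alg R\<^esub> = rel_coset R 0"
    by (auto simp: zero mem_rel_coset)
  have "rel_coset R (pm_scale c x) = rel_coset R (pm_scale c p)" if "x \<in> rel_coset R p" for x
    using rel_ideal_scale[of "x - p" R c] that by (simp add: mem_rel_coset rel_coset_eq_iff pm.scale_right_diff_distrib)
  moreover have "p \<in> rel_coset R p"
    by (simp add: mem_rel_coset)
  ultimately show "c \<odot>\<^bsub>presented_alg R\<^esub> rel_coset R p = rel_coset R (pm_scale c p)"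
    unfolding smult by blast
qed

lemma abelian_monoid_presented_alg: "abelian_monoid (presented_alg R)"
  for R :: "('x list \<Rightarrow>\<^sub>0 'k::field) set"
  by (rule abelian_monoidI)
     (auto simp: carrier_presented_alg add_presented_alg zero_presented_alg add.assoc add.commute add.left_commute)

lemma finsum_presented_alg:
  fixes R :: "('x list \<Rightarrow>\<^sub>0 'k::field) set"
  assumes "finite A"
  shows "finsum (presented_alg R) (\<lambda>i. rel_coset R (f i)) A = rel_coset R (sum f A)"
proof -
  interpret abelian_monoid "presented_alg R" by (rule abelian_monoid_presented_alg)
  show ?thesis
    using assms
    by (induction A rule: finite_induct)
       (simp_all add: zero_presented_alg add_presented_alg carrier_presented_alg)
qed

section \<open>Surjections with equal kernels\<close>

text \<open>The isomorphism sends \<open>F p\<close> to \<open>G p\<close>. Equality of kernels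
  makes this well defined and injective; the rest is inherited from the common domain.\<close>

lemma graded_alg_isomorphic_of_surjections:
  assumes F: "carrier A = range F" "carrier B = range G" and eq: "\<And>p q. F p = F q \<longleftrightarrow> G p = G q"
    and add: "\<And>p q. F p \<oplus>\<^bsub>A\<^esub> F q = F (p + q)" "\<And>p q. G p \<oplus>\<^bsub>B\<^esub> G q = G (p + q)"
    and mult: "\<And>p q. F p \<otimes>\<^bsub>A\<^esub> F q = F (p * q)" "\<And>p q. G p \<otimes>\<^bsub>B\<^esub> G q = G (p * q)"
    and one: "\<one>\<^bsub>A\<^esub> = F 1" "\<one>\<^bsub>B\<^esub> = G 1"
    and smult: "\<And>c p. c \<odot>\<^bsub>A\<^esub> F p = F (s c p)" "\<And>c p. c \<odot>\<^bsub>B\<^esub> G p = G (s c p)"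
    and grading: "\<And>n. dA n = F ` D n" "\<And>n. dB n = G ` D n"
  shows "graded_alg_isomorphic A dA B dB"
proof -
  define \<phi> where "\<phi> a = G (SOME p. F p = a)" for a
  have \<phi>: "\<phi> (F p) = G p" for p
    unfolding \<phi>_def eq[symmetric] by (rule someI) (rule refl)
  have "\<phi> \<in> ring_hom A B"
    by (rule ring_hom_memI) (auto simp: F \<phi> add mult one)
  moreover have "bij_betw \<phi> (carrier A) (carrier B)"
    unfolding F by (rule bij_betwI') (auto simp: \<phi> eq)
  ultimately have "\<phi> \<in> ring_iso A B"
    by (simp add: ring_iso_def)
  moreover have "\<phi> (c \<odot>\<^bsub>A\<^esub> x) = c \<odot>\<^bsub>B\<^esub> \<phi> x" if "x \<in> carrier A" for c x
    using that by (auto simp: F \<phi> smult)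
  moreover have "\<phi> ` dA n = dB n" for n
    by (simp add: grading image_image \<phi>)
  ultimately show ?thesis
    unfolding graded_alg_isomorphic_def by blast
qed

context skew_data
begin

section \<open>The skew group algebra as an image of the free algebra\<close>

abbreviation SG :: "('k, 'g \<Rightarrow> ('v list \<Rightarrow>\<^sub>0 'k) set) module" where
  "SG \<equiv> skew_group_alg (symmetric_alg scale) (symmetric_action act)"

abbreviation sym_coset :: "('v list \<Rightarrow>\<^sub>0 'k) \<Rightarrow> ('v list \<Rightarrow>\<^sub>0 'k) set" where
  "sym_coset \<equiv> rel_coset (symmetric_rels scale)"

definition symbol_class :: "(('v + 'g) list \<Rightarrow>\<^sub>0 'k) \<Rightarrow> ('g \<Rightarrow> ('v list \<Rightarrow>\<^sub>0 'k) set)" where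
  "symbol_class p = (\<lambda>h. sym_coset (symbol h p))"

lemma symbol_class_eq_iff: "symbol_class p = symbol_class q \<longleftrightarrow> (\<forall>h. symbol h (p - q) \<in> IS)"
  by (simp add: symbol_class_def fun_eq_iff rel_coset_eq_iff)

lemma symmetric_action_sym_coset: "symmetric_action act g (sym_coset p) = sym_coset (free_alg_map (act g) p)"
proof -
  have "symmetric_action act g (sym_coset p) = (\<lambda>x. x + free_alg_map (act g) p) ` (free_alg_map (act g) ` IS)"
    by (simp add: symmetric_action_def rel_coset_image image_image)
  also have "\<dots> = sym_coset (free_alg_map (act g) p)"
    by (simp only: IS_act_image rel_coset_image)
  finally show ?thesis .
qed

text \<open>A section of the symbol map: \<open>T(V) \<otimes> kG\<close> placed in the free algebra
  with group letters last.\<close>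

definition iota :: "('g \<Rightarrow> 'v list \<Rightarrow>\<^sub>0 'k) \<Rightarrow> (('v + 'g) list \<Rightarrow>\<^sub>0 'k)" where
  "iota r = (\<Sum>g\<in>UNIV. free_alg_map Inl (r g) * gen (Inr g))"

lemma normal_word_normal: "normal_word (map Inl w @ [Inr g]) = (w, g)"
  by (induction w) simp_all

lemma symbol_iota: "symbol h (iota r) = r h"
proof -
  have 1: "symbol h (free_alg_map Inl q * gen (Inr g)) = (if g = h then q else 0)" for q g
  proof (rule linear_eq_on_keys[where s = pm_scale and p = q and F = "\<lambda>q. symbol h (free_alg_map Inl q * gen (Inr g))"])
    show "Vector_Spaces.linear pm_scale pm_scale (\<lambda>q. symbol h (free_alg_map Inl q * gen (Inr g)))"
      by (rule linear_pm_comp[OF linear_pm_comp[OF free_alg_map_linear linear_mult_right] symbol_linear])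
    show "Vector_Spaces.linear pm_scale pm_scale (\<lambda>q. if g = h then q else 0 :: 'v list \<Rightarrow>\<^sub>0 'k)"
      by (rule linear_pmI) simp_all
  qed (simp add: mult_single symbol_single normal_word_normal)
  have "symbol h (iota r) = (\<Sum>g\<in>UNIV. if g = h then r h else 0)"
    unfolding iota_def symbol_simps by (rule sum.cong) (auto simp: 1)
  then show ?thesis by simp
qed

lemma iota_deg_eq: "(\<And>g. r g \<in> deg_eq length n) \<Longrightarrow> iota r \<in> deg_eq wd n"
  unfolding iota_def
proof (intro pm.subspace_sum subspace_deg_eq)
  fix g assume "\<And>g. r g \<in> deg_eq length n"
  then have r: "r g \<in> deg_eq length n" .
  show "free_alg_map Inl (r g) * gen (Inr g) \<in> deg_eq wd n"
    by (rule linear_mem[where p = "r g" and F = "\<lambda>q. free_alg_map Inl q * gen (Inr g)",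
          OF linear_pm_comp[OF free_alg_map_linear linear_mult_right] subspace_deg_eq])
       (use r in \<open>auto simp: mult_single deg_eq_def\<close>)
qed

lemma symbol_deg_eq: "p \<in> deg_eq wd n \<Longrightarrow> symbol h p \<in> deg_eq length n"
  using hcomp_deg_eq[of length n "symbol h p"] by (simp add: hcomp_id flip: symbol_hcomp)

lemma carrier_SG: "carrier SG = range symbol_class"
proof (intro equalityI subsetI)
  fix r assume "r \<in> carrier SG"
  then have "\<forall>g. \<exists>q. r g = sym_coset q"
    by (auto simp: skew_group_alg_def symmetric_alg_def carrier_presented_alg)
  then obtain q where "r g = sym_coset (q g)" for g by metis
  then have "r = symbol_class (iota q)"
    by (simp add: symbol_class_def symbol_iota fun_eq_iff)
  then show "r \<in> range symbol_class" by blast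
qed (auto simp: skew_group_alg_def symmetric_alg_def carrier_presented_alg symbol_class_def)

lemma add_SG: "symbol_class p \<oplus>\<^bsub>SG\<^esub> symbol_class q = symbol_class (p + q)"
  by (simp add: skew_group_alg_def symmetric_alg_def add_presented_alg symbol_class_def)

lemma smult_SG: "c \<odot>\<^bsub>SG\<^esub> symbol_class p = symbol_class (pm_scale c p)"
  by (simp add: skew_group_alg_def symmetric_alg_def smult_presented_alg symbol_class_def)

lemma one_SG: "\<one>\<^bsub>SG\<^esub> = symbol_class 1"
  by (auto simp: skew_group_alg_def symmetric_alg_def one_presented_alg zero_presented_alg symbol_class_def symbol_one fun_eq_iff)

lemma mult_SG: "symbol_class p \<otimes>\<^bsub>SG\<^esub> symbol_class q = symbol_class (p * q)"
proof
  fix x :: 'g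
  have fin: "finite {(g, h). g + h = x}"
    by (rule finite)
  show "(symbol_class p \<otimes>\<^bsub>SG\<^esub> symbol_class q) x = symbol_class (p * q) x"
    by (simp add: skew_group_alg_def symmetric_alg_def symbol_class_def symmetric_action_sym_coset mult_presented_alg symbol_mult
        prod.case_distrib[of sym_coset] flip: finsum_presented_alg[OF fin])
qed

lemma grading_SG: "(skew_group_grading (symmetric_grading scale) n :: ('g \<Rightarrow> _) set) = symbol_class ` deg_eq wd n"
proof -
  have S: "symmetric_grading scale n = sym_coset ` deg_eq length n"
    by (simp add: symmetric_grading_def presented_grading_def deg_eq_def word_degree_def sum_list_triv)
  show ?thesis
  proof (intro equalityI subsetI)
    fix r :: "'g \<Rightarrow> _" assume "r \<in> skew_group_grading (symmetric_grading scale) n"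
    then have "\<forall>g. \<exists>q. q \<in> deg_eq length n \<and> r g = sym_coset q"
      by (auto simp: skew_group_grading_def S)
    then obtain q :: "'g \<Rightarrow> 'v list \<Rightarrow>\<^sub>0 'k" where q: "\<And>g. q g \<in> deg_eq length n" "\<And>g. r g = sym_coset (q g)" by metis
    then have "r = symbol_class (iota q)"
      by (simp add: symbol_class_def symbol_iota fun_eq_iff)
    then show "r \<in> symbol_class ` deg_eq wd n" using iota_deg_eq[of q, OF q(1)] by blast
  qed (auto simp: skew_group_grading_def S symbol_class_def symbol_deg_eq)
qed

section \<open>The associated graded algebra as an image of the free algebra\<close>

abbreviation H :: "('k, (('v + 'g) list \<Rightarrow>\<^sub>0 'k) set) module" where
  "H \<equiv> H_alg scale act lam kap"

abbreviation FH :: "nat \<Rightarrow> (('v + 'g) list \<Rightarrow>\<^sub>0 'k) set set" where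
  "FH \<equiv> H_filtration scale act lam kap"

abbreviation H_coset :: "(('v + 'g) list \<Rightarrow>\<^sub>0 'k) \<Rightarrow> (('v + 'g) list \<Rightarrow>\<^sub>0 'k) set" where
  "H_coset \<equiv> rel_coset (H_rels scale act lam kap)"

lemmas H_simps =
  carrier_presented_alg[of "H_rels scale act lam kap", folded H_alg_def]
  mult_presented_alg[of "H_rels scale act lam kap", folded H_alg_def]
  add_presented_alg[of "H_rels scale act lam kap", folded H_alg_def]
  one_presented_alg[of "H_rels scale act lam kap", folded H_alg_def]
  zero_presented_alg[of "H_rels scale act lam kap", folded H_alg_def]
  smult_presented_alg[of "H_rels scale act lam kap", folded H_alg_def]

lemma FH_eq: "FH n = H_coset ` deg_le wd n"
  by (simp add: H_filtration_def presented_filtration_def deg_le_def wd_def)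

lemma filt_below_eq: "filt_below H FH n = H_coset ` deg_lt wd n"
proof (cases n)
  case 0
  have "deg_lt wd 0 = {0 :: ('v + 'g) list \<Rightarrow>\<^sub>0 'k}"
    by (auto simp: deg_lt_def simp flip: keys_eq_empty)
  then show ?thesis using 0 by (simp add: filt_below_def H_simps)
next
  case (Suc m)
  then show ?thesis by (simp add: filt_below_def FH_eq deg_le_def deg_lt_def less_Suc_eq_le)
qed

lemma coset_image: "X +>\<^bsub>A\<^esub> a = (\<lambda>x. x \<oplus>\<^bsub>A\<^esub> a) ` X"
  by (auto simp: a_r_coset_def')

text \<open>A coset of \<open>filt_below\<close> expressed through free-algebra representatives;
  \<open>U n\<close> absorbs both the relations and the lower filtration step.\<close>

definition gr_coset :: "nat \<Rightarrow> (('v + 'g) list \<Rightarrow>\<^sub>0 'k) \<Rightarrow> (('v + 'g) list \<Rightarrow>\<^sub>0 'k) set set" where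
  "gr_coset n p = H_coset ` {q. q - p \<in> U n}"

lemma gr_coset_eq_iff: "gr_coset n p = gr_coset n q \<longleftrightarrow> p - q \<in> U n"
proof
  assume eq: "gr_coset n p = gr_coset n q"
  have "H_coset p \<in> gr_coset n p"
    by (simp add: gr_coset_def pm.subspace_0[OF subspace_U])
  then obtain r where r: "r - q \<in> U n" "H_coset p = H_coset r"
    unfolding eq by (auto simp: gr_coset_def)
  then have "p - r \<in> U n"
    by (intro IH_U) (simp add: rel_coset_eq_iff)
  from pm.subspace_add[OF subspace_U this r(1)] show "p - q \<in> U n" by simp
next
  assume pq: "p - q \<in> U n"
  have "x - p \<in> U n \<longleftrightarrow> x - q \<in> U n" for x
    using pm.subspace_add[OF subspace_U _ pq, of "x - p"] pm.subspace_diff[OF subspace_U _ pq, of "x - q"] by auto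
  then show "gr_coset n p = gr_coset n q" by (simp add: gr_coset_def)
qed

lemma H_coset_mem_gr_coset: "H_coset q \<in> gr_coset n p \<longleftrightarrow> q - p \<in> U n"
proof -
  have "H_coset q \<in> gr_coset n p \<longleftrightarrow> (\<exists>r. r - p \<in> U n \<and> q - r \<in> IH)"
    by (auto simp: gr_coset_def rel_coset_eq_iff)
  also have "\<dots> \<longleftrightarrow> q - p \<in> U n"
  proof
    assume "\<exists>r. r - p \<in> U n \<and> q - r \<in> IH"
    then obtain r where "r - p \<in> U n" "q - r \<in> U n" using IH_U by blast
    from pm.subspace_add[OF subspace_U this] show "q - p \<in> U n" by simp
  qed (auto intro!: exI[of _ q])
  finally show ?thesis .
qed

lemma clsE:
  assumes "X \<in> gr_coset n p"
  obtains q where "X = H_coset q" "q - p \<in> U n"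
  using assms unfolding gr_coset_def by blast

lemma coset_gr_coset: "filt_below H FH n +>\<^bsub>H\<^esub> H_coset p = gr_coset n p"
proof -
  have "filt_below H FH n +>\<^bsub>H\<^esub> H_coset p = (\<lambda>q. H_coset (q + p)) ` deg_lt wd n"
    by (simp add: filt_below_eq coset_image[where A = H] image_image H_simps)
  also have "\<dots> = gr_coset n p"
  proof (intro equalityI subsetI)
    fix X assume "X \<in> (\<lambda>q. H_coset (q + p)) ` deg_lt wd n"
    then show "X \<in> gr_coset n p" using deg_lt_U by (auto simp: H_coset_mem_gr_coset)
  next
    fix X assume "X \<in> gr_coset n p"
    then obtain q where q: "X = H_coset q" "q - p \<in> U n" by (rule clsE)
    then obtain a b where "q - p = a + b" "a \<in> IH" "b \<in> deg_lt wd n" by (auto simp: U_def)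
    then have "H_coset q = H_coset (b + p)" by (simp add: rel_coset_eq_iff algebra_simps)
    then show "X \<in> (\<lambda>q. H_coset (q + p)) ` deg_lt wd n" using q \<open>b \<in> deg_lt wd n\<close> by blast
  qed
  finally show ?thesis .
qed

lemma filt_below_gr_coset: "filt_below H FH n = gr_coset n 0"
proof -
  have "filt_below H FH n = filt_below H FH n +>\<^bsub>H\<^esub> H_coset 0"
    by (simp add: filt_below_eq coset_image[where A = H] image_image H_simps)
  then show ?thesis by (simp only: coset_gr_coset)
qed

abbreviation GH :: "('k, nat \<Rightarrow> (('v + 'g) list \<Rightarrow>\<^sub>0 'k) set set) module" where
  "GH \<equiv> assoc_graded H FH"

text \<open>The graded surjection from the free algebra onto gr(H). Taking components first matters:
  the class of \<open>p\<close> in degree \<open>n\<close> uses only its words of that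
  degree.\<close>

definition gr_class :: "(('v + 'g) list \<Rightarrow>\<^sub>0 'k) \<Rightarrow> (nat \<Rightarrow> (('v + 'g) list \<Rightarrow>\<^sub>0 'k) set set)" where
  "gr_class p = (\<lambda>n. gr_coset n (hcomp wd n p))"

lemma gr_class_eq_iff: "gr_class p = gr_class q \<longleftrightarrow> (\<forall>n. hcomp wd n (p - q) \<in> U n)"
  by (simp add: gr_class_def fun_eq_iff gr_coset_eq_iff)

lemma mem_carrier_GH:
  "a \<in> carrier GH \<longleftrightarrow> (\<forall>n. \<exists>p\<in>deg_le wd n. a n = gr_coset n p) \<and> finite {n. a n \<noteq> gr_coset n 0}"
  by (simp add: assoc_graded_def Let_def FH_eq coset_gr_coset) (simp add: filt_below_gr_coset)

lemma carrier_GH: "carrier GH = range gr_class"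
proof (intro equalityI subsetI)
  fix a assume "a \<in> range gr_class"
  then obtain p where a: "a = gr_class p" by blast
  have "finite {n. gr_class p n \<noteq> gr_coset n 0}"
    by (rule finite_subset[OF _ finite_hcomp_support[of wd p]]) (auto simp: gr_class_def)
  then show "a \<in> carrier GH"
    using deg_eq_le[OF hcomp_deg_eq[of wd _ p]] by (auto simp: a mem_carrier_GH gr_class_def)
next
  fix a assume "a \<in> carrier GH"
  then obtain P where P: "\<And>n. P n \<in> deg_le wd n" "\<And>n. a n = gr_coset n (P n)"
    and fin: "finite {n. a n \<noteq> gr_coset n 0}"
    unfolding mem_carrier_GH by metis
  \<comment> \<open>Representatives must be homogeneous and almost all exactly zero, so that their
    sum is an element of the free algebra whose components they are.\<close>
  define Q where "Q n = (if a n = gr_coset n 0 then 0 else hcomp wd n (P n))" for n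
  have aQ: "a n = gr_coset n (Q n)" for n
    using deg_lt_U[OF diff_hcomp_deg_lt[OF P(1)]] by (auto simp: Q_def P(2) gr_coset_eq_iff)
  have Q: "Q n \<in> deg_eq wd n" for n
    by (simp add: Q_def hcomp_deg_eq) (simp add: deg_eq_def)
  have "hcomp wd n (\<Sum>i\<in>{n. a n \<noteq> gr_coset n 0}. Q i) = Q n" for n
    by (rule hcomp_sum_deg_eq[OF fin Q]) (simp add: Q_def)
  then have "a = gr_class (\<Sum>i\<in>{n. a n \<noteq> gr_coset n 0}. Q i)"
    by (simp add: gr_class_def aQ fun_eq_iff)
  then show "a \<in> range gr_class" by blast
qed

lemma add_GH: "gr_class p \<oplus>\<^bsub>GH\<^esub> gr_class q = gr_class (p + q)"
proof
  fix n
  let ?p = "hcomp wd n p" and ?q = "hcomp wd n q"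
  have "gr_coset n ?p <+>\<^bsub>H\<^esub> gr_coset n ?q = gr_coset n (?p + ?q)"
  proof (intro equalityI subsetI)
    fix X assume "X \<in> gr_coset n ?p <+>\<^bsub>H\<^esub> gr_coset n ?q"
    then obtain a b where ab: "X = H_coset (a + b)" "a - ?p \<in> U n" "b - ?q \<in> U n"
      by (auto simp: set_add_def' gr_coset_def H_simps)
    from pm.subspace_add[OF subspace_U ab(2,3)] show "X \<in> gr_coset n (?p + ?q)"
      by (simp add: ab(1) H_coset_mem_gr_coset algebra_simps)
  next
    fix X assume "X \<in> gr_coset n (?p + ?q)"
    then obtain a where a: "X = H_coset a" "a - (?p + ?q) \<in> U n"
      by (rule clsE)
    have "X = H_coset ?p \<oplus>\<^bsub>H\<^esub> H_coset (a - ?p)"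
      by (simp add: H_simps a)
    moreover have "H_coset ?p \<in> gr_coset n ?p" "H_coset (a - ?p) \<in> gr_coset n ?q"
      using a(2) by (simp_all add: H_coset_mem_gr_coset pm.subspace_0[OF subspace_U] algebra_simps)
    ultimately show "X \<in> gr_coset n ?p <+>\<^bsub>H\<^esub> gr_coset n ?q"
      by (auto simp: set_add_def')
  qed
  then show "(gr_class p \<oplus>\<^bsub>GH\<^esub> gr_class q) n = gr_class (p + q) n"
    by (simp add: assoc_graded_def Let_def gr_class_def)
qed

lemma smult_GH: "c \<odot>\<^bsub>GH\<^esub> gr_class p = gr_class (pm_scale c p)"
proof
  fix n
  let ?p = "hcomp wd n p"
  have "filt_below H FH n +>\<^bsub>H\<^esub> (c \<odot>\<^bsub>H\<^esub> X) = gr_coset n (pm_scale c ?p)" if X: "X \<in> gr_coset n ?p" for X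
  proof -
    obtain a where a: "X = H_coset a" "a - ?p \<in> U n"
      using X by (rule clsE)
    show ?thesis
      using pm.subspace_scale[OF subspace_U a(2), of c]
      by (simp add: a(1) H_simps coset_gr_coset gr_coset_eq_iff pm.scale_right_diff_distrib)
  qed
  moreover have "H_coset ?p \<in> gr_coset n ?p"
    by (simp add: H_coset_mem_gr_coset pm.subspace_0[OF subspace_U])
  ultimately show "(c \<odot>\<^bsub>GH\<^esub> gr_class p) n = gr_class (pm_scale c p) n"
    by (simp add: assoc_graded_def Let_def gr_class_def) blast
qed

lemma one_GH: "\<one>\<^bsub>GH\<^esub> = gr_class 1"
proof -
  have "hcomp wd n 1 = (if n = 0 then 1 else 0 :: ('v + 'g) list \<Rightarrow>\<^sub>0 'k)" for n
    using hcomp_single[of wd n "[]" 1] by auto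
  then show ?thesis
    by (simp add: assoc_graded_def Let_def gr_class_def H_simps coset_gr_coset fun_eq_iff) (simp add: filt_below_gr_coset)
qed

lemma hcomp_mult: "hcomp wd n (p * q) = (\<Sum>i\<le>n. hcomp wd i p * hcomp wd (n - i) q)"
  for p q :: "('v + 'g) list \<Rightarrow>\<^sub>0 'k"
proof (rule bilinear_eqI[where p = p and q = q])
  show "Vector_Spaces.linear pm_scale pm_scale (\<lambda>p :: ('v + 'g) list \<Rightarrow>\<^sub>0 'k. hcomp wd n (p * q))" for q
    by (rule linear_pm_comp[OF linear_mult_right hcomp_linear])
  show "Vector_Spaces.linear pm_scale pm_scale (\<lambda>q :: ('v + 'g) list \<Rightarrow>\<^sub>0 'k. hcomp wd n (single w 1 * q))" for w
    by (rule linear_pm_comp[OF linear_mult_left hcomp_linear])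
  show "Vector_Spaces.linear pm_scale pm_scale (\<lambda>p :: ('v + 'g) list \<Rightarrow>\<^sub>0 'k. \<Sum>i\<le>n. hcomp wd i p * hcomp wd (n - i) q)" for q
    by (intro linear_pm_sum linear_pm_comp[OF hcomp_linear linear_mult_right])
  show "Vector_Spaces.linear pm_scale pm_scale
      (\<lambda>q :: ('v + 'g) list \<Rightarrow>\<^sub>0 'k. \<Sum>i\<le>n. hcomp wd i (single w 1) * hcomp wd (n - i) q)" for w
    by (intro linear_pm_sum linear_pm_comp[OF hcomp_linear linear_mult_left])
  fix w w' :: "('v + 'g) list"
  have "(\<Sum>i\<le>n. hcomp wd i (grp w) * hcomp wd (n - i) (grp w' :: _ \<Rightarrow>\<^sub>0 'k))
     = (\<Sum>i\<le>n. if i = wd w then if wd w + wd w' = n then single (w @ w') 1 else 0 else 0)"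
    by (rule sum.cong) (auto simp: hcomp_single mult_single)
  also have "\<dots> = hcomp wd n (single w 1 * single w' 1)"
    by (auto simp: hcomp_single mult_single)
  finally show "hcomp wd n (single w 1 * single w' (1::'k))
    = (\<Sum>i\<le>n. hcomp wd i (grp w) * hcomp wd (n - i) (grp w'))" by simp
qed

text \<open>A representative \<open>b\<close> has bounded degree only modulo relations, so its
  relation part \<open>c\<close> is split off before the degree estimates are used. This makes the
  product of gr(H) independent of representatives.\<close>

lemma U_mult_diff:
  assumes "a - p \<in> U i" "p \<in> deg_le wd i" "b - q \<in> U j" "q \<in> deg_le wd j"
  shows "a * b - p * q \<in> U (i + j)"
proof -
  obtain c d where b: "b - q = c + d" "c \<in> IH" "d \<in> deg_lt wd j"
    using assms(3) by (auto simp: U_def)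
  have "q + d \<in> deg_le wd j"
    using b(3) assms(4) by (intro pm.subspace_add subspace_deg_le) (auto simp: deg_lt_def deg_le_def less_imp_le)
  have bb: "b = q + (c + d)"
    using b(1) by (simp add: diff_eq_eq add.commute)
  have "a * b - p * q = a * c + (a - p) * (q + d) + p * (b - q - c)"
    unfolding bb by (simp add: algebra_simps)
  also have "\<dots> \<in> U (i + j)"
  proof (intro pm.subspace_add subspace_U)
    show "a * c \<in> U (i + j)" by (intro IH_U rel_ideal_mult_left b)
    show "(a - p) * (q + d) \<in> U (i + j)" by (rule U_mult(2)) fact+
    show "p * (b - q - c) \<in> U (i + j)"
      using U_mult(1)[OF deg_lt_U[OF b(3)] assms(2)] by (simp add: b(1))
  qed
  finally show ?thesis .
qed

lemma UN_UN_const: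
  assumes "x0 \<in> X" "y0 \<in> Y" "\<And>x y. x \<in> X \<Longrightarrow> y \<in> Y \<Longrightarrow> f x y = Z"
  shows "(\<Union>x\<in>X. \<Union>y\<in>Y. f x y) = Z"
  using assms by blast

lemma mult_GH: "gr_class p \<otimes>\<^bsub>GH\<^esub> gr_class q = gr_class (p * q)"
proof
  fix n :: nat
  have fin: "finite {..n}" by simp
  have "filt_below H FH n +>\<^bsub>H\<^esub> (\<Oplus>\<^bsub>H\<^esub> i \<in> {..n}. x i \<otimes>\<^bsub>H\<^esub> y (n - i)) = gr_class (p * q) n"
    if x: "\<forall>i. x i \<in> gr_class p i" and y: "\<forall>i. y i \<in> gr_class q i" for x y
  proof -
    have ex: "\<exists>a. \<forall>i. x i = H_coset (a i) \<and> a i - hcomp wd i p \<in> U i" if "\<forall>i. x i \<in> gr_class p i" for x p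
    proof (rule choice, rule allI)
      fix i
      have "x i \<in> gr_coset i (hcomp wd i p)" using that by (simp add: gr_class_def)
      then show "\<exists>a. x i = H_coset a \<and> a - hcomp wd i p \<in> U i" by (elim clsE) blast
    qed
    from ex[OF x] obtain a where a: "\<And>i. x i = H_coset (a i)" "\<And>i. a i - hcomp wd i p \<in> U i"
      by blast
    from ex[OF y] obtain b where b: "\<And>i. y i = H_coset (b i)" "\<And>i. b i - hcomp wd i q \<in> U i"
      by blast
    have "(\<Oplus>\<^bsub>H\<^esub> i \<in> {..n}. x i \<otimes>\<^bsub>H\<^esub> y (n - i)) = H_coset (\<Sum>i\<le>n. a i * b (n - i))"
      by (simp add: a(1) b(1) H_simps finsum_presented_alg[OF fin, of "H_rels scale act lam kap", folded H_alg_def])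
    moreover have "(\<Sum>i\<le>n. a i * b (n - i)) - hcomp wd n (p * q) \<in> U n"
      unfolding hcomp_mult sum_subtractf[symmetric]
    proof (intro pm.subspace_sum subspace_U)
      fix i assume "i \<in> {..n}"
      then show "a i * b (n - i) - hcomp wd i p * hcomp wd (n - i) q \<in> U n"
        using U_mult_diff[OF a(2)[of i] deg_eq_le[OF hcomp_deg_eq] b(2)[of "n - i"] deg_eq_le[OF hcomp_deg_eq]]
        by simp
    qed
    ultimately show ?thesis
      by (simp add: coset_gr_coset gr_class_def gr_coset_eq_iff)
  qed
  moreover have "\<forall>i. H_coset (hcomp wd i p) \<in> gr_class p i" "\<forall>i. H_coset (hcomp wd i q) \<in> gr_class q i"
    by (simp_all add: gr_class_def H_coset_mem_gr_coset pm.subspace_0[OF subspace_U])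
  ultimately have "(\<Union>x \<in> {x. \<forall>i. x i \<in> gr_class p i}. \<Union>y \<in> {y. \<forall>i. y i \<in> gr_class q i}.
      filt_below H FH n +>\<^bsub>H\<^esub> (\<Oplus>\<^bsub>H\<^esub> i \<in> {..n}. x i \<otimes>\<^bsub>H\<^esub> y (n - i))) = gr_class (p * q) n"
    by (intro UN_UN_const[of "\<lambda>i. H_coset (hcomp wd i p)" _ "\<lambda>i. H_coset (hcomp wd i q)"]) simp_all
  then show "(gr_class p \<otimes>\<^bsub>GH\<^esub> gr_class q) n = gr_class (p * q) n"
    by (simp add: assoc_graded_def Let_def)
qed

lemma mem_grading_GH: "a \<in> assoc_graded_grading H FH n \<longleftrightarrow> a \<in> range gr_class \<and> (\<forall>m. m \<noteq> n \<longrightarrow> a m = gr_coset m 0)"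
  by (simp only: assoc_graded_grading_def filt_below_gr_coset carrier_GH mem_Collect_eq)

lemma grading_GH: "assoc_graded_grading H FH n = gr_class ` deg_eq wd n"
proof (intro equalityI subsetI)
  fix a assume "a \<in> assoc_graded_grading H FH n"
  then have "a \<in> range gr_class" and a: "\<And>m. m \<noteq> n \<Longrightarrow> a m = gr_coset m 0"
    unfolding mem_grading_GH by simp_all
  then obtain p where p: "a = gr_class p" by blast
  have "a m = gr_class (hcomp wd n p) m" for m
    by (cases "m = n") (simp_all add: a hcomp_other[OF hcomp_deg_eq] hcomp_id[OF hcomp_deg_eq] gr_class_def, simp add: p gr_class_def)
  then have "a = gr_class (hcomp wd n p)" ..
  then show "a \<in> gr_class ` deg_eq wd n" using hcomp_deg_eq by blast
next
  fix a assume "a \<in> gr_class ` deg_eq wd n"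
  then obtain p where p: "p \<in> deg_eq wd n" "a = gr_class p" by blast
  have "gr_class p m = gr_coset m 0" if "m \<noteq> n" for m
    using hcomp_other[OF p(1)] that by (simp add: gr_class_def)
  then show "a \<in> assoc_graded_grading H FH n"
    unfolding mem_grading_GH p(2) by simp
qed

end

section \<open>Sufficiency\<close>

lemma (in pbw_data) PBW: "PBW_property scale act lam kap"
proof -
  have eq: "gr_class p = gr_class q \<longleftrightarrow> symbol_class p = symbol_class q" for p q
  proof
    assume "symbol_class p = symbol_class q"
    then show "gr_class p = gr_class q"
      unfolding symbol_class_eq_iff gr_class_eq_iff using symbol_zero_imp_U by blast
  next
    assume gr: "gr_class p = gr_class q"
    \<comment> \<open>The component equals a relation \<open>a\<close> plus a lower term
      \<open>b\<close>. Then \<open>a\<close> has degree at most \<open>n\<close> and the component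
      as its leading part, so \<open>U_imp_symbol_zero\<close> applies to \<open>a\<close>.\<close>
    have "symbol h (hcomp wd n (p - q)) \<in> IS" for n h
    proof -
      obtain a b where ab: "hcomp wd n (p - q) = a + b" "a \<in> IH" "b \<in> deg_lt wd n"
        using gr unfolding gr_class_eq_iff U_def by blast
      have "b \<in> deg_le wd n"
        using ab(3) by (simp add: deg_lt_def deg_le_def less_imp_le)
      from pm.subspace_diff[OF subspace_deg_le deg_eq_le[OF hcomp_deg_eq] this]
      have "hcomp wd n (p - q) - b \<in> deg_le wd n" .
      then have "a \<in> deg_le wd n"
        unfolding ab(1) by simp
      from U_imp_symbol_zero[OF ab(2) this] have "symbol h (hcomp wd n (hcomp wd n (p - q) - b)) \<in> IS"
        unfolding ab(1) by simp
      moreover have "hcomp wd n (hcomp wd n (p - q) - b) = hcomp wd n (p - q)"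
        by (simp only: hcomp_simps(2)[of wd n "hcomp wd n (p - q)" b] hcomp_deg_lt[OF ab(3)] hcomp_id[OF hcomp_deg_eq] diff_zero)
      ultimately show ?thesis by (simp only:)
    qed
    moreover have "p - q = (\<Sum>n\<in>wd ` keys (p - q). hcomp wd n (p - q))"
      by (rule sum_hcomp)
    ultimately have "symbol h (p - q) \<in> IS" for h
      by (metis (mono_tags, lifting) symbol_simps(5) pm.subspace_sum subspace_rel_ideal)
    then show "symbol_class p = symbol_class q"
      unfolding symbol_class_eq_iff by blast
  qed
  show ?thesis
    unfolding PBW_property_def
    by (rule graded_alg_isomorphic_of_surjections[where F = gr_class and G = symbol_class and s = pm_scale and D = "deg_eq wd"])
       (simp_all only: carrier_GH carrier_SG eq add_GH add_SG mult_GH mult_SG one_GH one_SG smult_GH smult_SG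
         grading_GH grading_SG)
qed

section \<open>Linear independence in low degree\<close>

text \<open>Scalars on families over G with values in \<open>Y\<close>, a model of
  \<open>Y \<otimes> kG\<close>.\<close>

definition vscale :: "('k \<Rightarrow> 'y::zero \<Rightarrow> 'y) \<Rightarrow> 'k \<Rightarrow> ('g \<Rightarrow>\<^sub>0 'y) \<Rightarrow> ('g \<Rightarrow>\<^sub>0 'y)" where
  "vscale sy c = Poly_Mapping.map (sy c)"

lemma lookup_vscale: "vector_space sy \<Longrightarrow> lookup (vscale sy c f) g = sy c (lookup f g)"
proof -
  assume "vector_space sy"
  then interpret vector_space sy .
  show ?thesis by (simp add: vscale_def Poly_Mapping.map.rep_eq when_def)
qed

lemma vector_space_vscale:
  assumes "vector_space sy"
  shows "vector_space (vscale sy)"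
proof -
  interpret vector_space sy by fact
  show ?thesis
    by unfold_locales
       (auto intro!: poly_mapping_eqI simp: lookup_vscale[OF assms] lookup_add scale_right_distrib scale_left_distrib)
qed

lemma finite_dimensional_of_finite_span:
  assumes "vector_space s" "finite S" "module.span s S = UNIV"
  shows "\<exists>Bs. finite_dimensional_vector_space s Bs"
proof -
  interpret vector_space s by fact
  obtain T where T: "T \<subseteq> S" "independent T" "S \<subseteq> span T"
    using maximal_independent_subset[of S] by blast
  have "span T = UNIV"
    using span_minimal[OF T(3) subspace_span] assms(3) by auto
  then have "finite_dimensional_vector_space s T"
    using T finite_subset[OF T(1) assms(2)] by unfold_locales auto
  then show ?thesis by blast
qed

text \<open>G is finite, so the elements \<open>single g b\<close> with \<open>b\<close> in
  \<open>By\<close> form a finite spanning set.\<close>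

lemma finite_dimensional_vscale:
  fixes sy :: "'k::field \<Rightarrow> 'y::ab_group_add \<Rightarrow> 'y"
  assumes "finite_dimensional_vector_space sy By"
  shows "\<exists>Bs. finite_dimensional_vector_space (vscale sy :: 'k \<Rightarrow> ('g::finite \<Rightarrow>\<^sub>0 'y) \<Rightarrow> _) Bs"
proof (rule finite_dimensional_of_finite_span)
  interpret y: finite_dimensional_vector_space sy By by fact
  show "vector_space (vscale sy :: 'k \<Rightarrow> ('g \<Rightarrow>\<^sub>0 'y) \<Rightarrow> _)"
    by (rule vector_space_vscale) unfold_locales
  then interpret x: vector_space "vscale sy :: 'k \<Rightarrow> ('g \<Rightarrow>\<^sub>0 'y) \<Rightarrow> _" .
  let ?S = "(\<lambda>(g, b). single g b) ` (UNIV \<times> By) :: ('g \<Rightarrow>\<^sub>0 'y) set"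
  show "finite ?S" by (simp add: y.finite_Basis)
  have single: "single g u \<in> x.span ?S" for g u
  proof -
    have lin: "vscale sy c (single g u) = single g (sy c u)" for c u
      by (rule poly_mapping_eqI) (simp add: lookup_vscale y.vector_space_axioms lookup_single when_def)
    have "u \<in> y.span By" by (simp add: y.span_Basis)
    then show ?thesis
    proof (induction rule: y.span_induct_alt)
      case base
      then show ?case by (simp add: x.span_zero)
    next
      case (step c b u)
      have "single g b \<in> x.span ?S" using step.hyps by (intro x.span_base) auto
      then show ?case
        using step.IH by (simp add: single_add flip: lin) (intro x.span_add x.span_scale)
    qed
  qed
  have "f \<in> x.span ?S" for f
  proof -
    have "f = (\<Sum>g\<in>UNIV. single g (lookup f g))"
      by (rule poly_mapping_eqI) (simp add: lookup_sum lookup_single when_def)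
    also have "\<dots> \<in> x.span ?S" by (intro x.span_sum single)
    finally show ?thesis .
  qed
  then show "x.span ?S = UNIV" by blast
qed

context skew_data
begin

lemma iota_simps:
  "iota (\<lambda>g. r g + r' g) = iota r + iota r'"
  "iota (\<lambda>g. r g - r' g) = iota r - iota r'"
  "iota (\<lambda>g. pm_scale c (r g)) = pm_scale c (iota r)"
  by (simp_all add: iota_def distrib_right left_diff_distrib sum.distrib sum_subtractf pm_scale_mult_left
      flip: pm.scale_sum_right)

lemma iota_IS:
  assumes "\<And>g. r g \<in> IS" "\<And>g. r g \<in> deg_eq length n"
  shows "iota r \<in> U n"
  unfolding iota_def
proof (intro pm.subspace_sum subspace_U)
  fix g
  have "free_alg_map Inl (r g) \<in> U n"
    using symmetric_U[OF assms(1), of n g] by (simp add: hcomp_id assms(2))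
  from U_mult(2)[OF this, of "gen (Inr g)" 0] show "free_alg_map Inl (r g) * gen (Inr g) \<in> U n"
    by (simp add: deg_le_def)
qed

lemma gr_class_eqI: "p \<in> deg_eq wd n \<Longrightarrow> q \<in> deg_eq wd n \<Longrightarrow> p - q \<in> U n \<Longrightarrow> gr_class p = gr_class q"
proof -
  assume a: "p \<in> deg_eq wd n" "q \<in> deg_eq wd n" "p - q \<in> U n"
  have "hcomp wd m (p - q) \<in> U m" for m
  proof (cases "m = n")
    case True
    then show ?thesis using a by (simp add: hcomp_id)
  next
    case False
    then show ?thesis using a by (simp add: hcomp_other pm.subspace_0[OF subspace_U])
  qed
  then show ?thesis by (simp add: gr_class_eq_iff)
qed

text \<open>The elements \<open>iota (s \<circ> f)\<close> span the degree \<open>n\<close> part of the associated graded algebra. Composing with a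
  graded isomorphism onto the skew group algebra gives a surjective, hence injective, endomorphism of the
  finite-dimensional space of coefficient families \<open>f\<close>.\<close>

lemma symbols_independent:
  fixes sy :: "'k \<Rightarrow> 'y::ab_group_add \<Rightarrow> 'y" and s :: "'y \<Rightarrow> 'v list \<Rightarrow>\<^sub>0 'k" and f :: "'g \<Rightarrow>\<^sub>0 'y"
  assumes pbw: "PBW_property scale act lam kap" and fd: "finite_dimensional_vector_space sy By"
    and s_deg: "\<And>y. s y \<in> deg_eq length n"
    and s_add: "\<And>y y'. s (y + y') - (s y + s y') \<in> IS"
    and s_scale: "\<And>c y. s (sy c y) - pm_scale c (s y) \<in> IS"
    and \<delta>: "Vector_Spaces.linear pm_scale sy \<delta>" and \<delta>_IS: "\<And>q. q \<in> IS \<Longrightarrow> \<delta> q = 0"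
    and \<delta>_s: "\<And>y. \<delta> (s y) = y"
    and span: "\<And>q. q \<in> deg_eq length n \<Longrightarrow> q - s (\<delta> q) \<in> IS"
    and f: "iota (\<lambda>g. s (lookup f g)) \<in> U n"
  shows "f = 0"
proof -
  obtain \<phi> where iso: "\<phi> \<in> ring_iso GH SG"
    and \<phi>_scale: "\<And>c x. x \<in> carrier GH \<Longrightarrow> \<phi> (c \<odot>\<^bsub>GH\<^esub> x) = c \<odot>\<^bsub>SG\<^esub> \<phi> x"
    and \<phi>_grading: "\<And>n. \<phi> ` assoc_graded_grading H FH n = skew_group_grading (symmetric_grading scale) n"
    using pbw unfolding PBW_property_def graded_alg_isomorphic_def by blast
  \<comment> \<open>\<open>Y\<close> models the degree \<open>n\<close> part of S(V):
    \<open>s\<close> chooses representatives and \<open>\<delta>\<close> reads off the value of a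
    symbol in \<open>Y\<close>.\<close>
  define e where "e f = iota (\<lambda>g. s (lookup f g))" for f :: "'g \<Rightarrow>\<^sub>0 'y"
  have e_deg: "e f \<in> deg_eq wd n" for f
    unfolding e_def by (rule iota_deg_eq) (rule s_deg)
  have "\<exists>p. \<phi> (gr_class (e f)) = symbol_class p" for f
    using ring_iso_memE(1)[OF iso, of "gr_class (e f)"] by (auto simp: carrier_GH carrier_SG)
  then obtain P where P: "\<And>f. \<phi> (gr_class (e f)) = symbol_class (P f)"
    by metis
  have vs: "vector_space sy"
    using fd by (simp add: finite_dimensional_vector_space_def)
  \<comment> \<open>\<open>P\<close> is an arbitrary choice of representatives; since
    \<open>\<delta>\<close> kills \<open>IS\<close>, the value depends only on the class.\<close>
  define \<Psi> :: "('g \<Rightarrow>\<^sub>0 'y) \<Rightarrow> ('g \<Rightarrow>\<^sub>0 'y)" where "\<Psi> f = Abs_poly_mapping (\<lambda>g. \<delta> (symbol g (P f)))" for f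
  have lookup_\<Psi>: "lookup (\<Psi> f) g = \<delta> (symbol g (P f))" for f g
    unfolding \<Psi>_def by (subst lookup_Abs_poly_mapping) simp_all
  have \<delta>_symbol_class: "\<delta> (symbol g p) = \<delta> (symbol g q)" if "symbol_class p = symbol_class q" for p q g
  proof -
    have "\<delta> (symbol g (p - q)) = 0"
      using that unfolding symbol_class_eq_iff by (blast intro: \<delta>_IS)
    then show ?thesis by (simp add: linear_diffD[OF \<delta>])
  qed
  have "Vector_Spaces.linear (vscale sy) (vscale sy) \<Psi>"
    unfolding Vector_Spaces.linear_iff
  proof (intro conjI allI vector_space_vscale vs)
    fix f f' :: "'g \<Rightarrow>\<^sub>0 'y" and c
    have "e (f + f') - (e f + e f') \<in> U n"
      unfolding e_def iota_simps[symmetric] lookup_add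
      by (intro iota_IS s_add pm.subspace_diff pm.subspace_add subspace_deg_eq s_deg)
    then have "gr_class (e (f + f')) = gr_class (e f) \<oplus>\<^bsub>GH\<^esub> gr_class (e f')"
      unfolding add_GH by (rule gr_class_eqI[OF e_deg pm.subspace_add[OF subspace_deg_eq e_deg e_deg]])
    then have "symbol_class (P (f + f')) = symbol_class (P f + P f')"
      unfolding P[symmetric] add_SG[symmetric] by (simp add: ring_iso_memE(3)[OF iso] carrier_GH)
    from \<delta>_symbol_class[OF this] show "\<Psi> (f + f') = \<Psi> f + \<Psi> f'"
      by (intro poly_mapping_eqI) (simp add: lookup_\<Psi> lookup_add linear_addD[OF \<delta>])
    have "e (vscale sy c f) - pm_scale c (e f) \<in> U n"
      unfolding e_def iota_simps[symmetric] lookup_vscale[OF vs]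
      by (intro iota_IS s_scale pm.subspace_diff pm.subspace_scale subspace_deg_eq s_deg)
    then have "gr_class (e (vscale sy c f)) = c \<odot>\<^bsub>GH\<^esub> gr_class (e f)"
      unfolding smult_GH by (rule gr_class_eqI[OF e_deg pm.subspace_scale[OF subspace_deg_eq e_deg]])
    then have "symbol_class (P (vscale sy c f)) = symbol_class (pm_scale c (P f))"
      unfolding P[symmetric] smult_SG[symmetric] by (simp add: \<phi>_scale carrier_GH)
    from \<delta>_symbol_class[OF this] show "\<Psi> (vscale sy c f) = vscale sy c (\<Psi> f)"
      by (intro poly_mapping_eqI) (simp add: lookup_\<Psi> lookup_vscale[OF vs] linear_scaleD[OF \<delta>])
  qed
  moreover have "surj \<Psi>"
  proof (rule surjI)
    fix t :: "'g \<Rightarrow>\<^sub>0 'y"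
    \<comment> \<open>Compatibility of the isomorphism with the gradings is used here: the preimage
      is homogeneous of degree \<open>n\<close>, so modulo \<open>U n\<close> it is some
      \<open>e f\<close>.\<close>
    have "symbol_class (e t) \<in> \<phi> ` gr_class ` deg_eq wd n"
      using e_deg[of t] unfolding grading_GH[symmetric] \<phi>_grading grading_SG by blast
    then obtain p where p: "p \<in> deg_eq wd n" "symbol_class (e t) = \<phi> (gr_class p)" by blast
    define f :: "'g \<Rightarrow>\<^sub>0 'y" where "f = Abs_poly_mapping (\<lambda>h. \<delta> (symbol h p))"
    have lookup_f: "lookup f h = \<delta> (symbol h p)" for h
      unfolding f_def by (subst lookup_Abs_poly_mapping) simp_all
    have "p - iota (\<lambda>h. symbol h p) \<in> U n"
      using rewrite_hcomp[of n p] hcomp_id[OF p(1)] hcomp_id[OF symbol_deg_eq[OF p(1)]] by (simp add: iota_def)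
    moreover have "iota (\<lambda>h. symbol h p) - e f \<in> U n"
      unfolding e_def iota_simps[symmetric] lookup_f
      by (intro iota_IS span pm.subspace_diff subspace_deg_eq symbol_deg_eq p s_deg)
    ultimately have "p - e f \<in> U n"
      using pm.subspace_add[OF subspace_U] by fastforce
    then have "gr_class p = gr_class (e f)"
      by (rule gr_class_eqI[OF p(1) e_deg])
    then have "symbol_class (P f) = symbol_class (e t)"
      by (simp add: p P[symmetric])
    from \<delta>_symbol_class[OF this] have "\<Psi> f = t"
      by (intro poly_mapping_eqI) (simp add: lookup_\<Psi> e_def symbol_iota \<delta>_s)
    then show "\<Psi> (SOME f. \<Psi> f = t) = t" by (rule someI)
  qed
  ultimately have inj: "inj \<Psi>"
    using finite_dimensional_vscale[OF fd] finite_dimensional_vector_space.linear_surj_imp_inj by blast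
  \<comment> \<open>As \<open>s\<close> is additive only modulo \<open>IS\<close>,
    \<open>e 0\<close> need not vanish; it suffices that it lies in \<open>U n\<close>.\<close>
  have "s 0 \<in> IS"
    using rel_ideal_uminus[OF s_add[of 0 0]] by simp
  then have "e 0 \<in> U n"
    unfolding e_def by (intro iota_IS) (simp_all add: s_deg)
  then have "gr_class (e f) = gr_class (e 0)"
    using f by (intro gr_class_eqI[OF e_deg e_deg] pm.subspace_diff[OF subspace_U]) (simp_all add: e_def)
  then have "symbol_class (P f) = symbol_class (P 0)"
    by (simp flip: P)
  from \<delta>_symbol_class[OF this] have "\<Psi> f = \<Psi> 0"
    by (intro poly_mapping_eqI) (simp add: lookup_\<Psi>)
  then show "f = 0"
    using inj by (simp add: inj_eq)
qed

text \<open>The case \<open>n = 0\<close> with \<open>Y = k\<close>, where \<open>\<delta>\<close>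
  is the constant coefficient: kG embeds into H.\<close>

lemma group_alg_independent:
  assumes "PBW_property scale act lam kap" "group_alg_embed a \<in> IH"
  shows "a = 0"
proof (rule symbols_independent[where sy = "(*)" and n = 0 and s = "\<lambda>c. single [] c" and \<delta> = "\<lambda>p. lookup p []"])
  interpret k: vector_space "(*) :: 'k \<Rightarrow> 'k \<Rightarrow> 'k"
    by unfold_locales (simp_all add: algebra_simps)
  have "k.independent {1}" by (simp add: k.dependent_single)
  moreover have "k.span {1} = UNIV" by (auto simp: k.span_singleton)
  ultimately show "finite_dimensional_vector_space ((*) :: 'k \<Rightarrow> 'k \<Rightarrow> 'k) {1}"
    by unfold_locales simp_all
  show "Vector_Spaces.linear pm_scale (*) (\<lambda>p :: 'v list \<Rightarrow>\<^sub>0 'k. lookup p [])"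
    by (simp add: Vector_Spaces.linear_iff pm.vector_space_axioms k.vector_space_axioms lookup_add)
  have Cons: "lookup (gen x * p) [] = 0" "lookup (p * gen x) [] = 0" for x and p :: "'v list \<Rightarrow>\<^sub>0 'k"
  proof -
    have "[] \<notin> keys (gen x * p)" "[] \<notin> keys (p * gen x)"
      using keys_mult[of "gen x :: 'v list \<Rightarrow>\<^sub>0 'k" p] keys_mult[of p "gen x"] by auto
    then show "lookup (gen x * p) [] = 0" "lookup (p * gen x) [] = 0" by (simp_all add: in_keys_iff)
  qed
  have "IS \<subseteq> {q. lookup q [] = 0}"
    by (rule IS_subset)
       (auto intro!: pm.subspaceI simp: Cons lookup_add lookup_minus lookup_single mult_single simp del: zero_list_eq)
  then show "lookup q [] = 0" if "q \<in> IS" for q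
    using that by blast
  show "q - single [] (lookup q []) \<in> IS" if "q \<in> deg_eq length 0" for q
  proof -
    have "q = single [] (lookup q [])"
      using that by (intro poly_mapping_eqI)
        (auto simp: lookup_single when_def deg_eq_def simp flip: not_in_keys_iff_lookup_eq_zero)
    then show ?thesis by (metis diff_self rel_ideal_zero)
  qed
  show "iota (\<lambda>g. single [] (lookup a g)) \<in> U 0"
    using assms(2) by (simp add: iota_def group_alg_embed_def mult_single U_zero)
qed (auto simp: assms deg_eq_def single_add)

text \<open>The case \<open>n = 1\<close> with \<open>Y = V\<close>, where \<open>\<delta>\<close>
  evaluates one-letter words as vectors. The kG part has degree 0 and lies in \<open>U 1\<close>, so
  the vector coefficients vanish first; then the case of degree 0 gives
  \<open>a = 0\<close>.\<close>

lemma deg_one_independent: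
  assumes "PBW_property scale act lam kap"
    "(\<Sum>g\<in>UNIV. gen (Inl (f g)) * gen (Inr g)) + group_alg_embed a \<in> IH"
  shows "f g = 0" "a = 0"
proof -
  define \<delta> :: "('v list \<Rightarrow>\<^sub>0 'k) \<Rightarrow> 'v" where "\<delta> = lin scale (\<lambda>w. if length w = 1 then hd w else 0)"
  have \<delta>: "Vector_Spaces.linear pm_scale scale \<delta>"
    unfolding \<delta>_def by (rule linear_lin[OF vector_space_axioms])
  have \<delta>_single: "\<delta> (single w c) = scale c (if length w = 1 then hd w else 0)" for w c
    unfolding \<delta>_def by (rule lin_single[OF vector_space_axioms])
  have \<delta>_mult: "\<delta> (gen x * p) = scale (lookup p []) x" "\<delta> (p * gen x) = scale (lookup p []) x"
    "lookup (gen x * p) [] = 0" "lookup (p * gen x) [] = 0" for x p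
  proof -
    have lin: "Vector_Spaces.linear pm_scale scale (\<lambda>p :: 'v list \<Rightarrow>\<^sub>0 'k. scale (lookup p []) x)"
      using vector_space_axioms
      by (simp add: Vector_Spaces.linear_iff pm.vector_space_axioms lookup_add scale_left_distrib)
    show "\<delta> (gen x * p) = scale (lookup p []) x"
      by (rule linear_eq_on_keys[where p = p and F = "\<lambda>p. \<delta> (gen x * p)", OF linear_pm_comp[OF linear_mult_left \<delta>] lin])
         (auto simp: mult_single \<delta>_single lookup_single when_def)
    show "\<delta> (p * gen x) = scale (lookup p []) x"
      by (rule linear_eq_on_keys[where p = p and F = "\<lambda>p. \<delta> (p * gen x)", OF linear_pm_comp[OF linear_mult_right \<delta>] lin])
         (auto simp: mult_single \<delta>_single lookup_single when_def)
    have "[] \<notin> keys (gen x * p)" "[] \<notin> keys (p * gen x)"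
      using keys_mult[of "gen x :: 'v list \<Rightarrow>\<^sub>0 'k" p] keys_mult[of p "gen x"] by auto
    then show "lookup (gen x * p) [] = 0" "lookup (p * gen x) [] = 0" by (simp_all add: in_keys_iff)
  qed
  \<comment> \<open>The constant coefficient is carried along because
    \<open>\<delta> (gen x * p)\<close> equals that coefficient of \<open>p\<close> times
    \<open>x\<close>.\<close>
  have "IS \<subseteq> {q. \<delta> q = 0 \<and> lookup q [] = 0}"
    by (rule IS_subset)
       (auto intro!: pm.subspaceI simp: \<delta>_mult lookup_add lookup_minus lookup_single \<delta>_single
         linear_addD[OF \<delta>] linear_diffD[OF \<delta>] linear_zeroD[OF \<delta>] linear_scaleD[OF \<delta>] mult_single)
  then have \<delta>_IS: "\<delta> q = 0" if "q \<in> IS" for q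
    using that by blast
  have span: "q - gen (\<delta> q) \<in> IS" if q: "q \<in> deg_eq length 1" for q
  proof -
    define A where "A = {v. [v] \<in> keys q}"
    have keys: "keys q = (\<lambda>v. [v]) ` A"
      using q by (auto simp: A_def deg_eq_def length_Suc_conv)
    then have fin: "finite A"
      by (metis finite_imageD finite_keys inj_onI list.inject)
    have inj: "inj_on (\<lambda>v. [v]) A" by (simp add: inj_on_def)
    have "q = (\<Sum>v\<in>A. pm_scale (lookup q [v]) (gen v))"
      by (subst poly_mapping_expand[of q]) (simp add: keys sum.reindex[OF inj])
    moreover have "\<delta> q = (\<Sum>v\<in>A. scale (lookup q [v]) v)"
      by (simp add: \<delta>_def lin_def keys sum.reindex[OF inj])
    ultimately show ?thesis
      using rel_ideal_uminus[OF IS_sum[OF fin, of "\<lambda>v. lookup q [v]"]] by simp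
  qed
  define f' where "f' = Abs_poly_mapping f"
  have f': "lookup f' g = f g" for g
    unfolding f'_def by (subst lookup_Abs_poly_mapping) simp_all
  have iota: "iota (\<lambda>g. gen (f g)) = (\<Sum>g\<in>UNIV. gen (Inl (f g)) * gen (Inr g))" for f
    by (simp add: iota_def)
  have "group_alg_embed a \<in> U 1"
    using group_alg_embed_deg[of a] by (intro deg_lt_U) (fastforce simp: deg_lt_def deg_le_def)
  from pm.subspace_diff[OF subspace_U IH_U[OF assms(2)] this]
  have "iota (\<lambda>g. gen (lookup f' g)) \<in> U 1"
    by (simp add: iota f')
  then have "f' = 0"
    by (rule symbols_independent[where sy = scale and By = B and n = 1 and s = gen and \<delta> = \<delta>, rotated -1])
       (auto simp: assms finite_dimensional_vector_space_axioms deg_eq_def IS_scale \<delta> \<delta>_IS \<delta>_single span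
          IS_add[unfolded diff_diff_eq] simp del: pm_scale_single)
  then show f: "f g = 0" for g
    using f'[of g] by simp
  have "gen (Inl 0) \<in> IH"
    using rel_ideal_uminus[OF IH_add[of 0 0]] by simp
  then have "(\<Sum>g\<in>UNIV. gen (Inl (f g)) * gen (Inr g)) \<in> IH"
    by (intro pm.subspace_sum subspace_rel_ideal rel_ideal_mult_right) (simp add: f)
  from rel_ideal_diff[OF assms(2) this] have "group_alg_embed a \<in> IH"
    by simp
  then show "a = 0"
    by (rule group_alg_independent[OF assms(1)])
qed

section \<open>Necessity\<close>

abbreviation V :: "'v \<Rightarrow> (('v + 'g) list \<Rightarrow>\<^sub>0 'k)" where
  "V v \<equiv> gen (Inl v)"

abbreviation X :: "'g \<Rightarrow> (('v + 'g) list \<Rightarrow>\<^sub>0 'k)" where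
  "X g \<equiv> gen (Inr g)"

abbreviation E :: "('g \<Rightarrow>\<^sub>0 'k) \<Rightarrow> (('v + 'g) list \<Rightarrow>\<^sub>0 'k)" where
  "E \<equiv> group_alg_embed"

text \<open>A general element of \<open>V \<otimes> kG\<close>, the degree one part of a normal
  form.\<close>

definition E1 :: "('g \<Rightarrow> 'v) \<Rightarrow> (('v + 'g) list \<Rightarrow>\<^sub>0 'k)" where
  "E1 f = (\<Sum>g\<in>UNIV. V (f g) * X g)"

text \<open>Equality in H, written on representatives so that computations there can be
  chained.\<close>

definition eqv :: "(('v + 'g) list \<Rightarrow>\<^sub>0 'k) \<Rightarrow> (('v + 'g) list \<Rightarrow>\<^sub>0 'k) \<Rightarrow> bool" (infix "\<approx>" 50) where
  "p \<approx> q \<longleftrightarrow> p - q \<in> IH"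

lemma eqv_refl [simp]: "p \<approx> p"
  and eqv_sym: "p \<approx> q \<Longrightarrow> q \<approx> p"
  and eqv_add: "p \<approx> q \<Longrightarrow> p' \<approx> q' \<Longrightarrow> p + p' \<approx> q + q'"
  and eqv_diff: "p \<approx> q \<Longrightarrow> p' \<approx> q' \<Longrightarrow> p - p' \<approx> q - q'"
  and eqv_mult_left: "p \<approx> q \<Longrightarrow> r * p \<approx> r * q"
  and eqv_mult_right: "p \<approx> q \<Longrightarrow> p * r \<approx> q * r"
  and eqv_scale: "p \<approx> q \<Longrightarrow> pm_scale c p \<approx> pm_scale c q"
  using rel_ideal_uminus[of "p - q" "H_rels scale act lam kap"] rel_ideal_add[of "p - q" "H_rels scale act lam kap" "p' - q'"]
    rel_ideal_diff[of "p - q" "H_rels scale act lam kap" "p' - q'"]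
    rel_ideal_mult_left[of "p - q" "H_rels scale act lam kap" r] rel_ideal_mult_right[of "p - q" "H_rels scale act lam kap" r]
    rel_ideal_scale[of "p - q" "H_rels scale act lam kap" c]
  by (simp_all add: eqv_def algebra_simps pm.scale_right_diff_distrib)

lemma eqv_trans [trans]: "p \<approx> q \<Longrightarrow> q \<approx> r \<Longrightarrow> p \<approx> r"
  unfolding eqv_def using rel_ideal_add[of "p - q" "H_rels scale act lam kap" "q - r"] by simp

lemma eqv_eq_trans [trans]: "p \<approx> q \<Longrightarrow> q = r \<Longrightarrow> p \<approx> r"
  and eq_eqv_trans [trans]: "p = q \<Longrightarrow> q \<approx> r \<Longrightarrow> p \<approx> r"
  by simp_all

lemma eqv_sum: "(\<And>i. i \<in> A \<Longrightarrow> p i \<approx> q i) \<Longrightarrow> sum p A \<approx> sum q A"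
  unfolding eqv_def sum_subtractf[symmetric] by (rule pm.subspace_sum[OF subspace_rel_ideal])

lemma V_add: "V (v + w) \<approx> V v + V w"
  and V_scale: "V (scale c v) \<approx> pm_scale c (V v)"
  and X_mult: "X g * X h \<approx> X (g + h)"
  and V_commute: "V v * V w - V w * V v \<approx> E (kap v w)"
  and X_V: "X g * V v \<approx> V (act g v) * X g + E (lam (grp g) v)"
  unfolding eqv_def using IH_add[of v w] IH_scale[of c v] IH_group[of g h] IH_commute[of v w] IH_act[of g v]
  by (simp_all add: diff_diff_eq)

lemma V_diff: "V (v - w) \<approx> V v - V w"
proof -
  have "V (v - w) + V w - V w \<approx> V (v - w + w) - V w"
    by (intro eqv_diff eqv_refl eqv_sym[OF V_add])
  then show ?thesis by simp
qed

lemma E_linear: "Vector_Spaces.linear pm_scale pm_scale E"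
  by (rule linear_pmI)
     (simp_all add: group_alg_embed_def lookup_add pm.scale_left_distrib sum.distrib pm.scale_sum_right del: pm_scale_single)

lemma E_grp: "E (grp g) = X g"
proof -
  have "E (grp g) = (\<Sum>h\<in>UNIV. if h = g then X g else 0)"
    unfolding group_alg_embed_def by (rule sum.cong) (auto simp: lookup_single when_def)
  then show ?thesis by simp
qed

lemmas E_simps = linear_addD[OF E_linear] linear_diffD[OF E_linear] linear_zeroD[OF E_linear] linear_scaleD[OF E_linear]
  linear_sumD[OF E_linear]

lemma E_expand: "E a = (\<Sum>g\<in>UNIV. pm_scale (lookup a g) (X g))"
  by (simp add: group_alg_embed_def)

lemma group_alg_expand: "a = (\<Sum>g\<in>UNIV. pm_scale (lookup a g) (grp g))" for a :: "'g \<Rightarrow>\<^sub>0 'k"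
  by (rule poly_mapping_eqI) (simp add: lookup_sum lookup_single when_def)

lemma E_mult: "E a * E b \<approx> E (a * b)"
proof -
  have "E a * E b = (\<Sum>g\<in>UNIV. \<Sum>h\<in>UNIV. pm_scale (lookup a g * lookup b h) (X g * X h))"
    by (simp add: E_expand sum_product pm_scale_mult_left pm_scale_mult_right mult.commute del: pm_scale_single)
  also have "\<dots> \<approx> (\<Sum>g\<in>UNIV. \<Sum>h\<in>UNIV. pm_scale (lookup a g * lookup b h) (X (g + h)))"
    by (intro eqv_sum eqv_scale X_mult)
  also have "\<dots> = E ((\<Sum>g\<in>UNIV. pm_scale (lookup a g) (grp g)) * (\<Sum>h\<in>UNIV. pm_scale (lookup b h) (grp h)))"
    by (simp add: sum_product E_simps pm_scale_mult_left pm_scale_mult_right mult_single[of _ 1 _ 1] E_grp mult.commute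
        del: pm_scale_single)
  finally show ?thesis
    by (simp only: group_alg_expand[symmetric])
qed

lemma E1_add: "E1 (\<lambda>h. f h + f' h) \<approx> E1 f + E1 f'"
  unfolding E1_def sum.distrib[symmetric] distrib_right[symmetric] by (intro eqv_sum eqv_mult_right V_add)

lemma E1_diff: "E1 (\<lambda>h. f h - f' h) \<approx> E1 f - E1 f'"
  unfolding E1_def sum_subtractf[symmetric] left_diff_distrib[symmetric] by (intro eqv_sum eqv_mult_right V_diff)

text \<open>The normal form of an element of kG times a vector: vectors stand on the left, and the
  remainder lies in kG.\<close>

lemma E_V: "E a * V v \<approx> E1 (\<lambda>h. scale (lookup a h) (act h v)) + E (lam a v)"
proof -
  have "E a * V v = (\<Sum>g\<in>UNIV. pm_scale (lookup a g) (X g * V v))"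
    by (simp add: E_expand sum_distrib_right pm_scale_mult_left del: pm_scale_single)
  also have "\<dots> \<approx> (\<Sum>g\<in>UNIV. pm_scale (lookup a g) (V (act g v) * X g + E (lam (grp g) v)))"
    by (intro eqv_sum eqv_scale X_V)
  also have "\<dots> = (\<Sum>g\<in>UNIV. pm_scale (lookup a g) (V (act g v)) * X g)
      + E (lam (\<Sum>g\<in>UNIV. pm_scale (lookup a g) (grp g)) v)"
    by (simp add: pm.scale_right_distrib sum.distrib pm_scale_mult_left E_simps linear_sumD[OF lam_linear(1)]
        linear_scaleD[OF lam_linear(1)] del: pm_scale_single)
  also have "\<dots> \<approx> E1 (\<lambda>h. scale (lookup a h) (act h v)) + E (lam a v)"
    unfolding E1_def group_alg_expand[symmetric]
    by (intro eqv_add eqv_sum eqv_mult_right eqv_sym[OF V_scale] eqv_refl)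
  finally show ?thesis .
qed

lemma V_E: "V v * E a \<approx> E1 (\<lambda>h. scale (lookup a h) v)"
proof -
  have "V v * E a = (\<Sum>g\<in>UNIV. pm_scale (lookup a g) (V v) * X g)"
    by (simp add: E_expand sum_distrib_left pm_scale_mult_right pm_scale_mult_left del: pm_scale_single)
  also have "\<dots> \<approx> E1 (\<lambda>h. scale (lookup a h) v)"
    unfolding E1_def by (intro eqv_sum eqv_mult_right eqv_sym[OF V_scale])
  finally show ?thesis .
qed

section \<open>Reading off the five conditions from identities in H\<close>

context
  assumes pbw: "PBW_property scale act lam kap"
begin

lemma E_eqv: "E a \<approx> E b \<Longrightarrow> a = b"
  using group_alg_independent[OF pbw, of "a - b"] by (simp add: eqv_def E_simps)

lemma E1_E_eqv_zero:
  assumes "E1 f + E a \<approx> 0"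
  shows "f g = 0" "a = 0"
  using deg_one_independent[OF pbw, of f a] assms by (simp_all add: eqv_def E1_def)

lemma PBW_imp_cond1: "lam (grp (g + h)) v = lam (grp g) (act h v) * grp h + grp g * lam (grp h) v"
proof -
  have "X g * X h * V v \<approx> X (g + h) * V v"
    by (intro eqv_mult_right X_mult)
  also have "\<dots> \<approx> V (act (g + h) v) * X (g + h) + E (lam (grp (g + h)) v)"
    by (rule X_V)
  finally have 1: "X g * X h * V v \<approx> V (act (g + h) v) * X (g + h) + E (lam (grp (g + h)) v)" .
  have "X g * X h * V v = X g * (X h * V v)"
    by (rule mult.assoc)
  also have "\<dots> \<approx> X g * (V (act h v) * X h + E (lam (grp h) v))"
    by (intro eqv_mult_left X_V)
  also have "\<dots> = X g * V (act h v) * X h + E (grp g) * E (lam (grp h) v)"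
    by (simp only: distrib_left mult.assoc E_grp)
  also have "\<dots> \<approx> (V (act g (act h v)) * X g + E (lam (grp g) (act h v))) * X h + E (grp g * lam (grp h) v)"
    by (intro eqv_add eqv_mult_right X_V E_mult)
  also have "\<dots> = V (act (g + h) v) * (X g * X h) + E (lam (grp g) (act h v)) * E (grp h) + E (grp g * lam (grp h) v)"
    by (simp only: distrib_right mult.assoc act_plus E_grp)
  also have "\<dots> \<approx> V (act (g + h) v) * X (g + h) + E (lam (grp g) (act h v) * grp h) + E (grp g * lam (grp h) v)"
    by (intro eqv_add eqv_mult_left X_mult E_mult eqv_refl)
  \<comment> \<open>The common degree one term is subtracted so that only an identity in kG remains,
    where \<open>E_eqv\<close> applies.\<close>
  finally have "V (act (g + h) v) * X (g + h) + E (lam (grp (g + h)) v) - V (act (g + h) v) * X (g + h)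
      \<approx> V (act (g + h) v) * X (g + h) + E (lam (grp g) (act h v) * grp h) + E (grp g * lam (grp h) v)
        - V (act (g + h) v) * X (g + h)"
    by (intro eqv_diff eqv_refl eqv_trans[OF eqv_sym[OF 1]])
  then show ?thesis
    by (intro E_eqv) (simp add: E_simps)
qed

lemma PBW_imp_cond23:
  "scale (lookup (lam (grp g) v) h) (act h u - act g u) = scale (lookup (lam (grp g) u) h) (act h v - act g v)"
  "kap (act g u) (act g v) * grp g - grp g * kap u v = lam (lam (grp g) v) u - lam (lam (grp g) u) v"
proof -
  let ?l = "\<lambda>u h. lookup (lam (grp g) u) h"
  \<comment> \<open>The quadratic term is left unsorted: antisymmetrised in \<open>u\<close> and
    \<open>v\<close> it becomes a commutator, and only lower terms need a normal form.\<close>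
  have XVV: "X g * (V u * V v) \<approx> V (act g u) * V (act g v) * X g + E1 (\<lambda>h. scale (?l v h) (act g u))
      + (E1 (\<lambda>h. scale (?l u h) (act h v)) + E (lam (lam (grp g) u) v))" for u v
  proof -
    have "X g * (V u * V v) = X g * V u * V v"
      by (simp only: mult.assoc)
    also have "\<dots> \<approx> (V (act g u) * X g + E (lam (grp g) u)) * V v"
      by (intro eqv_mult_right X_V)
    also have "\<dots> = V (act g u) * (X g * V v) + E (lam (grp g) u) * V v"
      by (simp only: distrib_right mult.assoc)
    also have "\<dots> \<approx> V (act g u) * (V (act g v) * X g + E (lam (grp g) v))
        + (E1 (\<lambda>h. scale (?l u h) (act h v)) + E (lam (lam (grp g) u) v))"
      by (intro eqv_add eqv_mult_left X_V E_V)
    also have "\<dots> = V (act g u) * V (act g v) * X g + V (act g u) * E (lam (grp g) v)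
        + (E1 (\<lambda>h. scale (?l u h) (act h v)) + E (lam (lam (grp g) u) v))"
      by (simp only: distrib_left mult.assoc)
    also have "\<dots> \<approx> V (act g u) * V (act g v) * X g + E1 (\<lambda>h. scale (?l v h) (act g u))
      + (E1 (\<lambda>h. scale (?l u h) (act h v)) + E (lam (lam (grp g) u) v))"
      by (intro eqv_add eqv_refl V_E)
    finally show ?thesis .
  qed
  let ?f = "\<lambda>h. (scale (?l v h) (act g u) + scale (?l u h) (act h v)) - (scale (?l u h) (act g v) + scale (?l v h) (act h u))"
  let ?W = "(V (act g u) * V (act g v) - V (act g v) * V (act g u)) * X g"
  have "E (grp g * kap u v) \<approx> X g * E (kap u v)"
    using eqv_sym[OF E_mult[of "grp g" "kap u v"]] by (simp only: E_grp)
  also have "\<dots> \<approx> X g * (V u * V v - V v * V u)"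
    by (intro eqv_mult_left eqv_sym[OF V_commute])
  also have "\<dots> = X g * (V u * V v) - X g * (V v * V u)"
    by (rule right_diff_distrib)
  also have "\<dots> \<approx> V (act g u) * V (act g v) * X g + E1 (\<lambda>h. scale (?l v h) (act g u))
      + (E1 (\<lambda>h. scale (?l u h) (act h v)) + E (lam (lam (grp g) u) v))
     - (V (act g v) * V (act g u) * X g + E1 (\<lambda>h. scale (?l u h) (act g v))
      + (E1 (\<lambda>h. scale (?l v h) (act h u)) + E (lam (lam (grp g) v) u)))"
    by (intro eqv_diff XVV)
  also have "\<dots> = ?W + ((E1 (\<lambda>h. scale (?l v h) (act g u)) + E1 (\<lambda>h. scale (?l u h) (act h v)))
      - (E1 (\<lambda>h. scale (?l u h) (act g v)) + E1 (\<lambda>h. scale (?l v h) (act h u))))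
      + E (lam (lam (grp g) u) v - lam (lam (grp g) v) u)"
    by (simp add: E_simps algebra_simps)
  \<comment> \<open>The commutator \<open>?W\<close> is the only quadratic contribution; the
    relation for \<open>act g u\<close> and \<open>act g v\<close> brings it down to degree
    0.\<close>
  also have "\<dots> \<approx> E (kap (act g u) (act g v) * grp g)
      + ((E1 (\<lambda>h. scale (?l v h) (act g u)) + E1 (\<lambda>h. scale (?l u h) (act h v)))
      - (E1 (\<lambda>h. scale (?l u h) (act g v)) + E1 (\<lambda>h. scale (?l v h) (act h u))))
      + E (lam (lam (grp g) u) v - lam (lam (grp g) v) u)"
  proof (intro eqv_add eqv_refl)
    have "?W \<approx> E (kap (act g u) (act g v)) * E (grp g)"
      unfolding E_grp by (intro eqv_mult_right V_commute)
    also have "\<dots> \<approx> E (kap (act g u) (act g v) * grp g)"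
      by (rule E_mult)
    finally show "?W \<approx> E (kap (act g u) (act g v) * grp g)" .
  qed
  also have "\<dots> \<approx> E (kap (act g u) (act g v) * grp g) + E1 ?f
      + E (lam (lam (grp g) u) v - lam (lam (grp g) v) u)"
    by (intro eqv_add eqv_refl eqv_sym[OF eqv_trans[OF E1_diff eqv_diff[OF E1_add E1_add]]])
  finally have "E (grp g * kap u v) - E (grp g * kap u v) \<approx> E (kap (act g u) (act g v) * grp g) + E1 ?f
      + E (lam (lam (grp g) u) v - lam (lam (grp g) v) u) - E (grp g * kap u v)"
    by (intro eqv_diff eqv_refl)
  then have "0 \<approx> E1 ?f + E (kap (act g u) (act g v) * grp g - grp g * kap u v - (lam (lam (grp g) v) u - lam (lam (grp g) u) v))"
    by (simp add: E_simps algebra_simps)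
  \<comment> \<open>The identity splits by degree: the vector part is condition 3, the kG part
    condition 2.\<close>
  from E1_E_eqv_zero[OF eqv_sym[OF this]]
  have 3: "?f h = 0" and 2: "kap (act g u) (act g v) * grp g - grp g * kap u v - (lam (lam (grp g) v) u - lam (lam (grp g) u) v) = 0"
    by blast+
  show "scale (lookup (lam (grp g) v) h) (act h u - act g u) = scale (lookup (lam (grp g) u) h) (act h v - act g v)"
    using 3 by (simp add: scale_right_diff_distrib algebra_simps)
  show "kap (act g u) (act g v) * grp g - grp g * kap u v = lam (lam (grp g) v) u - lam (lam (grp g) u) v"
    using 2 by simp
qed

lemma PBW_imp_cond45:
  "scale (lookup (kap u v) g) (act g w - w) + scale (lookup (kap v w) g) (act g u - u)
    + scale (lookup (kap w u) g) (act g v - v) = 0"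
  "lam (kap u v) w + lam (kap v w) u + lam (kap w u) v = 0"
proof -
  let ?d = "\<lambda>u v w h. scale (lookup (kap u v) h) (act h w) - scale (lookup (kap u v) h) w"
  have comm: "(V u * V v - V v * V u) * V w - V w * (V u * V v - V v * V u)
      \<approx> E1 (?d u v w) + E (lam (kap u v) w)" for u v w
  proof -
    have "(V u * V v - V v * V u) * V w - V w * (V u * V v - V v * V u) \<approx> E (kap u v) * V w - V w * E (kap u v)"
      by (intro eqv_diff eqv_mult_left eqv_mult_right V_commute)
    also have "\<dots> \<approx> E1 (\<lambda>h. scale (lookup (kap u v) h) (act h w)) + E (lam (kap u v) w) - E1 (\<lambda>h. scale (lookup (kap u v) h) w)"
      by (intro eqv_diff E_V V_E)
    also have "\<dots> = (E1 (\<lambda>h. scale (lookup (kap u v) h) (act h w)) - E1 (\<lambda>h. scale (lookup (kap u v) h) w)) + E (lam (kap u v) w)"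
      by simp
    also have "\<dots> \<approx> E1 (?d u v w) + E (lam (kap u v) w)"
      by (intro eqv_add eqv_refl eqv_sym[OF E1_diff])
    finally show ?thesis .
  qed
  have AC: "(a + b) + (c + d) + (e + f) = (a + c + e) + (b + d + f)" for a b c d e f :: "('v + 'g) list \<Rightarrow>\<^sub>0 'k"
    by (simp add: add_ac)
  \<comment> \<open>The Jacobi identity already holds in the free algebra; evaluating each double
    commutator in H turns it into a statement about normal forms.\<close>
  have "0 = ((V u * V v - V v * V u) * V w - V w * (V u * V v - V v * V u))
    + ((V v * V w - V w * V v) * V u - V u * (V v * V w - V w * V v))
    + ((V w * V u - V u * V w) * V v - V v * (V w * V u - V u * V w))"
    by (simp add: algebra_simps)
  also have "\<dots> \<approx> (E1 (?d u v w) + E (lam (kap u v) w)) + (E1 (?d v w u) + E (lam (kap v w) u))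
      + (E1 (?d w u v) + E (lam (kap w u) v))"
    by (rule eqv_add[OF eqv_add[OF comm comm] comm])
  also have "\<dots> = (E1 (?d u v w) + E1 (?d v w u) + E1 (?d w u v))
      + E (lam (kap u v) w + lam (kap v w) u + lam (kap w u) v)"
    unfolding E_simps(1) by (rule AC)
  also have "\<dots> \<approx> E1 (\<lambda>h. ?d u v w h + ?d v w u h + ?d w u v h) + E (lam (kap u v) w + lam (kap v w) u + lam (kap w u) v)"
  proof (rule eqv_add[OF eqv_sym eqv_refl])
    have "E1 (\<lambda>h. ?d u v w h + ?d v w u h + ?d w u v h) \<approx> E1 (\<lambda>h. ?d u v w h + ?d v w u h) + E1 (?d w u v)"
      by (rule E1_add)
    also have "\<dots> \<approx> E1 (?d u v w) + E1 (?d v w u) + E1 (?d w u v)"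
      by (rule eqv_add[OF E1_add eqv_refl])
    finally show "E1 (\<lambda>h. ?d u v w h + ?d v w u h + ?d w u v h) \<approx> E1 (?d u v w) + E1 (?d v w u) + E1 (?d w u v)" .
  qed
  finally have *: "E1 (\<lambda>h. ?d u v w h + ?d v w u h + ?d w u v h) + E (lam (kap u v) w + lam (kap v w) u + lam (kap w u) v) \<approx> 0"
    by (rule eqv_sym)
  show "scale (lookup (kap u v) g) (act g w - w) + scale (lookup (kap v w) g) (act g u - u)
    + scale (lookup (kap w u) g) (act g v - v) = 0"
    using E1_E_eqv_zero(1)[OF *, of g] by (simp only: scale_right_diff_distrib)
  show "lam (kap u v) w + lam (kap v w) u + lam (kap w u) v = 0"
    by (rule E1_E_eqv_zero(2)[OF *])
qed

end

end

theorem theorem3p1: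
  fixes scale :: "'k::field \<Rightarrow> 'v::ab_group_add \<Rightarrow> 'v"
    and B :: "'v set"
    and act :: "'g::{group_add,finite} \<Rightarrow> 'v \<Rightarrow> 'v"
    and lam :: "('g \<Rightarrow>\<^sub>0 'k) \<Rightarrow> 'v \<Rightarrow> ('g \<Rightarrow>\<^sub>0 'k)"
    and kap :: "'v \<Rightarrow> 'v \<Rightarrow> ('g \<Rightarrow>\<^sub>0 'k)"
  assumes "finite_dimensional_vector_space scale B"
    and "linear_action scale act"
    and "bilinear_map pm_scale scale pm_scale lam"
    and "bilinear_map scale scale pm_scale kap"
    and "\<And>v. kap v v = 0"
  shows "PBW_property scale act lam kap \<longleftrightarrow>
    (\<forall>g h u v w.
      lam (grp (g + h)) v = lam (grp g) (act h v) * grp h + grp g * lam (grp h) v \<and>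
      kap (act g u) (act g v) * grp g - grp g * kap u v =
        lam (lam (grp g) v) u - lam (lam (grp g) u) v \<and>
      scale (Poly_Mapping.lookup (lam (grp g) v) h) (act h u - act g u) =
        scale (Poly_Mapping.lookup (lam (grp g) u) h) (act h v - act g v) \<and>
      scale (Poly_Mapping.lookup (kap u v) g) (act g w - w) +
        scale (Poly_Mapping.lookup (kap v w) g) (act g u - u) +
        scale (Poly_Mapping.lookup (kap w u) g) (act g v - v) = 0 \<and>
      lam (kap u v) w + lam (kap v w) u + lam (kap w u) v = 0)"
    (is "?PBW \<longleftrightarrow> ?conds")
proof -
  interpret finite_dimensional_vector_space scale B by fact
  interpret skew_data scale B act lam kap
    by unfold_locales (use assms in auto)
  show ?thesis
  proof
    assume ?PBW
    then show ?conds
      by (intro allI conjI) (rule PBW_imp_cond1 PBW_imp_cond23 PBW_imp_cond45, assumption)+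
  next
    assume conds: ?conds
    interpret pbw_data scale B act lam kap
      by unfold_locales (use conds in blast)+
    show ?PBW by (rule PBW)
  qed
qed

end
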